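(* Let $m\ge1$, $I=[0,1]$ and $t_*\in I$. For all $\phi\in\Pi^{2m-1}$, $$\phi(t_* )\,\mathrm{Vol}(M^{2m-1})=\frac{2}{(2m-1)!(m-1)!}\int_{I^{m-1}}(\Sigma\phi)(t)\,\mathcal{H}(t_*,t)\,dt+\frac{\phi(0)}{(2m-1)!(m-1)!}\int_{I^{m-1}}\mathcal{J}^c_{ou}(t_*,t)\,dt+\frac{\phi(1)}{(2m-1)!(m-1)!}\int_{I^{m-1}}\mathcal{J}^c_{ol}(t_*,t)\,dt,$$ and for all $\phi\in\Pi^{2m}$, $$\phi(t_* )\,\mathrm{Vol}(M^{2m})=-\frac{2}{(2m)!m!}\int_{I^m}(\Sigma\phi)(t)\bigl(\mathcal{J}^c_{el}(t_*,t)-\mathcal{J}^c_{el}(0,t)\bigr)dt-\frac{2}{(2m)!(m-1)!}\int_{I^{m-1}}(\Sigma\phi)(t)\,\mathcal{J}^c_{eu}(t_*,t)\,dt$$ $$\qquad+\frac{\phi(0)}{(2m)!m!}\int_{I^m}\mathcal{J}^c_{el}(t_*,t)\,dt-\frac{\phi(1)}{(2m)!(m-1)!}\int_{I^{m-1}}\mathcal{J}^c_{eu}(t_*,t)\,dt .$$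
   Context: $\Pi^n$ is the space of real polynomials in one variable of degree at most $n$. $M^n\subset\mathbb{R}^n$ is the set of vectors $(\mathbb{E}_{t\sim\mu}[t^i])_{i=1}^n$ as $\mu$ ranges over Borel probability measures on $[0,1]$, and $\mathrm{Vol}$ is $n$-dimensional Lebesgue measure. For $\phi:I\to\mathbb{R}$ and $t\in I^N$, $(\Sigma\phi)(t):=\sum_{j=1}^N\phi(t_j)$ ($N$ being the dimension of the domain of integration). $\Delta_N(t):=\prod_{1\le j<k\le N}(t_k-t_j)$, $\Delta_N^4(t)=(\Delta_N(t))^4$. Empty products equal $1$, empty sums $0$, and integration over $I^0$ is evaluation. Define $$\mathcal{J}^c_{ol}(t_*,t):=t_*\prod_{j=1}^{m-1}(t_j-t_* )^2\prod_{j=1}^{m-1}t_j^2\cdot\Delta_{m-1}^4(t),\quad \mathcal{J}^c_{ou}(t_*,t):=(1-t_* )\prod_{j=1}^{m-1}(t_j-t_* )^2\prod_{j=1}^{m-1}(1-t_j)^2\cdot\Delta_{m-1}^4(t)\quad (t\in I^{m-1}),$$ $$\mathcal{J}^c_{el}(t_*,t):=\prod_{j=1}^{m}(t_j-t_* )^2\cdot\Delta_m^4(t)\ (t\in I^m),\quad \mathcal{J}^c_{eu}(t_*,t):=t_*(1-t_* )\prod_{j=1}^{m-1}(t_j-t_* )^2\prod_{j=1}^{m-1}t_j^2(1-t_j)^2\cdot\Delta_{m-1}^4(t)\ (t\in I^{m-1}),$$ $$\mathcal{H}(t_*,t):=\mathcal{J}^c_{ou}(0,t)-\mathcal{J}^c_{ol}(t_*,t)-\mathcal{J}^c_{ou}(t_*,t)\quad(t\in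 I^{m-1}).$$ *)

theory Defs
  imports "HOL-Probability.Probability" "HOL-Computational_Algebra.Polynomial"
begin

text \<open>
  Vectors in \<open>\<real>\<^sup>n\<close> are functions \<open>nat \<Rightarrow> real\<close> on the index set \<open>{1..n}\<close>, equal to
  \<^const>\<open>undefined\<close> outside it. This is the underlying space of the product measure below,
  which for \<open>n = 0\<close> is the unit mass at the only point.
\<close>

definition lborel_pow :: "nat \<Rightarrow> (nat \<Rightarrow> real) measure" where
  "lborel_pow n = Pi\<^sub>M {1..n} (\<lambda>_. lborel)"

definition unit_cube :: "nat \<Rightarrow> (nat \<Rightarrow> real) set" where
  "unit_cube n = Pi\<^sub>E {1..n} (\<lambda>_. {0..1})"

definition cube_integral :: "nat \<Rightarrow> ((nat \<Rightarrow> real) \<Rightarrow> real) \<Rightarrow> real" where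
  "cube_integral n f = (LINT t:unit_cube n|lborel_pow n. f t)"

definition moment_space :: "nat \<Rightarrow> (nat \<Rightarrow> real) set" where
  "moment_space n =
     {(\<lambda>i\<in>{1..n}. \<integral>t. t ^ i \<partial>\<mu>) | \<mu> :: real measure.
        prob_space \<mu> \<and> sets \<mu> = sets (restrict_space borel {0..1})}"

text \<open>
  Lebesgue measure is taken on the Borel sets, without completion; this suffices because
  the moment spaces are compact.
\<close>

definition vol :: "nat \<Rightarrow> (nat \<Rightarrow> real) set \<Rightarrow> real" where
  "vol n A = measure (lborel_pow n) A"

definition Sigma_sum :: "nat \<Rightarrow> (real \<Rightarrow> real) \<Rightarrow> (nat \<Rightarrow> real) \<Rightarrow> real" where
  "Sigma_sum n \<phi> t = (\<Sum>j=1..n. \<phi> (t j))"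

definition Vdm :: "nat \<Rightarrow> (nat \<Rightarrow> real) \<Rightarrow> real" where
  "Vdm n t = (\<Prod>(j, k)\<in>{(j, k). 1 \<le> j \<and> j < k \<and> k \<le> n}. t k - t j)"

text \<open>The functions below are meant for \<open>m \<ge> 1\<close>, so that \<open>m - 1\<close> is not truncated.\<close>

definition Jc_ol :: "nat \<Rightarrow> real \<Rightarrow> (nat \<Rightarrow> real) \<Rightarrow> real" where
  "Jc_ol m s t =
     s * (\<Prod>j=1..m-1. (t j - s)^2) * (\<Prod>j=1..m-1. (t j)^2) * (Vdm (m-1) t)^4"

definition Jc_ou :: "nat \<Rightarrow> real \<Rightarrow> (nat \<Rightarrow> real) \<Rightarrow> real" where
  "Jc_ou m s t =
     (1 - s) * (\<Prod>j=1..m-1. (t j - s)^2) * (\<Prod>j=1..m-1. (1 - t j)^2) * (Vdm (m-1) t)^4"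

definition Jc_el :: "nat \<Rightarrow> real \<Rightarrow> (nat \<Rightarrow> real) \<Rightarrow> real" where
  "Jc_el m s t = (\<Prod>j=1..m. (t j - s)^2) * (Vdm m t)^4"

definition Jc_eu :: "nat \<Rightarrow> real \<Rightarrow> (nat \<Rightarrow> real) \<Rightarrow> real" where
  "Jc_eu m s t =
     s * (1 - s) * (\<Prod>j=1..m-1. (t j - s)^2) * (\<Prod>j=1..m-1. (t j)^2 * (1 - t j)^2)
       * (Vdm (m-1) t)^4"

definition Hc :: "nat \<Rightarrow> real \<Rightarrow> (nat \<Rightarrow> real) \<Rightarrow> real" where
  "Hc m s t = Jc_ou m 0 t - Jc_ol m s t - Jc_ou m s t"

end

theory Submission
  imports Defs "HOL-Computational_Algebra.Fundamental_Theorem_Algebra"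
begin

text \<open>
  For fixed \<open>t\<close>, Hermite interpolation of \<open>\<phi>\<close> at \<open>s\<close> with double nodes \<open>t\<^sub>j\<close> and the simple nodes
  \<open>0, 1\<close> (odd case) or \<open>0\<close> (even case), multiplied by the weight \<open>J\<^sup>c\<^sub>o\<^sub>u(0, t)\<close> or \<open>J\<^sup>c\<^sub>e\<^sub>l(0, t)\<close>, has
  polynomial coefficients: at \<open>0\<close> and \<open>1\<close> they are the functions \<open>J\<^sup>c(s, t)\<close>, at \<open>\<phi>'(t\<^sub>j)\<close> there is
  some \<open>K\<^sub>j\<close>, and at \<open>\<phi>(t\<^sub>j)\<close> there is exactly \<open>- \<partial>\<^sub>j K\<^sub>j\<close>. Integrating over \<open>t\<close>, by parts in the \<open>j\<close>-th
  variable, gives both formulas, with the integral of the weight in place of the volume.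

  This integral is a Selberg integral with exponent \<open>4\<close>, which Aomoto's recursion evaluates. The
  volume of the moment space is evaluated by the substitution of canonical moments, which is
  triangular with polynomial entries and maps the unit cube onto the moment space up to a null set.
  Both are products of the Beta values \<open>(k!)\<^sup>2 / (2 k + 1)!\<close>.
\<close>

section \<open>Integration over the unit cube\<close>

text \<open>The weight clears the denominators of Hermite interpolation. Let W be the polynomial of
  the simple nodes and g the product of W and all (x - t i)^2 with i \<noteq> j. The basis
  polynomial of \<phi>'(t j) is (s - t j) g(s) / g(t j), and that of \<phi>(t j) has the denominator
  g(t j)^2. So the weight should contain g(t j)^2 for every j; this explains the factors W(t j)^2
  and the fourth power of the Vandermonde product. Then K j is (s - t j) g(s) g(t j) times a factor
  free of t j, and its derivative is minus the coefficient of \<phi>(t j).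

  Integrating the terms with \<phi>' by parts doubles those with \<phi>, hence the factor 2. This
  leaves \<phi>(t j) times the j-th derivative of K j, whereas the theorem has \<Sigma>\<phi> times
  a difference of weights. By the case \<phi> = 1 of the interpolation that difference is minus the
  sum of these derivatives, and for i \<noteq> j the mixed term with \<phi>(t i) is an exact
  derivative in t j, which leaves boundary values only. These vanish at an end that is a simple
  node; only the even case, where 1 is not a node, keeps some.\<close>

declare One_nat_def [simp del]

text \<open>With a probability measure on each coordinate the cube integral becomes an expectation,
  for which bounded functions are integrable.\<close>

definition unif :: "real measure" where "unif = density lborel (indicator {0..1})"

lemma prob_space_unif: "prob_space unif"
  unfolding unif_def by (rule prob_spaceI) (simp add: emeasure_density)

interpretation unif: prob_space unif by (rule prob_space_unif)

interpretation unif_prod: product_prob_space "\<lambda>_::nat. unif" UNIV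
  by unfold_locales

interpretation lborel_prod: product_sigma_finite "\<lambda>_::nat. lborel :: real measure"
  by unfold_locales

lemma sets_unif [measurable_cong, simp]: "sets unif = sets borel"
  by (simp add: unif_def)

lemma space_unif [simp]: "space unif = UNIV"
  by (simp add: unif_def)

lemma emeasure_unif: "A \<in> sets borel \<Longrightarrow> emeasure unif A = emeasure lborel ({0..1} \<inter> A)"
  unfolding unif_def by (subst emeasure_density) (auto simp: indicator_inter_arith[symmetric] nn_integral_indicator)

lemma AE_unif_cube: "AE x in unif. x \<in> {0..1}"
  unfolding unif_def by (subst AE_density) (auto simp: indicator_eq_0_iff zero_less_iff_neq_zero)

lemma AE_unif_neq: "AE x in unif. x \<noteq> c"
proof (rule AE_I)
  show "emeasure unif {c} = 0"
    using emeasure_mono[of "{0..1} \<inter> {c}" "{c}" lborel] by (simp add: emeasure_unif)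
qed auto

lemma integral_unif:
  fixes f :: "real \<Rightarrow> real"
  assumes [measurable]: "f \<in> borel_measurable borel"
  shows "integral\<^sup>L unif f = (LBINT x. f x * indicator {0..1} x)"
  using integral_density[of f lborel "indicator {0..1}"]
  by (simp add: unif_def ennreal_indicator mult.commute)

lemma integral_unif_deriv:
  fixes F f :: "real \<Rightarrow> real"
  assumes "\<And>x. (F has_real_derivative f x) (at x)" "continuous_on UNIV f"
  shows "integral\<^sup>L unif f = F 1 - F 0"
proof -
  have "continuous (at x) f" for x
    using assms(2) by (simp add: continuous_on_eq_continuous_at)
  then show ?thesis
    using integral_FTC_Icc_real[of 0 1 F f] assms(1)
    by (subst integral_unif) (auto intro: borel_measurable_continuous_onI assms(2))
qed

lemma integrable_unif_continuous:
  fixes f :: "real \<Rightarrow> real"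
  assumes f: "continuous_on UNIV f"
  shows "integrable unif f"
proof -
  have [measurable]: "f \<in> borel_measurable borel"
    using f by (rule borel_measurable_continuous_onI)
  have "bounded (f ` {0..1})"
    by (intro compact_imp_bounded compact_continuous_image continuous_on_subset[OF f]) auto
  then obtain B where B: "\<And>x. x \<in> {0..1} \<Longrightarrow> norm (f x) \<le> B"
    by (force simp: bounded_iff)
  show ?thesis
    by (rule unif.integrable_const_bound[of _ B]) (use AE_unif_cube B in auto)
qed

section \<open>The cube integral as an integral over a product probability space\<close>

definition cube_measure :: "nat \<Rightarrow> (nat \<Rightarrow> real) measure" where
  "cube_measure n = Pi\<^sub>M {1..n} (\<lambda>_. unif)"

lemma prob_space_cube: "prob_space (cube_measure n)"
  unfolding cube_measure_def by (intro prob_space_PiM prob_space_unif)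

lemma sets_cube_measure [measurable_cong, simp]: "sets (cube_measure n) = sets (Pi\<^sub>M {1..n} (\<lambda>_. borel))"
  unfolding cube_measure_def by (intro sets_PiM_cong) auto

lemma unit_cube_sets [measurable]: "unit_cube n \<in> sets (Pi\<^sub>M {1..n} (\<lambda>_. borel))"
  unfolding unit_cube_def by (intro sets_PiM_I_finite) auto

lemma sets_lborel_pow [measurable_cong, simp]: "sets (lborel_pow n) = sets (Pi\<^sub>M {1..n} (\<lambda>_. borel))"
  unfolding lborel_pow_def by (intro sets_PiM_cong) auto

text \<open>A product measure is determined by its values on boxes, and intersecting a box with the
  cube intersects each of its sides with the unit interval.\<close>

lemma cube_measure_eq_density: "cube_measure n = density (lborel_pow n) (indicator (unit_cube n))"
proof -
  have "density (lborel_pow n) (indicator (unit_cube n)) = Pi\<^sub>M {1..n} (\<lambda>_. unif)"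
  proof (rule unif_prod.PiM_eqI)
    show "sets (density (lborel_pow n) (indicator (unit_cube n))) = sets (Pi\<^sub>M {1..n} (\<lambda>_. unif))"
      using sets_cube_measure[of n] by (simp add: cube_measure_def)
    fix A assume A: "\<And>i. i \<in> {1..n} \<Longrightarrow> A i \<in> sets unif"
    have P: "Pi\<^sub>E {1..n} A \<in> sets (Pi\<^sub>M {1..n} (\<lambda>_. borel :: real measure))"
      by (intro sets_PiM_I_finite) (use A in auto)
    have "emeasure (density (lborel_pow n) (indicator (unit_cube n))) (Pi\<^sub>E {1..n} A)
        = emeasure (lborel_pow n) (unit_cube n \<inter> Pi\<^sub>E {1..n} A)"
      using P by (subst emeasure_density) (auto simp: indicator_inter_arith[symmetric] intro!: nn_integral_indicator)
    also have "unit_cube n \<inter> Pi\<^sub>E {1..n} A = Pi\<^sub>E {1..n} (\<lambda>i. {0..1} \<inter> A i)"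
      by (auto simp: unit_cube_def PiE_Int)
    also have "emeasure (lborel_pow n) \<dots> = (\<Prod>i\<in>{1..n}. emeasure unif (A i))"
      unfolding lborel_pow_def
      by (subst lborel_prod.emeasure_PiM) (use A in \<open>auto simp: emeasure_unif\<close>)
    finally show "emeasure (density (lborel_pow n) (indicator (unit_cube n))) (Pi\<^sub>E {1..n} A)
      = (\<Prod>i\<in>{1..n}. emeasure unif (A i))" .
  qed auto
  then show ?thesis by (simp add: cube_measure_def)
qed

lemma cube_integral_eq:
  assumes "f \<in> borel_measurable (Pi\<^sub>M {1..n} (\<lambda>_. borel))"
  shows "cube_integral n f = integral\<^sup>L (cube_measure n) f"
  unfolding cube_integral_def set_lebesgue_integral_def cube_measure_eq_density
  by (subst integral_density[where g="indicator (unit_cube n)", symmetric])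
     (use assms in \<open>auto simp: ennreal_indicator measurable_cong_sets[OF sets_lborel_pow refl]\<close>)

text \<open>Continuity refers to the product topology on \<open>nat \<Rightarrow> real\<close>.\<close>

lemma measurable_continuous_fun:
  fixes f :: "(nat \<Rightarrow> real) \<Rightarrow> real"
  assumes "continuous_on UNIV f"
  shows "f \<in> borel_measurable (Pi\<^sub>M {1..n} (\<lambda>_. borel))"
proof -
  have "(\<lambda>x. x) \<in> Pi\<^sub>M {1..n} (\<lambda>_. borel :: real measure) \<rightarrow>\<^sub>M borel"
  proof (rule measurable_coordinatewise_then_product)
    fix i
    show "(\<lambda>x. x i) \<in> borel_measurable (Pi\<^sub>M {1..n} (\<lambda>_. borel :: real measure))"
    proof (cases "i \<in> {1..n}")
      \<comment> \<open>Points of the product space are extensional, so a coordinate outside the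
        index set is the constant \<open>undefined\<close>.\<close>
      case False
      then have "(\<lambda>x. x i) \<in> borel_measurable (Pi\<^sub>M {1..n} (\<lambda>_. borel :: real measure))
         \<longleftrightarrow> (\<lambda>x. undefined :: real) \<in> borel_measurable (Pi\<^sub>M {1..n} (\<lambda>_. borel :: real measure))"
        using False by (intro measurable_cong) ( auto simp: space_PiM PiE_def extensional_def)
      then show ?thesis by simp
    qed measurable
  qed
  from measurable_compose[OF this borel_measurable_continuous_onI[OF assms]] show ?thesis by simp
qed

text \<open>Within the space of all functions the cube is a full product of compact factors, with
  the factor \<open>{undefined}\<close> at each index outside \<open>{1..n}\<close>, so Tychonoff's
  theorem applies.\<close>

lemma compact_unit_cube: "compact (unit_cube n)"
proof -
  have "compact (Pi\<^sub>E UNIV (\<lambda>i. if i \<in> {1..n} then {0..1} else {undefined :: real}))"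
    using compactin_PiE[of "\<lambda>_. euclidean :: real topology" UNIV
        "\<lambda>i. if i \<in> {1..n} then {0..1} else {undefined :: real}"]
    by (simp add: euclidean_product_topology compactin_euclidean_iff)
  also have "Pi\<^sub>E UNIV (\<lambda>i. if i \<in> {1..n} then {0..1} else {undefined :: real}) = unit_cube n"
    by (auto simp: unit_cube_def PiE_def Pi_def extensional_def split: if_splits)
  finally show ?thesis .
qed

lemma AE_cube: "AE t in cube_measure n. t \<in> unit_cube n"
  unfolding cube_measure_eq_density
  by (subst AE_density) (auto simp: indicator_eq_0_iff zero_less_iff_neq_zero)

lemma integrable_cube:
  fixes f :: "(nat \<Rightarrow> real) \<Rightarrow> real"
  assumes f: "continuous_on UNIV f"
  shows "integrable (cube_measure n) f"
proof -
  interpret prob_space "cube_measure n" by (rule prob_space_cube)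
  have m: "f \<in> borel_measurable (cube_measure n)"
    using measurable_continuous_fun[OF f] by (simp cong: measurable_cong_sets)
  have "bounded (f ` unit_cube n)"
    by (intro compact_imp_bounded compact_continuous_image continuous_on_subset[OF f] compact_unit_cube) auto
  then obtain B where B: "\<And>x. x \<in> unit_cube n \<Longrightarrow> norm (f x) \<le> B"
    by (auto simp: bounded_iff)
  show ?thesis
    by (rule integrable_const_bound[of _ B]) (use AE_cube[of n] B m in auto)
qed

lemma cube_integral_continuous:
  assumes "continuous_on UNIV f"
  shows "cube_integral n f = integral\<^sup>L (cube_measure n) f"
  by (intro cube_integral_eq measurable_continuous_fun assms)

lemma cube_integral_add:
  assumes "continuous_on UNIV f" "continuous_on UNIV g"
  shows "cube_integral n (\<lambda>t. f t + g t) = cube_integral n f + cube_integral n g"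
  using assms
  by (simp add: cube_integral_continuous continuous_on_add integrable_cube)

lemma cube_integral_diff:
  assumes "continuous_on UNIV f" "continuous_on UNIV g"
  shows "cube_integral n (\<lambda>t. f t - g t) = cube_integral n f - cube_integral n g"
  using assms
  by (simp add: cube_integral_continuous continuous_on_diff integrable_cube)

lemma cube_integral_cmult [simp]: "cube_integral n (\<lambda>t. c * f t) = c * cube_integral n f"
  unfolding cube_integral_def by simp

lemma cube_integral_minus [simp]: "cube_integral n (\<lambda>t. - f t) = - cube_integral n f"
  using cube_integral_cmult[of n "-1" f] by simp

lemma cube_integral_sum:
  assumes "\<And>i. i \<in> A \<Longrightarrow> continuous_on UNIV (f i)"
  shows "cube_integral n (\<lambda>t. \<Sum>i\<in>A. f i t) = (\<Sum>i\<in>A. cube_integral n (f i))"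
proof -
  have "cube_integral n (\<lambda>t. \<Sum>i\<in>A. f i t) = integral\<^sup>L (cube_measure n) (\<lambda>t. \<Sum>i\<in>A. f i t)"
    by (intro cube_integral_continuous continuous_on_sum assms)
  also have "\<dots> = (\<Sum>i\<in>A. integral\<^sup>L (cube_measure n) (f i))"
    by (intro Bochner_Integration.integral_sum integrable_cube assms)
  finally show ?thesis
    using assms by (simp add: cube_integral_continuous)
qed

section \<open>Null sets, symmetry and integration by parts on the cube\<close>

lemma AE_cube_coord_neq:
  assumes "i \<in> {1..n}" shows "AE t in cube_measure n. t i \<noteq> c"
proof -
  have "AE t in Pi\<^sub>M {1..n} (\<lambda>_. unif). t i \<noteq> c"
    by (rule AE_PiM_component) (use assms AE_unif_neq prob_space_unif in auto)
  then show ?thesis by (subst cube_measure_def)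
qed

text \<open>Made for pointwise identities from interpolation, which fail when a double node falls on
  one of the finitely many simple nodes in \<open>Z\<close>; the excluded hyperplanes are
  null.\<close>

lemma cube_integral_cong:
  fixes f g :: "(nat \<Rightarrow> real) \<Rightarrow> real"
  assumes fg: "continuous_on UNIV f" "continuous_on UNIV g" and Z: "finite Z"
    and eq: "\<And>t. (\<And>i. i \<in> {1..n} \<Longrightarrow> t i \<notin> Z) \<Longrightarrow> f t = g t"
  shows "cube_integral n f = cube_integral n g"
proof -
  have "AE t in cube_measure n. \<forall>i\<in>{1..n}. \<forall>z\<in>Z. t i \<noteq> z"
    using Z AE_cube_coord_neq by (intro AE_finite_allI) auto
  then have "AE t in cube_measure n. f t = g t"
    by eventually_elim (rule eq, blast)
  then show ?thesis
    unfolding fg[THEN cube_integral_continuous]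
    by (intro integral_cong_AE)
       (use fg[THEN measurable_continuous_fun] in \<open>auto cong: measurable_cong_sets\<close>)
qed

text \<open>All factors of the product measure are equal, so reindexing preserves it. The equation
  is asked for extensional points, which make up the space; for these
  \<open>t \<circ> transpose i j\<close> is again extensional.\<close>

lemma cube_integral_permute:
  fixes f :: "(nat \<Rightarrow> real) \<Rightarrow> real"
  assumes f: "continuous_on UNIV f" and "i \<in> {1..n}" "j \<in> {1..n}"
    and eq: "\<And>t. t \<in> extensional {1..n} \<Longrightarrow> g t = f (t \<circ> Transposition.transpose i j)"
  shows "cube_integral n g = cube_integral n f"
proof -
  define \<pi> where "\<pi> = Transposition.transpose i j"
  have pi: "bij_betw \<pi> {1..n} {1..n}"
    unfolding \<pi>_def bij_betw_transpose_iff using assms by auto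
  have inj: "inj_on \<pi> {1..n}" and fs: "\<pi> \<in> {1..n} \<rightarrow> {1..n}"
    using pi by (auto simp: bij_betw_def)
  have out: "\<pi> k = k" if "k \<notin> {1..n}" for k
    using that assms(2,3) by (auto simp: \<pi>_def Transposition.transpose_def)
  have D: "distr (cube_measure n) (cube_measure n) (\<lambda>\<omega>. \<lambda>k\<in>{1..n}. \<omega> (\<pi> k)) = cube_measure n"
    using distr_PiM_reindex[of "{1..n}" "\<lambda>_. unif" \<pi> "{1..n}"] inj fs prob_space_unif
    by (simp add: cube_measure_def)
  have meas: "(\<lambda>\<omega>. \<lambda>k\<in>{1..n}. \<omega> (\<pi> k)) \<in> cube_measure n \<rightarrow>\<^sub>M cube_measure n"
    unfolding cube_measure_def
    by (intro measurable_restrict measurable_component_singleton) (use fs in auto)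
  have mf: "f \<in> borel_measurable (cube_measure n)"
    using measurable_continuous_fun[OF f] by (simp cong: measurable_cong_sets)
  have *: "f (\<lambda>k\<in>{1..n}. \<omega> (\<pi> k)) = g \<omega>" if "\<omega> \<in> space (cube_measure n)" for \<omega>
  proof -
    have ext: "\<omega> \<in> extensional {1..n}"
      using that by (auto simp: cube_measure_def space_PiM PiE_def)
    have "(\<lambda>k\<in>{1..n}. \<omega> (\<pi> k)) = \<omega> \<circ> \<pi>"
      using ext out by (auto simp: fun_eq_iff extensional_def)
    then show ?thesis using eq[OF ext] by (simp add: \<pi>_def)
  qed
  have "integral\<^sup>L (cube_measure n) f
      = integral\<^sup>L (distr (cube_measure n) (cube_measure n) (\<lambda>\<omega>. \<lambda>k\<in>{1..n}. \<omega> (\<pi> k))) f"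
    by (subst D) simp
  also have "\<dots> = integral\<^sup>L (cube_measure n) g"
    by (subst integral_distr[OF meas mf]) (auto intro!: Bochner_Integration.integral_cong *)
  finally have "integral\<^sup>L (cube_measure n) g = integral\<^sup>L (cube_measure n) f" ..
  moreover have "g \<in> borel_measurable (Pi\<^sub>M {1..n} (\<lambda>_. borel))"
    using measurable_compose[OF meas mf] *
    by (subst measurable_cong[where g="\<lambda>\<omega>. f (\<lambda>k\<in>{1..n}. \<omega> (\<pi> k))"])
       (auto simp: cube_measure_def space_PiM cong: measurable_cong_sets)
  ultimately show ?thesis
    using cube_integral_continuous[OF f] by (simp add: cube_integral_eq)
qed

lemma cube_integral_Suc:
  fixes f :: "(nat \<Rightarrow> real) \<Rightarrow> real"
  assumes f: "continuous_on UNIV f"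
  shows "cube_integral (Suc n) f = integral\<^sup>L (cube_measure n) (\<lambda>t. \<integral>x. f (t(Suc n := x)) \<partial>unif)"
proof -
  have "integrable (cube_measure (Suc n)) f" by (rule integrable_cube[OF f])
  then have "integral\<^sup>L (Pi\<^sub>M (insert (Suc n) {1..n}) (\<lambda>_. unif)) f
     = (\<integral>t. (\<integral>x. f (t(Suc n := x)) \<partial>unif) \<partial>Pi\<^sub>M {1..n} (\<lambda>_. unif))"
    by (intro unif_prod.product_integral_insert) (auto simp: cube_measure_def atLeastAtMostSuc_conv)
  then show ?thesis
    by (simp add: cube_integral_continuous[OF f] cube_measure_def atLeastAtMostSuc_conv)
qed

text \<open>Integration by parts is always carried out in the last coordinate, which Fubini's
  theorem splits off; other coordinates are first swapped into its place.\<close>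

lemma cube_integral_deriv:
  fixes F f :: "(nat \<Rightarrow> real) \<Rightarrow> real"
  assumes f: "continuous_on UNIV f" and F: "continuous_on UNIV F"
    and der: "\<And>t x. ((\<lambda>x. F (t(Suc n := x))) has_real_derivative f (t(Suc n := x))) (at x)"
  shows "cube_integral (Suc n) f
    = cube_integral n (\<lambda>t. F (t(Suc n := 1))) - cube_integral n (\<lambda>t. F (t(Suc n := 0)))"
proof -
  have c: "continuous_on UNIV (\<lambda>x. t(Suc n := x))" for t :: "nat \<Rightarrow> real"
  proof (rule continuous_on_coordinatewise_then_product)
    show "continuous_on UNIV (\<lambda>x. (t(Suc n := x)) i)" for i
      by (cases "i = Suc n") auto
  qed
  have cu: "continuous_on UNIV (\<lambda>t :: nat \<Rightarrow> real. t(Suc n := c))" for c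
  proof (rule continuous_on_coordinatewise_then_product)
    show "continuous_on UNIV (\<lambda>t :: nat \<Rightarrow> real. (t(Suc n := c)) i)" for i
      by (cases "i = Suc n") auto
  qed
  have "(\<integral>x. f (t(Suc n := x)) \<partial>unif) = F (t(Suc n := 1)) - F (t(Suc n := 0))" for t
    by (rule integral_unif_deriv[OF der]) (rule continuous_on_compose2[OF f c], auto)
  moreover have "continuous_on UNIV (\<lambda>t. F (t(Suc n := c)))" for c
    by (rule continuous_on_compose2[OF F cu]) auto
  ultimately show ?thesis
    by (simp add: cube_integral_Suc[OF f] cube_integral_continuous integrable_cube)
qed

section \<open>Selberg integrals with exponent four\<close>

declare continuous_on_product_coordinates [continuous_intros]

abbreviation "swp \<equiv> Transposition.transpose"

section \<open>The fourth power of the Vandermonde product\<close>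

lemma Vdm_Suc: "Vdm (Suc n) t = Vdm n t * (\<Prod>j=1..n. t (Suc n) - t j)"
proof -
  let ?A = "{(j, k). 1 \<le> j \<and> j < k \<and> k \<le> n}"
  have fin: "finite ?A"
    by (rule finite_subset[of _ "{1..n} \<times> {1..n}"]) auto
  have "{(j, k). 1 \<le> j \<and> j < k \<and> k \<le> Suc n} = ?A \<union> (\<lambda>j. (j, Suc n)) ` {1..n}"
    by (auto simp: le_Suc_eq)
  then have "Vdm (Suc n) t = (\<Prod>(j, k)\<in>?A \<union> (\<lambda>j. (j, Suc n)) ` {1..n}. t k - t j)"
    by (simp add: Vdm_def)
  also have "\<dots> = Vdm n t * (\<Prod>(j, k)\<in>(\<lambda>j. (j, Suc n)) ` {1..n}. t k - t j)"
    unfolding Vdm_def by (rule prod.union_disjoint) (use fin in auto)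
  also have "(\<Prod>(j, k)\<in>(\<lambda>j. (j, Suc n)) ` {1..n}. t k - t j) = (\<Prod>j=1..n. t (Suc n) - t j)"
    by (subst prod.reindex) (auto simp: inj_on_def)
  finally show ?thesis .
qed

lemma Vdm_cong: "(\<And>i. i \<in> {1..n} \<Longrightarrow> t i = u i) \<Longrightarrow> Vdm n t = Vdm n u"
  unfolding Vdm_def by (intro prod.cong) auto

lemma Vdm_upd [simp]: "Vdm n (t(Suc n := x)) = Vdm n t"
  by (rule Vdm_cong) auto

lemma Vdm_0 [simp]: "Vdm 0 t = 1"
  unfolding Vdm_def by (rule prod.neutral) auto

text \<open>Over ordered pairs every unordered pair contributes its square twice. This form is
  visibly symmetric, while \<open>Vdm\<close> itself changes sign under a transposition.\<close>

lemma Vdm4_conv: "Vdm n t ^ 4 = (\<Prod>(i, j)\<in>{(i, j). i \<in> {1..n} \<and> j \<in> {1..n} \<and> i \<noteq> j}. (t i - t j)\<^sup>2)"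
proof -
  let ?A = "{(j, k). 1 \<le> j \<and> j < k \<and> k \<le> n}"
  have fin: "finite ?A"
    by (rule finite_subset[of _ "{1..n} \<times> {1..n}"]) auto
  have "{(i, j). i \<in> {1..n} \<and> j \<in> {1..n} \<and> i \<noteq> j} = ?A \<union> prod.swap ` ?A"
    by (force simp: image_iff)
  then have "(\<Prod>(i, j)\<in>{(i, j). i \<in> {1..n} \<and> j \<in> {1..n} \<and> i \<noteq> j}. (t i - t j)\<^sup>2)
     = (\<Prod>(i, j)\<in>?A \<union> prod.swap ` ?A. (t i - t j)\<^sup>2)" by simp
  also have "\<dots> = (\<Prod>(i, j)\<in>?A. (t i - t j)\<^sup>2) * (\<Prod>(i, j)\<in>prod.swap ` ?A. (t i - t j)\<^sup>2)"
    by (rule prod.union_disjoint) (use fin in auto)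
  also have "(\<Prod>(i, j)\<in>prod.swap ` ?A. (t i - t j)\<^sup>2) = (Vdm n t)\<^sup>2"
    unfolding Vdm_def by (subst prod.reindex) (auto simp: case_prod_unfold prod_power_distrib)
  also have "(\<Prod>(i, j)\<in>?A. (t i - t j)\<^sup>2) = (Vdm n t)\<^sup>2"
    unfolding Vdm_def prod_power_distrib by (intro prod.cong) (auto simp: power2_commute)
  finally show ?thesis by (simp flip: power_add)
qed

lemma Vdm4_permute:
  assumes bij: "bij_betw \<pi> {1..n} {1..n}"
  shows "Vdm n (t \<circ> \<pi>) ^ 4 = Vdm n t ^ 4"
proof -
  have conv: "Vdm n u ^ 4 = (\<Prod>i=1..n. \<Prod>j=1..n. if i \<noteq> j then (u i - u j)\<^sup>2 else 1)" for u
  proof -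
    have "{(i, j). i \<in> {1..n} \<and> j \<in> {1..n} \<and> i \<noteq> j} = {p \<in> {1..n} \<times> {1..n}. fst p \<noteq> snd p}"
      by (simp add: set_eq_iff split_beta conj_assoc)
    then have "Vdm n u ^ 4 = (\<Prod>p\<in>{1..n} \<times> {1..n}. if fst p \<noteq> snd p then (u (fst p) - u (snd p))\<^sup>2 else 1)"
      unfolding Vdm4_conv case_prod_unfold by (simp only:) (rule prod.inter_filter, simp)
    also have "\<dots> = (\<Prod>i=1..n. \<Prod>j=1..n. if i \<noteq> j then (u i - u j)\<^sup>2 else 1)"
      by (simp only: prod.cartesian_product case_prod_unfold)
    finally show ?thesis .
  qed
  have eq_iff: "i \<in> {1..n} \<Longrightarrow> j \<in> {1..n} \<Longrightarrow> \<pi> i = \<pi> j \<longleftrightarrow> i = j" for i j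
    using bij by (meson bij_betw_def inj_on_eq_iff)
  have "Vdm n (t \<circ> \<pi>) ^ 4 = (\<Prod>i=1..n. \<Prod>j=1..n. if \<pi> i \<noteq> \<pi> j then (t (\<pi> i) - t (\<pi> j))\<^sup>2 else 1)"
    unfolding conv by (intro prod.cong refl) (simp add: eq_iff)
  also have "\<dots> = (\<Prod>i=1..n. \<Prod>j=1..n. if \<pi> i \<noteq> j then (t (\<pi> i) - t j)\<^sup>2 else 1)"
    by (intro prod.cong refl prod.reindex_bij_betw[OF bij])
  also have "\<dots> = Vdm n t ^ 4"
    unfolding conv by (rule prod.reindex_bij_betw[OF bij])
  finally show ?thesis .
qed

lemma bij_swp: "i \<in> {1..n} \<Longrightarrow> j \<in> {1..n} \<Longrightarrow> bij_betw (swp i j) {1..n} {1..n}"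
  unfolding bij_betw_transpose_iff by auto

lemma prod_swp:
  fixes f :: "'b \<Rightarrow> 'a::comm_monoid_mult"
  shows "i \<in> {1..n} \<Longrightarrow> j \<in> {1..n} \<Longrightarrow> (\<Prod>k=1..n. f ((t \<circ> swp i j) k)) = (\<Prod>k=1..n. f (t k))"
  using prod.reindex_bij_betw[OF bij_swp, of i n j "\<lambda>k. f (t k)"] by simp

lemma sum_swp:
  fixes f :: "'b \<Rightarrow> 'a::comm_monoid_add"
  shows "i \<in> {1..n} \<Longrightarrow> j \<in> {1..n} \<Longrightarrow> (\<Sum>k=1..n. f ((t \<circ> swp i j) k)) = (\<Sum>k=1..n. f (t k))"
  using sum.reindex_bij_betw[OF bij_swp, of i n j "\<lambda>k. f (t k)"] by simp

lemma continuous_Vdm [continuous_intros]: "continuous_on UNIV (\<lambda>t. Vdm n t)"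
  unfolding Vdm_def by (intro continuous_on_prod) (auto intro!: continuous_intros)

text \<open>The right-hand side is a polynomial that vanishes where the two coordinates coincide, so
  the convention \<open>x / 0 = 0\<close> gives the continuous extension of the quotient.\<close>

lemma Vdm4_quotient:
  assumes "j \<in> {1..n}"
  shows "Vdm (Suc n) t ^ 4 / (t (Suc n) - t j)
    = Vdm n t ^ 4 * ((t (Suc n) - t j) ^ 3 * (\<Prod>i\<in>{1..n}-{j}. (t (Suc n) - t i) ^ 4))"
proof -
  have "(\<Prod>i=1..n. t (Suc n) - t i) ^ 4
     = (t (Suc n) - t j) ^ 4 * (\<Prod>i\<in>{1..n}-{j}. (t (Suc n) - t i) ^ 4)"
    using assms by (simp add: prod.remove[of _ j] power_mult_distrib prod_power_distrib)
  then have "Vdm (Suc n) t ^ 4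
     = Vdm n t ^ 4 * ((t (Suc n) - t j) ^ 4 * (\<Prod>i\<in>{1..n}-{j}. (t (Suc n) - t i) ^ 4))"
    by (simp add: Vdm_Suc power_mult_distrib)
  moreover have "v * (d ^ 4 * r) / d = v * (d ^ 3 * r)" for v d r :: real
    by (cases "d = 0") (simp_all add: power4_eq_xxxx power3_eq_cube)
  ultimately show ?thesis
    by (simp only:)
qed

lemma continuous_Vdm4_quotient:
  assumes "j \<in> {1..n}"
  shows "continuous_on UNIV (\<lambda>t. Vdm (Suc n) t ^ 4 / (t (Suc n) - t j))"
  unfolding Vdm4_quotient[OF assms] by (intro continuous_intros)

text \<open>Logarithmic differentiation, with the fourth power kept inside each quotient so that
  coordinates may coincide.\<close>

lemma Vdm4_has_derivative:
  "((\<lambda>x. Vdm (Suc n) (t(Suc n := x)) ^ 4) has_real_derivative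
     4 * (\<Sum>j=1..n. Vdm (Suc n) (t(Suc n := x)) ^ 4 / (x - t j))) (at x)"
proof -
  let ?u = "t(Suc n := x)"
  have eq: "Vdm (Suc n) (t(Suc n := y)) ^ 4 = Vdm n t ^ 4 * (\<Prod>j=1..n. (y - t j) ^ 4)" for y
    by (simp add: Vdm_Suc power_mult_distrib prod_power_distrib)
  have q: "Vdm (Suc n) ?u ^ 4 / (x - t j)
     = Vdm n t ^ 4 * ((x - t j) ^ 3 * (\<Prod>i\<in>{1..n}-{j}. (x - t i) ^ 4))" if "j \<in> {1..n}" for j
    using Vdm4_quotient[OF that, of ?u] that by simp
  have "((\<lambda>x. Vdm n t ^ 4 * (\<Prod>j=1..n. (x - t j) ^ 4)) has_real_derivative
     Vdm n t ^ 4 * (\<Sum>j=1..n. (4 * (x - t j) ^ 3) * (\<Prod>i\<in>{1..n}-{j}. (x - t i) ^ 4))) (at x)"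
    by (intro DERIV_cmult has_field_derivative_prod) (auto intro!: derivative_eq_intros)
  moreover have "Vdm n t ^ 4 * (\<Sum>j=1..n. (4 * (x - t j) ^ 3) * (\<Prod>i\<in>{1..n}-{j}. (x - t i) ^ 4))
      = 4 * (\<Sum>j=1..n. Vdm (Suc n) ?u ^ 4 / (x - t j))"
    unfolding sum_distrib_left by (intro sum.cong refl) (simp add: q mult_ac)
  ultimately show ?thesis
    by (simp only: eq)
qed

text \<open>In the usual parameters of Selberg's integral, \<alpha> = a + 1, \<beta> = b + 1 and
  \<gamma> = 2.\<close>

definition selberg_weight :: "nat \<Rightarrow> nat \<Rightarrow> nat \<Rightarrow> (nat \<Rightarrow> real) \<Rightarrow> real" where
  "selberg_weight a b n t = (\<Prod>j=1..n. t j ^ a * (1 - t j) ^ b) * Vdm n t ^ 4"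

definition selberg :: "nat \<Rightarrow> nat \<Rightarrow> nat \<Rightarrow> real" where
  "selberg a b n = cube_integral n (selberg_weight a b n)"

lemma continuous_selberg_weight [continuous_intros]: "continuous_on UNIV (\<lambda>t. selberg_weight a b n t)"
  unfolding selberg_weight_def by (intro continuous_intros)

lemma selberg_weight_swp:
  "i \<in> {1..n} \<Longrightarrow> j \<in> {1..n} \<Longrightarrow> selberg_weight a b n (t \<circ> swp i j) = selberg_weight a b n t"
  unfolding selberg_weight_def
  using prod_swp[of i n j "\<lambda>x. x ^ a * (1 - x) ^ b" t] Vdm4_permute[OF bij_swp, of i n j t] by simp

text \<open>Where two coordinates coincide the quotient below is \<open>0 / 0 = 0\<close>, which is its limit.\<close>

lemma selberg_weight_has_derivative:
  "((\<lambda>x. g x * selberg_weight a b (Suc n) (t(Suc n := x))) has_real_derivative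
     (\<Prod>j=1..n. t j ^ a * (1 - t j) ^ b) * h * Vdm (Suc n) (t(Suc n := x)) ^ 4
     + 4 * (\<Sum>j=1..n. g x * (selberg_weight a b (Suc n) (t(Suc n := x)) / (x - t j)))) (at x)"
  if "((\<lambda>x. g x * (x ^ a * (1 - x) ^ b)) has_real_derivative h) (at x)"
proof -
  let ?w = "\<Prod>j=1..n. t j ^ a * (1 - t j) ^ b"
  have eq: "g y * selberg_weight a b (Suc n) (t(Suc n := y))
     = ?w * (g y * (y ^ a * (1 - y) ^ b)) * Vdm (Suc n) (t(Suc n := y)) ^ 4" for y
    by (simp add: selberg_weight_def)
  have "((\<lambda>y. ?w * (g y * (y ^ a * (1 - y) ^ b)) * Vdm (Suc n) (t(Suc n := y)) ^ 4) has_real_derivative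
      (?w * h) * Vdm (Suc n) (t(Suc n := x)) ^ 4
      + (4 * (\<Sum>j=1..n. Vdm (Suc n) (t(Suc n := x)) ^ 4 / (x - t j))) * (?w * (g x * (x ^ a * (1 - x) ^ b)))) (at x)"
    by (intro DERIV_mult DERIV_cmult that Vdm4_has_derivative)
  moreover have "(4 * (\<Sum>j=1..n. Vdm (Suc n) (t(Suc n := x)) ^ 4 / (x - t j))) * (?w * (g x * (x ^ a * (1 - x) ^ b)))
      = 4 * (\<Sum>j=1..n. g x * (selberg_weight a b (Suc n) (t(Suc n := x)) / (x - t j)))"
    unfolding mult.assoc sum_distrib_right
    by (intro arg_cong[where f="(*) 4"] sum.cong refl) (simp only: times_divide_eq_right eq mult_ac times_divide_eq_left)
  ultimately show ?thesis
    by (simp only: eq)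
qed

section \<open>Aomoto's recursion\<close>

context
  fixes a b n :: nat
begin

abbreviation "wt \<equiv> selberg_weight a b (Suc n)"

lemma continuous_selberg_quotient:
  assumes "j \<in> {1..n}"
  shows "continuous_on UNIV (\<lambda>t. wt t / (t (Suc n) - t j))"
  unfolding selberg_weight_def times_divide_eq_right[symmetric]
  by (rule continuous_on_mult[OF _ continuous_Vdm4_quotient[OF assms]]) (intro continuous_intros)

lemma selberg_weight_coincide: "t (Suc n) = t j \<Longrightarrow> j \<in> {1..n} \<Longrightarrow> wt t = 0"
  by (auto simp: selberg_weight_def Vdm_Suc)

text \<open>Swapping the two coordinates fixes the weight and reverses the sign of the denominator.
  Averaging the two integrands therefore replaces \<open>g\<close> by half its antisymmetrization,
  where the denominator cancels.\<close>

lemma cube_integral_antisym: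
  assumes j: "j \<in> {1..n}" and g: "continuous_on UNIV g" and h: "continuous_on UNIV h"
    and eq: "\<And>t. g t - g (t \<circ> swp j (Suc n)) = (t (Suc n) - t j) * h t"
  shows "2 * cube_integral (Suc n) (\<lambda>t. g t * (wt t / (t (Suc n) - t j)))
    = cube_integral (Suc n) (\<lambda>t. h t * wt t)"
proof -
  let ?f = "\<lambda>t. g t * (wt t / (t (Suc n) - t j))"
  have jn: "j \<in> {1..Suc n}" "Suc n \<in> {1..Suc n}" using j by auto
  have cf: "continuous_on UNIV ?f"
    by (intro continuous_on_mult g continuous_selberg_quotient j)
  have ch: "continuous_on UNIV (\<lambda>t. h t * wt t)"
    by (intro continuous_on_mult h continuous_selberg_weight)
  have pt: "?f (t \<circ> swp j (Suc n)) = h t * wt t - ?f t" for t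
  proof (cases "t (Suc n) = t j")
    case True
    then show ?thesis using selberg_weight_coincide[OF True j] selberg_weight_swp[OF jn, of a b t] by simp
  next
    case False
    define D where "D = t (Suc n) - t j"
    have "D \<noteq> 0" "t j - t (Suc n) = - D" using False by (auto simp: D_def)
    moreover have "g (t \<circ> swp j (Suc n)) = g t - D * h t" using eq[of t] by (simp add: D_def)
    ultimately have "?f (t \<circ> swp j (Suc n)) = (g t - D * h t) * (wt t / (- D))"
      using selberg_weight_swp[OF jn, of a b t] by simp
    also have "\<dots> = h t * wt t - g t * (wt t / D)"
      using \<open>D \<noteq> 0\<close> by (simp add: field_simps)
    finally show ?thesis by (simp add: D_def)
  qed
  have "cube_integral (Suc n) (\<lambda>t. h t * wt t - ?f t) = cube_integral (Suc n) ?f"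
    by (rule cube_integral_permute[OF cf jn]) (simp only: pt)
  then have "cube_integral (Suc n) (\<lambda>t. h t * wt t) - cube_integral (Suc n) ?f = cube_integral (Suc n) ?f"
    by (simp only: cube_integral_diff[OF ch cf])
  then show ?thesis
    by (simp only: diff_eq_eq mult_2)
qed

text \<open>These integrals interpolate between the exponents \<open>b\<close> and
  \<open>b + 1\<close>: \<open>k = 0\<close> is the Selberg integral itself, and
  \<open>k = Suc n\<close> is the one with \<open>b + 1\<close>.\<close>

definition aomoto :: "nat \<Rightarrow> real" where
  "aomoto k = cube_integral (Suc n) (\<lambda>t. (\<Prod>i=1..k. 1 - t i) * wt t)"

text \<open>By the symmetry of the weight only the number of distinct factors counts, not the
  indices that they carry.\<close>

lemma aomoto_insert:
  assumes "k < i" "i \<le> Suc n"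
  shows "cube_integral (Suc n) (\<lambda>t. (1 - t i) * (\<Prod>l=1..k. 1 - t l) * wt t) = aomoto (Suc k)"
proof -
  have ik: "Suc k \<in> {1..Suc n}" "i \<in> {1..Suc n}" using assms by auto
  have pt: "(1 - t i) * (\<Prod>l=1..k. 1 - t l) * wt t
      = (\<Prod>l=1..Suc k. 1 - (t \<circ> swp (Suc k) i) l) * wt (t \<circ> swp (Suc k) i)" for t
  proof -
    have "(\<Prod>l=1..k. 1 - (t \<circ> swp (Suc k) i) l) = (\<Prod>l=1..k. 1 - t l)"
      by (rule prod.cong) (use assms in \<open>auto simp: Transposition.transpose_def\<close>)
    then have "(\<Prod>l=1..Suc k. 1 - (t \<circ> swp (Suc k) i) l) = (\<Prod>l=1..k. 1 - t l) * (1 - t i)"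
      by simp
    then show ?thesis
      by (simp only: selberg_weight_swp[OF ik] mult.commute)
  qed
  show ?thesis
    unfolding aomoto_def
    by (rule cube_integral_permute[OF _ ik], (intro continuous_intros)[1], rule pt)
qed

text \<open>With x and y the last and the j-th coordinate, the product already contains 1 - y, and x
  (1 - x) (1 - y) - y (1 - y) (1 - x) = (x - y) (1 - x) (1 - y).\<close>

lemma aomoto_quotient_le:
  assumes "j \<in> {1..k}" "k \<le> n"
  shows "2 * cube_integral (Suc n) (\<lambda>t. t (Suc n) * (1 - t (Suc n)) * (\<Prod>i=1..k. 1 - t i) * (wt t / (t (Suc n) - t j)))
    = aomoto (Suc k)"
proof -
  have "2 * cube_integral (Suc n) (\<lambda>t. t (Suc n) * (1 - t (Suc n)) * (\<Prod>i=1..k. 1 - t i) * (wt t / (t (Suc n) - t j)))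
    = cube_integral (Suc n) (\<lambda>t. (1 - t (Suc n)) * (\<Prod>i=1..k. 1 - t i) * wt t)"
  proof (rule cube_integral_antisym)
    fix t :: "nat \<Rightarrow> real"
    let ?t = "t \<circ> swp j (Suc n)"
    have "(\<Prod>i\<in>{1..k}-{j}. 1 - ?t i) = (\<Prod>i\<in>{1..k}-{j}. 1 - t i)"
      by (rule prod.cong) (use assms in \<open>auto simp: Transposition.transpose_def\<close>)
    then show "t (Suc n) * (1 - t (Suc n)) * (\<Prod>i=1..k. 1 - t i)
       - ?t (Suc n) * (1 - ?t (Suc n)) * (\<Prod>i=1..k. 1 - ?t i)
       = (t (Suc n) - t j) * ((1 - t (Suc n)) * (\<Prod>i=1..k. 1 - t i))"
      using assms by (simp add: prod.remove[of _ j] algebra_simps)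
  qed (use assms in \<open>auto intro!: continuous_intros\<close>)
  then show ?thesis using assms by (simp add: aomoto_insert)
qed

text \<open>Here the product contains neither coordinate, and x (1 - x) - y (1 - y) = (x - y) ((1 -
  x) + (1 - y) - 1).\<close>

lemma aomoto_quotient_gt:
  assumes "j \<in> {k<..n}"
  shows "2 * cube_integral (Suc n) (\<lambda>t. t (Suc n) * (1 - t (Suc n)) * (\<Prod>i=1..k. 1 - t i) * (wt t / (t (Suc n) - t j)))
    = 2 * aomoto (Suc k) - aomoto k"
proof -
  let ?P = "\<lambda>t :: nat \<Rightarrow> real. \<Prod>i=1..k. 1 - t i"
  let ?h = "\<lambda>t. ((1 - t (Suc n)) * ?P t + (1 - t j) * ?P t) - ?P t"
  have j: "j \<in> {1..n}" using assms by auto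
  have sym: "t (Suc n) * (1 - t (Suc n)) * ?P t
       - (t \<circ> swp j (Suc n)) (Suc n) * (1 - (t \<circ> swp j (Suc n)) (Suc n)) * ?P (t \<circ> swp j (Suc n))
       = (t (Suc n) - t j) * ?h t" for t
  proof -
    have P: "?P (t \<circ> swp j (Suc n)) = ?P t"
      by (rule prod.cong) (use assms in \<open>auto simp: Transposition.transpose_def\<close>)
    have "x * (1 - x) * p - y * (1 - y) * p = (x - y) * (((1 - x) * p + (1 - y) * p) - p)" for x y p :: real
      by (simp add: algebra_simps)
    then show ?thesis unfolding P by simp
  qed
  have "2 * cube_integral (Suc n) (\<lambda>t. t (Suc n) * (1 - t (Suc n)) * ?P t * (wt t / (t (Suc n) - t j)))
    = cube_integral (Suc n) (\<lambda>t. ?h t * wt t)"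
    by (rule cube_integral_antisym[OF j _ _ sym]) (intro continuous_intros)+
  also have "\<dots> = cube_integral (Suc n) (\<lambda>t. ((1 - t (Suc n)) * ?P t * wt t + (1 - t j) * ?P t * wt t) - ?P t * wt t)"
    by (simp only: ring_distribs)
  also have "\<dots> = (aomoto (Suc k) + aomoto (Suc k)) - aomoto k"
  proof -
    have "cube_integral (Suc n) (\<lambda>t. (1 - t (Suc n)) * ?P t * wt t) = aomoto (Suc k)"
      "cube_integral (Suc n) (\<lambda>t. (1 - t j) * ?P t * wt t) = aomoto (Suc k)"
      using assms by (auto intro!: aomoto_insert)
    then show ?thesis
      by (subst cube_integral_diff, (intro continuous_intros)+, subst cube_integral_add, (intro continuous_intros)+)
         (simp only: aomoto_def)
  qed
  finally show ?thesis by simp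
qed

text \<open>The derivative of x (1 - x) P \<open>wt\<close> in the last coordinate x has integral 0,
  since x (1 - x) vanishes at both ends; P is free of x because \<open>k \<le> n\<close>. The powers
  contribute (a + 1) (1 - x) - (b + 1) x = (a + b + 2) (1 - x) - (b + 1). The Vandermonde product
  contributes one quotient for each \<open>j \<le> n\<close>, of which \<open>k\<close> have j among
  the factors of P and \<open>n - k\<close> do not.\<close>

lemma aomoto_rec:
  assumes "k \<le> n"
  shows "(real a + b + 2 * n + 2 + 2 * real (n - k)) * aomoto (Suc k) = (real b + 1 + 2 * real (n - k)) * aomoto k"
proof -
  let ?P = "\<lambda>t :: nat \<Rightarrow> real. \<Prod>i=1..k. 1 - t i"
  let ?N = "Suc n"
  let ?F = "\<lambda>t :: nat \<Rightarrow> real. t ?N * (1 - t ?N) * ?P t * wt t"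
  let ?X = "\<lambda>j (t :: nat \<Rightarrow> real). t ?N * (1 - t ?N) * ?P t * (wt t / (t ?N - t j))"
  let ?f = "\<lambda>t :: nat \<Rightarrow> real. ((real a + 1) * (1 - t ?N) - (real b + 1) * t ?N) * ?P t * wt t + 4 * (\<Sum>j=1..n. ?X j t)"
  have cX: "continuous_on UNIV (?X j)" if "j \<in> {1..n}" for j
  proof -
    have "continuous_on UNIV (\<lambda>t. t ?N * (1 - t ?N) * ?P t)" by (intro continuous_intros)
    then show ?thesis by (rule continuous_on_mult[OF _ continuous_selberg_quotient[OF that]])
  qed
  have cS: "continuous_on UNIV (\<lambda>t. 4 * (\<Sum>j=1..n. ?X j t))"
    by (rule continuous_on_mult_left, rule continuous_on_sum, rule cX)
  have P: "?P (t(?N := x)) = ?P t" for t x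
    by (rule prod.cong) (use assms in auto)
  have "cube_integral ?N ?f = cube_integral n (\<lambda>t. ?F (t(?N := 1))) - cube_integral n (\<lambda>t. ?F (t(?N := 0)))"
  proof (rule cube_integral_deriv)
    show "continuous_on UNIV ?f"
      by (rule continuous_on_add[OF _ cS]) (intro continuous_intros)
    show "continuous_on UNIV ?F" by (intro continuous_intros)
    fix t :: "nat \<Rightarrow> real" and x :: real
    let ?h = "((real a + 1) * (1 - x) - (real b + 1) * x) * ?P t * (x ^ a * (1 - x) ^ b)"
    have d: "((\<lambda>x. 1 - x) has_real_derivative - 1) (at x)"
      by (auto intro!: derivative_eq_intros)
    have "((\<lambda>x. x ^ Suc a) has_real_derivative (real a + 1) * x ^ a) (at x)"
      "((\<lambda>x. (1 - x) ^ Suc b) has_real_derivative - (real b + 1) * (1 - x) ^ b) (at x)"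
      using DERIV_power_Suc[OF DERIV_ident, of a x UNIV] DERIV_power_Suc[OF d, of b]
      by (simp_all add: algebra_simps del: power_Suc)
    from DERIV_cmult[OF DERIV_mult[OF this], of "?P t"]
    have "((\<lambda>x. ?P t * (x ^ Suc a * (1 - x) ^ Suc b)) has_real_derivative
        ?P t * (x ^ Suc a * (- (real b + 1) * (1 - x) ^ b) + (real a + 1) * x ^ a * (1 - x) ^ Suc b)) (at x)"
      by (simp only: add.commute mult.commute)
    moreover have "p * (x ^ Suc a * (- (real b + 1) * y ^ b) + (real a + 1) * x ^ a * y ^ Suc b)
       = ((real a + 1) * y - (real b + 1) * x) * p * (x ^ a * y ^ b)" for p y
      by (simp add: algebra_simps)
    moreover have "(\<lambda>x. ?P t * (x ^ Suc a * (1 - x) ^ Suc b)) = (\<lambda>x. x * (1 - x) * ?P t * (x ^ a * (1 - x) ^ b))"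
      by (simp add: fun_eq_iff mult_ac)
    ultimately have "((\<lambda>x. x * (1 - x) * ?P t * (x ^ a * (1 - x) ^ b)) has_real_derivative ?h) (at x)"
      by (simp only:)
    from selberg_weight_has_derivative[OF this, of n t]
    show "((\<lambda>x. ?F (t(?N := x))) has_real_derivative ?f (t(?N := x))) (at x)"
      unfolding P
      by (rule back_subst[of "\<lambda>d. (d has_real_derivative _) _", OF back_subst[of "\<lambda>d. (_ has_real_derivative d) _"]])
         (auto simp: selberg_weight_def mult_ac intro!: sum.cong)
  qed
  also have "\<dots> = 0" by simp
  also have "cube_integral ?N ?f = cube_integral ?N (\<lambda>t. (((real a + b + 2) * ((1 - t ?N) * ?P t * wt t)
      - (real b + 1) * (?P t * wt t))) + 4 * (\<Sum>j=1..n. ?X j t))"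
    by (simp add: algebra_simps)
  also have "\<dots> = (real a + b + 2) * aomoto (Suc k) - (real b + 1) * aomoto k + 4 * (\<Sum>j=1..n. cube_integral ?N (?X j))"
  proof -
    let ?u = "\<lambda>t. (1 - t ?N) * ?P t * wt t" and ?v = "\<lambda>t. ?P t * wt t"
    have "cube_integral ?N ?u = aomoto (Suc k)"
      using assms by (intro aomoto_insert) auto
    moreover have "cube_integral ?N ?v = aomoto k" by (simp only: aomoto_def)
    moreover have "cube_integral ?N (\<lambda>t. 4 * (\<Sum>j=1..n. ?X j t)) = 4 * (\<Sum>j=1..n. cube_integral ?N (?X j))"
      by (simp only: cube_integral_cmult cube_integral_sum[OF cX])
    moreover have "cube_integral ?N (\<lambda>t. ((real a + b + 2) * ?u t - (real b + 1) * ?v t) + 4 * (\<Sum>j=1..n. ?X j t))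
        = cube_integral ?N (\<lambda>t. (real a + b + 2) * ?u t - (real b + 1) * ?v t) + cube_integral ?N (\<lambda>t. 4 * (\<Sum>j=1..n. ?X j t))"
      by (rule cube_integral_add[OF _ cS]) (intro continuous_intros)
    moreover have "cube_integral ?N (\<lambda>t. (real a + b + 2) * ?u t - (real b + 1) * ?v t)
        = cube_integral ?N (\<lambda>t. (real a + b + 2) * ?u t) - cube_integral ?N (\<lambda>t. (real b + 1) * ?v t)"
      by (rule cube_integral_diff) (intro continuous_intros)+
    ultimately show ?thesis by (simp only: cube_integral_cmult)
  qed
  also have "(\<Sum>j=1..n. cube_integral ?N (?X j)) = (\<Sum>j\<in>{1..k} \<union> {k<..n}. cube_integral ?N (?X j))"
    using assms by (intro sum.cong) auto
  also have "\<dots> = (\<Sum>j\<in>{1..k}. cube_integral ?N (?X j)) + (\<Sum>j\<in>{k<..n}. cube_integral ?N (?X j))"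
    by (rule sum.union_disjoint) auto
  also have "(\<Sum>j\<in>{1..k}. cube_integral ?N (?X j)) = (\<Sum>j\<in>{1..k}. aomoto (Suc k) / 2)"
    using aomoto_quotient_le[OF _ assms] by (intro sum.cong) (auto simp: field_simps)
  also have "(\<Sum>j\<in>{k<..n}. cube_integral ?N (?X j)) = (\<Sum>j\<in>{k<..n}. (2 * aomoto (Suc k) - aomoto k) / 2)"
    using aomoto_quotient_gt by (intro sum.cong) (auto simp: field_simps)
  finally have E: "(real a + b + 2) * aomoto (Suc k) - (real b + 1) * aomoto k
      + 4 * (real k * (aomoto (Suc k) / 2) + (real n - real k) * ((2 * aomoto (Suc k) - aomoto k) / 2)) = 0"
    using assms by (simp add: of_nat_diff)
  have "(\<alpha> + \<beta> + 2 * N + 2 + 2 * (N - K)) * x = (\<beta> + 1 + 2 * (N - K)) * y"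
    if "(\<alpha> + \<beta> + 2) * x - (\<beta> + 1) * y + 4 * (K * (x / 2) + (N - K) * ((2 * x - y) / 2)) = 0"
    for \<alpha> \<beta> N K x y :: real
    using that by (simp add: field_simps)
  from this[OF E] show ?thesis
    using assms by (simp add: of_nat_diff)
qed

lemma aomoto_0: "aomoto 0 = selberg a b (Suc n)"
  by (simp add: aomoto_def selberg_def)

lemma aomoto_last: "aomoto (Suc n) = selberg a (Suc b) (Suc n)"
  unfolding aomoto_def selberg_def selberg_weight_def
  by (simp add: prod.distrib mult_ac)

lemma aomoto_prod:
  assumes "k \<le> Suc n"
  shows "(\<Prod>i<k. real a + b + 2 * n + 2 + 2 * real (n - i)) * aomoto k
     = (\<Prod>i<k. real b + 1 + 2 * real (n - i)) * aomoto 0"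
  using assms
proof (induction k)
  case (Suc k)
  have "(\<Prod>i<Suc k. real a + b + 2 * n + 2 + 2 * real (n - i)) * aomoto (Suc k)
      = (\<Prod>i<k. real a + b + 2 * n + 2 + 2 * real (n - i)) * ((real b + 1 + 2 * real (n - k)) * aomoto k)"
    using Suc.prems aomoto_rec[of k] by simp
  also have "\<dots> = (real b + 1 + 2 * real (n - k)) * ((\<Prod>i<k. real b + 1 + 2 * real (n - i)) * aomoto 0)"
    using Suc by simp
  finally show ?case by simp
qed simp

lemma selberg_Suc_right_Suc:
  "(\<Prod>i<Suc n. real a + b + 2 * Suc n + 2 * real i) * selberg a (Suc b) (Suc n)
     = (\<Prod>i<Suc n. real b + 1 + 2 * real i) * selberg a b (Suc n)"
proof -
  have "(\<Prod>i<Suc n. f (n - i)) = (\<Prod>i<Suc n. f i)" for f :: "nat \<Rightarrow> real"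
    using prod.nat_diff_reindex[of f "Suc n"] by simp
  from this[of "\<lambda>i. real a + b + 2 * Suc n + 2 * real i"] this[of "\<lambda>i. real b + 1 + 2 * real i"]
  show ?thesis
    using aomoto_prod[OF order_refl] by (simp add: aomoto_0 aomoto_last add_ac del: prod.lessThan_Suc)
qed

text \<open>This recursion lowers the dimension. For \<open>b = 0\<close> the boundary value at 1
  survives, and setting the last coordinate to 1 turns its Vandermonde factors into (1 - t j)^4,
  which is the exponent \<open>b = 4\<close> in the remaining coordinates. The factor
  \<open>t (Suc n)\<close> kills the value at 0, and each of the \<open>n\<close> quotients
  contributes 4 / 2.\<close>

lemma selberg_boundary:
  assumes "b = 0"
  shows "(real a + 2 * n + 1) * selberg a 0 (Suc n) = selberg a 4 n"
proof -
  let ?N = "Suc n"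
  let ?F = "\<lambda>t :: nat \<Rightarrow> real. t ?N * wt t"
  let ?X = "\<lambda>j (t :: nat \<Rightarrow> real). t ?N * (wt t / (t ?N - t j))"
  let ?f = "\<lambda>t :: nat \<Rightarrow> real. (real a + 1) * wt t + 4 * (\<Sum>j=1..n. ?X j t)"
  have cX: "continuous_on UNIV (?X j)" if "j \<in> {1..n}" for j
    by (rule continuous_on_mult[OF continuous_on_product_coordinates continuous_selberg_quotient[OF that]])
  have cS: "continuous_on UNIV (\<lambda>t. 4 * (\<Sum>j=1..n. ?X j t))"
    by (rule continuous_on_mult_left, rule continuous_on_sum, rule cX)
  have "cube_integral ?N ?f = cube_integral n (\<lambda>t. ?F (t(?N := 1))) - cube_integral n (\<lambda>t. ?F (t(?N := 0)))"
  proof (rule cube_integral_deriv)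
    show "continuous_on UNIV ?f"
      by (rule continuous_on_add[OF _ cS]) (intro continuous_intros)
    show "continuous_on UNIV ?F" by (intro continuous_intros)
    fix t :: "nat \<Rightarrow> real" and x :: real
    have d: "((\<lambda>x. 1 - x) has_real_derivative - 1) (at x)"
      by (auto intro!: derivative_eq_intros)
    have "((\<lambda>x. x ^ Suc a) has_real_derivative (real a + 1) * x ^ a) (at x)"
      by (rule derivative_eq_intros refl | simp)+
    then have "((\<lambda>x. x * (x ^ a * (1 - x) ^ b)) has_real_derivative (real a + 1) * x ^ a) (at x)"
      by (simp add: assms)
    from selberg_weight_has_derivative[OF this, of n t]
    show "((\<lambda>x. ?F (t(?N := x))) has_real_derivative ?f (t(?N := x))) (at x)"
      by (rule back_subst[of "\<lambda>d. (d has_real_derivative _) _", OF back_subst[of "\<lambda>d. (_ has_real_derivative d) _"]])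
         (auto simp: selberg_weight_def mult_ac assms intro!: sum.cong)
  qed
  also have "(\<lambda>t. ?F (t(?N := 0))) = (\<lambda>t. 0)" by simp
  also have "(\<lambda>t. ?F (t(?N := 1))) = selberg_weight a 4 n"
    by (auto simp: fun_eq_iff selberg_weight_def Vdm_Suc assms prod.distrib prod_power_distrib power_mult_distrib)
  also have "cube_integral n (\<lambda>t. 0) = 0" by (simp add: cube_integral_def)
  also have "cube_integral ?N ?f = (real a + 1) * selberg a 0 ?N + 4 * (\<Sum>j=1..n. cube_integral ?N (?X j))"
  proof -
    have "cube_integral ?N (\<lambda>t. 4 * (\<Sum>j=1..n. ?X j t)) = 4 * (\<Sum>j=1..n. cube_integral ?N (?X j))"
      by (simp only: cube_integral_cmult cube_integral_sum[OF cX])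
    moreover have "cube_integral ?N ?f = cube_integral ?N (\<lambda>t. (real a + 1) * wt t) + cube_integral ?N (\<lambda>t. 4 * (\<Sum>j=1..n. ?X j t))"
      by (rule cube_integral_add[OF _ cS]) (intro continuous_intros)
    ultimately show ?thesis
      by (simp only: selberg_def assms cube_integral_cmult)
  qed
  also have "(\<Sum>j=1..n. cube_integral ?N (?X j)) = (\<Sum>j=1..n. selberg a 0 ?N / 2)"
  proof (rule sum.cong)
    fix j assume j: "j \<in> {1..n}"
    have "2 * cube_integral ?N (?X j) = cube_integral ?N (\<lambda>t. 1 * wt t)"
      by (rule cube_integral_antisym[OF j]) (auto intro!: continuous_intros)
    then show "cube_integral ?N (?X j) = selberg a 0 ?N / 2" by (simp add: selberg_def assms)
  qed simp
  finally show ?thesis by (simp add: selberg_def algebra_simps)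
qed

end

section \<open>Evaluation of the integrals of the two weights\<close>

lemma selberg_Suc_right:
  "(\<Prod>i<n. real a + b + 2 * n + 2 * real i) * selberg a (Suc b) n = (\<Prod>i<n. real b + 1 + 2 * real i) * selberg a b n"
proof (cases n)
  case 0
  moreover have "selberg_weight a b 0 = (\<lambda>_. 1)" for b
    by (auto simp: selberg_weight_def)
  ultimately show ?thesis by (simp add: selberg_def)
next
  case (Suc l)
  then show ?thesis using selberg_Suc_right_Suc[of a b l] by simp
qed


text \<open>One step in \<open>b\<close> yields products over arithmetic progressions of difference
  2. Two consecutive steps interleave them into factorials, so \<open>b\<close> is raised by two at
  a time.\<close>

lemma prod_two_step_fact:
  "(\<Prod>i<n. (real c + 1 + 2 * real i) * (real c + 2 + 2 * real i)) * fact c = fact (c + 2 * n)"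
proof (induction n)
  case (Suc n)
  have "c + 2 * Suc n = Suc (Suc (c + 2 * n))" by simp
  then have "(fact (c + 2 * Suc n) :: real) = (real c + 1 + 2 * real n) * (real c + 2 + 2 * real n) * fact (c + 2 * n)"
    by (simp only: fact_Suc of_nat_Suc) (simp add: algebra_simps)
  then show ?case by (simp add: Suc.IH[symmetric])
qed simp

definition moment_vol :: "nat \<Rightarrow> real" where
  "moment_vol n = (\<Prod>k<n. (fact k)\<^sup>2 / fact (2 * k + 1))"

lemma moment_vol_Suc: "moment_vol (Suc n) = moment_vol n * ((fact n)\<^sup>2 / fact (2 * n + 1))"
  by (simp add: moment_vol_def)

text \<open>First link of a chain with \<open>a = 2\<close> fixed: \<open>b\<close> goes from 0 to 2
  in dimension \<open>n\<close>. The next lemma leads on to \<open>b = 0\<close> in dimension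
  \<open>Suc n\<close>. Each link corresponds to one more factor of
  \<open>moment_vol\<close>.\<close>

lemma selberg_22_from_20: "fact (4 * n + 1) * selberg 2 2 n = fact (2 * n) * fact (2 * n + 1) * selberg 2 0 n"
proof -
  let ?A = "\<Prod>i<n. (real (2 * n + 1) + 1 + 2 * real i)" and ?B = "\<Prod>i<n. (real (2 * n + 1) + 2 + 2 * real i)"
  let ?C = "\<Prod>i<n. (real 0 + 1 + 2 * real i)" and ?D = "\<Prod>i<n. (real 0 + 2 + 2 * real i)"
  have AB: "?A * ?B * fact (2 * n + 1) = fact (4 * n + 1)"
    using prod_two_step_fact[of "2 * n + 1" n] by (simp add: prod.distrib)
  have CD: "?C * ?D = fact (2 * n)"
    using prod_two_step_fact[of 0 n] by (simp add: prod.distrib)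
  have 1: "?A * selberg 2 1 n = ?C * selberg 2 0 n"
    using selberg_Suc_right[of 2 0 n] by (simp add: add_ac One_nat_def)
  have 2: "?B * selberg 2 2 n = ?D * selberg 2 1 n"
    using selberg_Suc_right[of 2 1 n] by (simp add: add_ac numeral_2_eq_2[symmetric] One_nat_def[symmetric])
  have "fact (4 * n + 1) * selberg 2 2 n = ?A * (?B * selberg 2 2 n) * fact (2 * n + 1)"
    unfolding AB[symmetric] by (simp only: mult_ac)
  also have "\<dots> = ?D * (?A * selberg 2 1 n) * fact (2 * n + 1)"
    unfolding 2 by (simp only: mult_ac)
  also have "\<dots> = (?C * ?D) * selberg 2 0 n * fact (2 * n + 1)"
    unfolding 1 by (simp only: mult_ac)
  finally show ?thesis unfolding CD by (simp only: mult_ac)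
qed

text \<open>Raising \<open>b\<close> from 2 to 4 reaches the integral which
  \<open>selberg_boundary\<close> identifies with one of dimension \<open>Suc n\<close> and
  \<open>b = 0\<close>.\<close>

lemma selberg_20_from_22:
  "2 * fact (4 * n + 3) * selberg 2 0 (Suc n) = (fact (2 * n + 2))\<^sup>2 * selberg 2 2 n"
proof -
  let ?A = "\<Prod>i<n. (real (2 * n + 3) + 1 + 2 * real i)" and ?B = "\<Prod>i<n. (real (2 * n + 3) + 2 + 2 * real i)"
  let ?C = "\<Prod>i<n. (real 2 + 1 + 2 * real i)" and ?D = "\<Prod>i<n. (real 2 + 2 + 2 * real i)"
  have AB: "?A * ?B * fact (2 * n + 3) = fact (4 * n + 3)"
    using prod_two_step_fact[of "2 * n + 3" n] by (simp add: prod.distrib)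
  have CD: "?C * ?D * 2 = fact (2 * n + 2)"
    using prod_two_step_fact[of 2 n] by (simp add: prod.distrib add.commute)
  have 1: "?A * selberg 2 3 n = ?C * selberg 2 2 n"
    using selberg_Suc_right[of 2 2 n] by (simp add: add_ac)
  have 2: "?B * selberg 2 4 n = ?D * selberg 2 3 n"
    using selberg_Suc_right[of 2 3 n] by (simp add: add_ac)
  have 3: "(real (2 * n + 3)) * selberg 2 0 (Suc n) = selberg 2 4 n"
    using selberg_boundary[where a=2 and b=0 and n=n] by (simp add: add_ac)
  have f: "fact (2 * n + 3) = real (2 * n + 3) * fact (2 * n + 2)"
    by (simp add: fact_reduce)
  have "real (2 * n + 3) * (2 * fact (4 * n + 3) * selberg 2 0 (Suc n)) = 2 * (?A * ?B * fact (2 * n + 3)) * selberg 2 4 n"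
    unfolding AB 3[symmetric] by (simp only: mult_ac)
  also have "\<dots> = 2 * fact (2 * n + 3) * (?A * (?B * selberg 2 4 n))" by (simp only: mult_ac)
  also have "\<dots> = 2 * fact (2 * n + 3) * (?D * (?A * selberg 2 3 n))" unfolding 2 by (simp only: mult_ac)
  also have "\<dots> = fact (2 * n + 3) * (?C * ?D * 2) * selberg 2 2 n" unfolding 1 by (simp only: mult_ac)
  also have "\<dots> = real (2 * n + 3) * ((fact (2 * n + 2))\<^sup>2 * selberg 2 2 n)"
    unfolding CD f by (simp only: mult_ac power2_eq_square)
  finally show ?thesis by simp
qed

text \<open>The exponents are those of the squared node polynomial: t^2 for the simple node 0 alone,
  and t^2 (1 - t)^2 for the nodes 0 and 1.\<close>

lemma selberg_moment_vol:
  "selberg 2 0 n = fact (2 * n) * fact n * moment_vol (2 * n)"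
  "selberg 2 2 n = fact (2 * n + 1) * fact n * moment_vol (2 * n + 1)"
proof -
  have step: "selberg 2 2 n = fact (2 * n + 1) * fact n * moment_vol (2 * n + 1)"
    if "selberg 2 0 n = fact (2 * n) * fact n * moment_vol (2 * n)" for n
  proof -
    have "moment_vol (2 * n + 1) = moment_vol (2 * n) * ((fact (2 * n))\<^sup>2 / fact (4 * n + 1))"
      using moment_vol_Suc[of "2 * n"] by (simp add: Suc_eq_plus1)
    moreover have "selberg 2 2 n = fact (2 * n) * fact (2 * n + 1) * selberg 2 0 n / fact (4 * n + 1)"
    proof (subst nonzero_eq_divide_eq)
      show "selberg 2 2 n * fact (4 * n + 1) = fact (2 * n) * fact (2 * n + 1) * selberg 2 0 n"
        by (subst mult.commute) (rule selberg_22_from_20)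
    qed simp
    ultimately show ?thesis
      unfolding that by (simp only: power2_eq_square times_divide_eq_right mult_ac)
  qed
  show A: "selberg 2 0 n = fact (2 * n) * fact n * moment_vol (2 * n)"
  proof (induction n)
    case 0
    have "selberg 2 0 0 = cube_integral 0 (\<lambda>_. 1)"
      by (simp add: selberg_def selberg_weight_def[abs_def])
    also have "\<dots> = 1"
      using prob_space.prob_space[OF prob_space_cube[of 0]]
      by (subst cube_integral_continuous) (auto intro: continuous_intros)
    finally show ?case by (simp add: moment_vol_def)
  next
    case (Suc n)
    have mv: "moment_vol (2 * Suc n) = moment_vol (2 * n + 1) * ((fact (2 * n + 1))\<^sup>2 / fact (4 * n + 3))"
    proof -
      have e: "2 * Suc n = Suc (2 * n + 1)" "4 * n + 3 = 2 * (2 * n + 1) + 1" by simp_all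
      show ?thesis unfolding e by (rule moment_vol_Suc)
    qed
    have f: "fact (2 * n + 2) = 2 * (real n + 1) * fact (2 * n + 1)"
      using fact_Suc[of "2 * n + 1", where ?'a = real] by (simp add: algebra_simps)
    have "selberg 2 0 (Suc n) = (fact (2 * n + 2))\<^sup>2 * selberg 2 2 n / (2 * fact (4 * n + 3))"
    proof (subst nonzero_eq_divide_eq)
      show "selberg 2 0 (Suc n) * (2 * fact (4 * n + 3)) = (fact (2 * n + 2))\<^sup>2 * selberg 2 2 n"
        by (subst mult.commute) (rule selberg_20_from_22)
    qed simp
    also have "\<dots> = fact (2 * n + 2) * (2 * (real n + 1) * fact (2 * n + 1)) * (fact (2 * n + 1) * fact n * moment_vol (2 * n + 1)) / (2 * fact (4 * n + 3))"
      unfolding step[OF Suc.IH] f[symmetric] by (simp only: power2_eq_square)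
    also have "\<dots> = fact (2 * Suc n) * fact (Suc n) * moment_vol (2 * Suc n)"
    proof -
      have arith: "F * (2 * q * G) * (G * f * M) / (2 * h) = F * (q * f) * (M * (G * G / h))" for F q G f M h :: real
        by simp
      have "fact (2 * Suc n) = (fact (2 * n + 2) :: real)" "fact (Suc n) = (real n + 1) * fact n"
        by (simp_all add: algebra_simps)
      then show ?thesis
        unfolding mv power2_eq_square by (simp only:) (rule arith)
    qed
    finally show ?case .
  qed
  show "selberg 2 2 n = fact (2 * n + 1) * fact n * moment_vol (2 * n + 1)"
    by (rule step[OF A])
qed

section \<open>Hermite interpolation and integration by parts\<close>

lemma linear_square_dvd:
  fixes p :: "real poly"
  assumes "poly p t = 0" "poly (pderiv p) t = 0"
  shows "[:- t, 1:]\<^sup>2 dvd p"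
proof -
  obtain q where q: "p = [:- t, 1:] * q" using assms(1) by (auto simp: poly_eq_0_iff_dvd)
  have "poly (pderiv p) t = poly q t"
    unfolding q pderiv_mult by (simp add: pderiv_pCons)
  then have "[:- t, 1:] dvd q" using assms(2) by (simp add: poly_eq_0_iff_dvd)
  then show ?thesis unfolding q power2_eq_square by (rule mult_dvd_mono[OF dvd_refl])
qed

lemma pderiv_linear_square_dvd:
  fixes p :: "real poly"
  assumes "[:- t, 1:]\<^sup>2 dvd p"
  shows "poly p t = 0" "poly (pderiv p) t = 0"
proof -
  obtain q where q: "p = [:- t, 1:]\<^sup>2 * q" using assms by auto
  show "poly p t = 0" unfolding q by simp
  show "poly (pderiv p) t = 0"
    unfolding q pderiv_mult power2_eq_square by simp
qed

lemma hermite_unique: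
  fixes p :: "real poly"
  assumes fin: "finite Z" "finite T" and disj: "Z \<inter> T = {}"
    and deg: "degree p < card Z + 2 * card T"
    and z: "\<And>z. z \<in> Z \<Longrightarrow> poly p z = 0"
    and t: "\<And>t. t \<in> T \<Longrightarrow> poly p t = 0" "\<And>t. t \<in> T \<Longrightarrow> poly (pderiv p) t = 0"
  shows "p = 0"
proof (rule ccontr)
  assume p: "p \<noteq> 0"
  have ord1: "order z p \<ge> 1" if "z \<in> Z" for z
    using z[OF that] p order_root[of p z] by simp
  have ord2: "order u p \<ge> 2" if "u \<in> T" for u
    using linear_square_dvd[OF t(1)[OF that] t(2)[OF that]] p by (simp add: order_divides)
  have sub: "Z \<union> T \<subseteq> {x. poly p x = 0}" using z t by auto
  have "card Z + 2 * card T = (\<Sum>z\<in>Z. 1) + (\<Sum>u\<in>T. 2)" by simp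
  also have "\<dots> \<le> (\<Sum>z\<in>Z. order z p) + (\<Sum>u\<in>T. order u p)"
    by (intro add_mono sum_mono ord1 ord2)
  also have "\<dots> = (\<Sum>x\<in>Z \<union> T. order x p)" using fin disj by (simp add: sum.union_disjoint)
  also have "\<dots> \<le> (\<Sum>x | poly p x = 0. order x p)"
    by (rule sum_mono2[OF poly_roots_finite[OF p] sub]) simp
  also have "\<dots> \<le> degree p" by (rule sum_order_le_degree[OF p])
  finally show False using deg by simp
qed

lemma pderiv_sum: "pderiv (\<Sum>x\<in>A. f x) = (\<Sum>x\<in>A. pderiv (f x))"
  by (induction A rule: infinite_finite_induct) (simp_all add: pderiv_add)

lemma degree_prod_linear:
  "finite A \<Longrightarrow> degree (\<Prod>a\<in>A. [:- f a, 1 :: real:]) = card A"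
  by (subst degree_prod_eq_sum_degree) auto

text \<open>\<open>D\<close> is \<open>\<phi>\<close> minus its interpolant. It has more roots,
  counted with multiplicity, than its degree allows.\<close>

lemma hermite_interpolation:
  fixes \<phi> :: "real poly" and Z T :: "real set"
  defines "W \<equiv> \<Prod>z\<in>Z. [:- z, 1:]"
  defines "\<omega> \<equiv> \<lambda>z. (\<Prod>y\<in>Z-{z}. [:- y, 1:]) * (\<Prod>u\<in>T. [:- u, 1:]\<^sup>2)"
  defines "g \<equiv> \<lambda>t. W * (\<Prod>u\<in>T-{t}. [:- u, 1:]\<^sup>2)"
  assumes fin: "finite Z" "finite T" and disj: "Z \<inter> T = {}"
    and deg: "degree \<phi> < card Z + 2 * card T"
  shows "poly \<phi> s = (\<Sum>z\<in>Z. poly \<phi> z * poly (\<omega> z) s / poly (\<omega> z) z)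
    + (\<Sum>t\<in>T. poly \<phi> t * (poly (g t) s / poly (g t) t
                 - (s - t) * poly (pderiv (g t)) t * poly (g t) s / (poly (g t) t)\<^sup>2)
             + poly (pderiv \<phi>) t * ((s - t) * poly (g t) s / poly (g t) t))"
proof -
  define \<l> where "\<l> z = smult (1 / poly (\<omega> z) z) (\<omega> z)" for z
  define k where "k t = smult (1 / poly (g t) t) ([:- t, 1:] * g t)" for t
  \<comment> \<open>The normalized \<open>g t\<close> has the right value at \<open>t\<close> but a
    nonzero derivative in general; the multiple of (x - t) g that is subtracted cancels the
    derivative and leaves the value alone.\<close>
  define h where "h t = smult (1 / poly (g t) t) (g t)
      - smult (poly (pderiv (g t)) t / (poly (g t) t)\<^sup>2) ([:- t, 1:] * g t)" for t
  define D where "D = \<phi> - (\<Sum>z\<in>Z. smult (poly \<phi> z) (\<l> z))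
      - (\<Sum>t\<in>T. smult (poly \<phi> t) (h t) + smult (poly (pderiv \<phi>) t) (k t))"
  have \<omega>z: "poly (\<omega> z) z \<noteq> 0" if "z \<in> Z" for z
    using that disj fin by (auto simp: \<omega>_def poly_prod)
  have gt: "poly (g t) t \<noteq> 0" if "t \<in> T" for t
    using that disj fin by (auto simp: g_def W_def poly_prod)
  have \<omega>0: "poly (\<omega> z) y = 0" if "z \<in> Z" "y \<in> Z" "y \<noteq> z" for y z
    using that fin by (auto simp: \<omega>_def poly_prod)
  have \<omega>dvd: "[:- t, 1:]\<^sup>2 dvd \<omega> z" if "t \<in> T" for t z
    unfolding \<omega>_def by (intro dvd_mult dvd_prodI[OF fin(2) that, where f="\<lambda>u. [:- u, 1:]\<^sup>2"])
  have gdvd: "[:- u, 1:]\<^sup>2 dvd g t" if "u \<in> T" "u \<noteq> t" for t u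
    unfolding g_def using fin that by (intro dvd_mult dvd_prodI[where f="\<lambda>u. [:- u, 1:]\<^sup>2"]) auto
  have gz: "poly (g t) z = 0" if "z \<in> Z" for t z
    using that fin by (auto simp: g_def W_def poly_prod)
  have lz: "poly (\<l> z) y = (if y = z then 1 else 0)" if "z \<in> Z" "y \<in> Z" for z y
    using that \<omega>z \<omega>0 by (auto simp: \<l>_def)
  have lt: "poly (\<l> z) t = 0" "poly (pderiv (\<l> z)) t = 0" if "t \<in> T" for z t
    using pderiv_linear_square_dvd[OF \<omega>dvd[OF that]] by (auto simp: \<l>_def pderiv_smult)
  have hk_z: "poly (h t) z = 0" "poly (k t) z = 0" if "z \<in> Z" for z t
    using gz[OF that] by (auto simp: h_def k_def)
  have g0: "poly (g t) u = 0" "poly (pderiv (g t)) u = 0" if "u \<in> T" "u \<noteq> t" for u t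
    using pderiv_linear_square_dvd[OF gdvd[OF that]] by auto
  have dl: "poly (pderiv ([:- t, 1:] * q)) u = (u - t) * poly (pderiv q) u + poly q u" for t u and q :: "real poly"
    by (simp only: pderiv_mult) (simp add: pderiv_pCons algebra_simps)
  have dh: "poly (pderiv (h t)) u = 1 / poly (g t) t * poly (pderiv (g t)) u
      - poly (pderiv (g t)) t / (poly (g t) t)\<^sup>2 * ((u - t) * poly (pderiv (g t)) u + poly (g t) u)" for t u
    by (simp only: h_def pderiv_diff pderiv_smult poly_diff poly_smult dl)
  have ht: "poly (h t) u = (if u = t then 1 else 0)" if "t \<in> T" "u \<in> T" for t u
    using gt[OF that(1)] g0(1)[OF that(2), of t] by (auto simp: h_def)
  have ht': "poly (pderiv (h t)) u = 0" if "t \<in> T" "u \<in> T" for t u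
    using gt[OF that(1)] g0[OF that(2), of t] by (cases "u = t") (simp_all add: dh power2_eq_square)
  have dk: "poly (pderiv (k t)) u = 1 / poly (g t) t * ((u - t) * poly (pderiv (g t)) u + poly (g t) u)" for t u
    by (simp only: k_def pderiv_smult poly_smult dl)
  have kt: "poly (k t) u = 0" "poly (pderiv (k t)) u = (if u = t then 1 else 0)" if "t \<in> T" "u \<in> T" for t u
    using gt[OF that(1)] g0[OF that(2), of t] by ((cases "u = t"; simp add: k_def), (cases "u = t"; simp add: dk))
  have dW: "degree W = card Z" unfolding W_def by (rule degree_prod_linear[OF fin(1)])
  have dsq: "degree (\<Prod>u\<in>A. [:- u, 1:: real:]\<^sup>2) = 2 * card A" if "finite A" for A
    using that by (subst degree_prod_eq_sum_degree) (auto simp: degree_power_eq)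
  have dg: "degree ([:- t, 1:] * g t) \<le> card Z + 2 * card T - 1" if "t \<in> T" for t
  proof -
    have "card T = Suc (card (T - {t}))" using card.remove[OF fin(2) that] .
    then have "degree (g t) \<le> card Z + 2 * card T - 2"
      unfolding g_def using degree_mult_le[of W "\<Prod>u\<in>T-{t}. [:- u, 1:]\<^sup>2"] dW dsq[of "T - {t}"] fin by simp
    then show ?thesis
      using degree_mult_le[of "[:- t, 1:]" "g t"] \<open>card T = _\<close> by simp
  qed
  have dg': "degree (g t) \<le> card Z + 2 * card T - 1" if "t \<in> T" for t
  proof (cases "g t = 0")
    case False
    then show ?thesis using dg[OF that] by (subst (asm) degree_mult_eq) auto
  qed simp
  have d\<omega>: "degree (\<omega> z) \<le> card Z + 2 * card T - 1" if "z \<in> Z" for z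
  proof -
    have "card Z = Suc (card (Z - {z}))" using card.remove[OF fin(1) that] .
    then show ?thesis
      unfolding \<omega>_def using degree_mult_le[of "\<Prod>y\<in>Z-{z}. [:- y, 1:]" "\<Prod>u\<in>T. [:- u, 1:]\<^sup>2"]
        degree_prod_linear[of "Z - {z}" "\<lambda>x. x"] dsq[OF fin(2)] fin by simp
  qed
  have "degree D \<le> card Z + 2 * card T - 1"
    unfolding D_def
  proof (intro degree_diff_le degree_sum_le fin degree_add_le)
    show "degree \<phi> \<le> card Z + 2 * card T - 1" using deg by simp
    show "degree (smult (poly \<phi> z) (\<l> z)) \<le> card Z + 2 * card T - 1" if "z \<in> Z" for z
      using d\<omega>[OF that] by (simp add: \<l>_def)
    show "degree (smult (poly (pderiv \<phi>) t) (k t)) \<le> card Z + 2 * card T - 1" if "t \<in> T" for t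
      unfolding k_def by (rule order_trans[OF degree_smult_le order_trans[OF degree_smult_le dg[OF that]]])
    show "degree (smult (poly \<phi> t) (h t)) \<le> card Z + 2 * card T - 1" if "t \<in> T" for t
      unfolding h_def using dg[OF that] dg'[OF that]
      by (intro order_trans[OF degree_smult_le] degree_diff_le order_trans[OF degree_smult_le])
  qed
  moreover have "card Z + 2 * card T > 0" using deg by linarith
  ultimately have dD: "degree D < card Z + 2 * card T" by linarith
  have "D = 0"
  proof (rule hermite_unique[OF fin disj dD])
    fix z assume z: "z \<in> Z"
    have "(\<Sum>x\<in>Z. poly \<phi> x * poly (\<l> x) z) = (\<Sum>x\<in>Z. if x = z then poly \<phi> x else 0)"
      by (intro sum.cong refl) (use lz z in auto)
    then show "poly D z = 0"
      using z fin by (simp add: D_def poly_sum hk_z)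
  next
    fix u assume u: "u \<in> T"
    have "(\<Sum>t\<in>T. poly \<phi> t * poly (h t) u) = (\<Sum>t\<in>T. if t = u then poly \<phi> t else 0)"
      by (intro sum.cong refl) (use ht u in auto)
    then show "poly D u = 0"
      using u fin by (simp add: D_def poly_sum lt kt sum.distrib)
    have "(\<Sum>t\<in>T. poly (pderiv \<phi>) t * poly (pderiv (k t)) u) = (\<Sum>t\<in>T. if t = u then poly (pderiv \<phi>) t else 0)"
      by (intro sum.cong refl) (use kt u in auto)
    then show "poly (pderiv D) u = 0"
      using u fin by (simp add: D_def poly_sum lt ht' pderiv_diff pderiv_sum pderiv_add pderiv_smult sum.distrib)
  qed
  then have "poly \<phi> s = (\<Sum>z\<in>Z. poly \<phi> z * poly (\<l> z) s)
      + (\<Sum>t\<in>T. poly \<phi> t * poly (h t) s + poly (pderiv \<phi>) t * poly (k t) s)"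
  proof -
    have "poly D s = 0" using \<open>D = 0\<close> by simp
    then show ?thesis by (simp add: D_def poly_sum)
  qed
  moreover have lin: "poly ([:- t, 1:] * q) s = (s - t) * poly q s" for t and q :: "real poly"
    by (simp only: poly_mult) simp
  have "poly \<phi> z * poly (\<l> z) s = poly \<phi> z * poly (\<omega> z) s / poly (\<omega> z) z" for z
    by (simp add: \<l>_def)
  moreover have "poly (h t) s = poly (g t) s / poly (g t) t
      - (s - t) * poly (pderiv (g t)) t * poly (g t) s / (poly (g t) t)\<^sup>2" for t
    by (simp only: h_def poly_diff poly_smult lin) simp
  moreover have "poly (k t) s = (s - t) * poly (g t) s / poly (g t) t" for t
    by (simp only: k_def poly_smult lin) simp
  ultimately show ?thesis by (simp only:)
qed


section \<open>The interpolation formula multiplied by the weight\<close>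

definition node_poly :: "real set \<Rightarrow> real poly" where
  "node_poly Z = (\<Prod>z\<in>Z. [:- z, 1:])"

text \<open>For a configuration \<open>t\<close> of \<open>n\<close> double nodes besides the last coordinate \<open>x = t (Suc n)\<close>,
  \<open>node_kernel\<close> is the Hermite basis polynomial of the derivative at \<open>x\<close>, evaluated at \<open>s\<close>
  and multiplied by \<open>node_weight\<close>; \<open>node_kernel'\<close> is its partial derivative with respect to \<open>x\<close>,
  which is minus the basis polynomial of the value at \<open>x\<close>.\<close>

definition conf_poly :: "real set \<Rightarrow> nat \<Rightarrow> (nat \<Rightarrow> real) \<Rightarrow> real poly" where
  "conf_poly Z n t = node_poly Z * (\<Prod>i=1..n. [:- t i, 1:]\<^sup>2)"

definition node_weight :: "real set \<Rightarrow> nat \<Rightarrow> (nat \<Rightarrow> real) \<Rightarrow> real" where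
  "node_weight Z n t = (\<Prod>i=1..n. (poly (node_poly Z) (t i))\<^sup>2) * Vdm n t ^ 4"

definition node_kernel :: "real set \<Rightarrow> nat \<Rightarrow> real \<Rightarrow> (nat \<Rightarrow> real) \<Rightarrow> real" where
  "node_kernel Z n s t = (s - t (Suc n)) * poly (conf_poly Z n t) s
     * poly (conf_poly Z n t) (t (Suc n)) * node_weight Z n t"

definition node_kernel' :: "real set \<Rightarrow> nat \<Rightarrow> real \<Rightarrow> (nat \<Rightarrow> real) \<Rightarrow> real" where
  "node_kernel' Z n s t = ((s - t (Suc n)) * poly (pderiv (conf_poly Z n t)) (t (Suc n))
      - poly (conf_poly Z n t) (t (Suc n))) * poly (conf_poly Z n t) s * node_weight Z n t"

text \<open>The basis polynomial of the simple node \<open>z\<close>, multiplied by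
  \<open>node_weight\<close>. The product of (z - t i)^2 in its denominator is the contribution of
  \<open>z\<close> to the weight and cancels, which leaves the node polynomial of
  \<open>Z - {z}\<close>.\<close>

definition node_end :: "real set \<Rightarrow> nat \<Rightarrow> real \<Rightarrow> real \<Rightarrow> (nat \<Rightarrow> real) \<Rightarrow> real" where
  "node_end Z n z s t = (\<Prod>y\<in>Z-{z}. (s - y) / (z - y)) * (\<Prod>i=1..n. (s - t i)\<^sup>2)
     * (\<Prod>i=1..n. (poly (node_poly (Z - {z})) (t i))\<^sup>2) * Vdm n t ^ 4"

lemma poly_node_poly: "poly (node_poly Z) x = (\<Prod>z\<in>Z. x - z)"
  by (simp add: node_poly_def poly_prod)

lemma poly_conf_poly: "poly (conf_poly Z n t) x = poly (node_poly Z) x * (\<Prod>i=1..n. (x - t i)\<^sup>2)"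
  by (simp add: conf_poly_def poly_prod)

lemma pderiv_conf_poly:
  "poly (pderiv (conf_poly Z n t)) x = poly (node_poly Z) x
      * (\<Sum>i=1..n. 2 * (x - t i) * (\<Prod>j\<in>{1..n}-{i}. (x - t j)\<^sup>2))
    + poly (pderiv (node_poly Z)) x * (\<Prod>i=1..n. (x - t i)\<^sup>2)"
proof -
  have "poly (pderiv ([:- u, 1:]\<^sup>2)) x = 2 * (x - u)" for u :: real
    by (simp add: power2_eq_square pderiv_mult pderiv_pCons)
  then show ?thesis
    unfolding conf_poly_def pderiv_mult pderiv_prod
    by (simp add: poly_sum poly_prod mult_ac)
qed

lemma continuous_poly_compose [continuous_intros]:
  "continuous_on A f \<Longrightarrow> continuous_on A (\<lambda>x. poly p (f x :: real))"
  by (rule continuous_on_compose2[of UNIV "poly p"]) (auto intro: continuous_intros)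

lemma continuous_conf_poly [continuous_intros]:
  assumes "continuous_on UNIV f"
  shows "continuous_on UNIV (\<lambda>t. poly (conf_poly Z n t) (f t))"
  unfolding poly_conf_poly by (intro continuous_intros assms)

lemma continuous_pderiv_conf_poly [continuous_intros]:
  assumes "continuous_on UNIV f"
  shows "continuous_on UNIV (\<lambda>t. poly (pderiv (conf_poly Z n t)) (f t))"
  unfolding pderiv_conf_poly by (intro continuous_intros assms)

lemma continuous_node_weight [continuous_intros]: "continuous_on UNIV (\<lambda>t. node_weight Z n t)"
  unfolding node_weight_def by (intro continuous_intros)

lemma continuous_node_kernel [continuous_intros]: "continuous_on UNIV (\<lambda>t. node_kernel Z n s t)"
  unfolding node_kernel_def by (intro continuous_intros)

lemma continuous_node_kernel' [continuous_intros]: "continuous_on UNIV (\<lambda>t. node_kernel' Z n s t)"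
  unfolding node_kernel'_def by (intro continuous_intros)

lemma continuous_node_end [continuous_intros]: "continuous_on UNIV (\<lambda>t. node_end Z n z s t)"
  unfolding node_end_def by (intro continuous_intros)

lemma continuous_swp [continuous_intros]:
  fixes f :: "(nat \<Rightarrow> real) \<Rightarrow> real"
  assumes "continuous_on UNIV f"
  shows "continuous_on UNIV (\<lambda>t. f (t \<circ> swp i j))"
proof -
  have "continuous_on UNIV (\<lambda>t :: nat \<Rightarrow> real. t \<circ> swp i j)"
    by (rule continuous_on_coordinatewise_then_product) (simp add: comp_def)
  then show ?thesis by (rule continuous_on_compose2[OF assms]) auto
qed

lemma conf_poly_upd [simp]: "conf_poly Z n (t(Suc n := x)) = conf_poly Z n t"
  unfolding conf_poly_def by (intro arg_cong2[where f="(*)"] prod.cong) auto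

lemma node_weight_upd [simp]: "node_weight Z n (t(Suc n := x)) = node_weight Z n t"
  unfolding node_weight_def by (intro arg_cong2[where f="(*)"] prod.cong) auto

text \<open>\<open>conf_poly Z n t\<close> and \<open>node_weight Z n t\<close> do not see the last
  coordinate, so only the product of s - x and the value at x is differentiated.\<close>

lemma node_kernel_has_derivative:
  "((\<lambda>x. node_kernel Z n s (t(Suc n := x))) has_real_derivative node_kernel' Z n s (t(Suc n := x))) (at x)"
proof -
  let ?g = "conf_poly Z n t"
  have "((\<lambda>x. (s - x) * poly ?g x) has_real_derivative (s - x) * poly (pderiv ?g) x - poly ?g x) (at x)"
    by (rule derivative_eq_intros poly_DERIV refl | simp)+
  from DERIV_cmult[OF this, of "poly ?g s * node_weight Z n t"]
  show ?thesis
    by (simp add: node_kernel_def node_kernel'_def mult_ac)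
qed

text \<open>The square is exactly the common denominator of the two basis polynomials at the last
  node.\<close>

lemma node_weight_Suc: "node_weight Z (Suc n) t = (poly (conf_poly Z n t) (t (Suc n)))\<^sup>2 * node_weight Z n t"
proof -
  have "(p * w)\<^sup>2 * (d * e) ^ 4 = (w * e\<^sup>2)\<^sup>2 * (p\<^sup>2 * d ^ 4)" for p w d e :: real
    by (simp add: power_mult_distrib power_mult[symmetric])
  then show ?thesis
    by (simp add: node_weight_def poly_conf_poly Vdm_Suc prod_power_distrib[symmetric])
qed

lemma node_weight_swp:
  "i \<in> {1..n} \<Longrightarrow> j \<in> {1..n} \<Longrightarrow> node_weight Z n (t \<circ> swp i j) = node_weight Z n t"
  unfolding node_weight_def
  using prod_swp[of i n j "\<lambda>x. (poly (node_poly Z) x)\<^sup>2" t] Vdm4_permute[OF bij_swp, of i n j t] by simp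

lemma Vdm_eq_0: "\<not> inj_on t {1..n} \<Longrightarrow> Vdm n t = 0"
proof -
  assume "\<not> inj_on t {1..n}"
  then obtain i j where ij: "i \<in> {1..n}" "j \<in> {1..n}" "i < j" "t i = t j"
    unfolding inj_on_def by (metis nat_neq_iff)
  have "finite {(j, k). 1 \<le> j \<and> j < k \<and> k \<le> n}"
    by (rule finite_subset[of _ "{1..n} \<times> {1..n}"]) auto
  then show ?thesis
    unfolding Vdm_def by (rule prod_zero) (intro bexI[of _ "(i, j)"]; use ij in simp)
qed

text \<open>For distinct double nodes this is \<open>hermite_interpolation\<close> times the weight,
  the swap moving the j-th node to the last place. If two nodes coincide, every term is 0.\<close>

lemma node_hermite:
  fixes \<phi> :: "real poly"
  assumes Z: "finite Z" and t: "\<And>i. i \<in> {1..Suc n} \<Longrightarrow> t i \<notin> Z"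
    and deg: "degree \<phi> < card Z + 2 * Suc n"
  shows "poly \<phi> s * node_weight Z (Suc n) t = (\<Sum>z\<in>Z. poly \<phi> z * node_end Z (Suc n) z s t)
    + (\<Sum>j=1..Suc n. poly (pderiv \<phi>) (t j) * node_kernel Z n s (t \<circ> swp j (Suc n))
        - poly \<phi> (t j) * node_kernel' Z n s (t \<circ> swp j (Suc n)))"
proof (cases "inj_on t {1..Suc n}")
  case False
  have "node_kernel Z n s (t \<circ> swp j (Suc n)) = 0 \<and> node_kernel' Z n s (t \<circ> swp j (Suc n)) = 0"
    if j: "j \<in> {1..Suc n}" for j
  proof -
    let ?u = "t \<circ> swp j (Suc n)"
    have "\<not> inj_on ?u {1..Suc n}"
    proof
      assume "inj_on ?u {1..Suc n}"
      moreover have "bij_betw (swp j (Suc n)) {1..Suc n} {1..Suc n}"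
        using j by (intro bij_swp) auto
      ultimately show False
        using False inj_on_imageI[of t "swp j (Suc n)" "{1..Suc n}"] by (simp add: bij_betw_def)
    qed
    \<comment> \<open>Either two of the first \<open>n\<close> coordinates agree and the weight
      vanishes, or the last one equals an earlier one and is a double root of
      \<open>conf_poly\<close>.\<close>
    moreover have "{1..Suc n} = insert (Suc n) {1..n}" by auto
    ultimately consider "\<not> inj_on ?u {1..n}" | i where "i \<in> {1..n}" "?u (Suc n) = ?u i"
      by (auto simp: inj_on_insert)
    then show ?thesis
    proof cases
      case 1
      then show ?thesis by (simp add: node_kernel_def node_kernel'_def node_weight_def Vdm_eq_0)
    next
      case 2
      have "[:- ?u (Suc n), 1:]\<^sup>2 dvd conf_poly Z n ?u"
        unfolding conf_poly_def 2(2)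
        by (intro dvd_mult dvd_prodI[where f="\<lambda>i. [:- ?u i, 1:]\<^sup>2"] 2) auto
      from pderiv_linear_square_dvd[OF this] show ?thesis
        by (simp add: node_kernel_def node_kernel'_def)
    qed
  qed
  moreover have "node_weight Z (Suc n) t = 0" "node_end Z (Suc n) z s t = 0" for z
    using Vdm_eq_0[OF False] by (simp_all add: node_weight_def node_end_def)
  ultimately show ?thesis by simp
next
  case inj: True
  let ?T = "t ` {1..Suc n}" and ?J = "node_weight Z (Suc n) t"
  define \<omega> where "\<omega> z = (\<Prod>y\<in>Z-{z}. [:- y, 1:]) * (\<Prod>u\<in>?T. [:- u, 1:]\<^sup>2)" for z
  define g where "g x = (\<Prod>z\<in>Z. [:- z, 1:]) * (\<Prod>u\<in>?T-{x}. [:- u, 1:]\<^sup>2)" for x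
  have disj: "Z \<inter> ?T = {}" using t by auto
  have cT: "card ?T = Suc n" using card_image[OF inj] by simp
  have H: "poly \<phi> s = (\<Sum>z\<in>Z. poly \<phi> z * poly (\<omega> z) s / poly (\<omega> z) z)
    + (\<Sum>x\<in>?T. poly \<phi> x * (poly (g x) s / poly (g x) x
                 - (s - x) * poly (pderiv (g x)) x * poly (g x) s / (poly (g x) x)\<^sup>2)
             + poly (pderiv \<phi>) x * ((s - x) * poly (g x) s / poly (g x) x))"
    unfolding \<omega>_def g_def by (rule hermite_interpolation) (use Z disj deg cT in auto)
  have ends: "poly (\<omega> z) s / poly (\<omega> z) z * ?J = node_end Z (Suc n) z s t" if z: "z \<in> Z" for z
  proof -
    have J: "?J = (\<Prod>i=1..Suc n. (poly (node_poly (Z - {z})) (t i))\<^sup>2) * (\<Prod>i=1..Suc n. (z - t i)\<^sup>2) * Vdm (Suc n) t ^ 4"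
      unfolding node_weight_def prod.distrib[symmetric] node_poly_def prod.remove[OF Z z]
      by (simp only: poly_mult power_mult_distrib) (simp add: power2_commute mult_ac)
    have w: "poly (\<omega> z) x = (\<Prod>y\<in>Z-{z}. x - y) * (\<Prod>i=1..Suc n. (x - t i)\<^sup>2)" for x
      unfolding \<omega>_def by (simp only: poly_mult poly_prod prod.reindex[OF inj] comp_def) simp
    have nz: "(\<Prod>i=1..Suc n. (z - t i)\<^sup>2) \<noteq> 0"
      using t z by (force simp: prod_zero_iff)
    have arith: "a * b / (c * d) * (e * d * f) = a / c * b * e * f" if "d \<noteq> 0" for a b c d e f :: real
      using that by simp
    show ?thesis
      unfolding J w node_end_def prod_dividef by (rule arith[OF nz])
  qed
  have inner: "(poly \<phi> (t j) * (poly (g (t j)) s / poly (g (t j)) (t j)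
                 - (s - t j) * poly (pderiv (g (t j))) (t j) * poly (g (t j)) s / (poly (g (t j)) (t j))\<^sup>2)
             + poly (pderiv \<phi>) (t j) * ((s - t j) * poly (g (t j)) s / poly (g (t j)) (t j))) * ?J
      = poly (pderiv \<phi>) (t j) * node_kernel Z n s (t \<circ> swp j (Suc n))
        - poly \<phi> (t j) * node_kernel' Z n s (t \<circ> swp j (Suc n))" if j: "j \<in> {1..Suc n}" for j
  proof -
    let ?u = "t \<circ> swp j (Suc n)"
    have bij: "bij_betw (swp j (Suc n)) {1..Suc n} {1..Suc n}"
      using j by (intro bij_swp) auto
    have injn: "inj_on ?u {1..n}"
    proof (rule comp_inj_on)
      show "inj_on (swp j (Suc n)) {1..n}" by simp
      have "swp j (Suc n) ` {1..n} \<subseteq> swp j (Suc n) ` {1..Suc n}" by (rule image_mono) auto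
      also have "\<dots> = {1..Suc n}" using bij by (simp add: bij_betw_def)
      finally show "inj_on t (swp j (Suc n) ` {1..n})" by (rule inj_on_subset[OF inj])
    qed
    have im: "?u ` {1..n} = ?T - {t j}"
    proof -
      have "swp j (Suc n) ` {1..Suc n} = {1..Suc n}" using bij by (simp add: bij_betw_def)
      moreover have "{1..n} = {1..Suc n} - {Suc n}" by auto
      moreover have "inj (swp j (Suc n))" by simp
      ultimately have "swp j (Suc n) ` {1..n} = {1..Suc n} - {j}"
        by (simp add: image_set_diff del: Suc_eq_plus1)
      then have "?u ` {1..n} = t ` ({1..Suc n} - {j})" by (simp only: image_comp[symmetric])
      also have "\<dots> = ?T - {t j}"
        using inj_on_image_set_diff[OF inj, of "{1..Suc n}" "{j}"] j by auto
      finally show ?thesis .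
    qed
    have g: "conf_poly Z n ?u = g (t j)"
      unfolding conf_poly_def g_def node_poly_def im[symmetric] prod.reindex[OF injn] by (simp add: comp_def)
    have uj: "?u (Suc n) = t j" by simp
    have J: "?J = (poly (g (t j)) (t j))\<^sup>2 * node_weight Z n ?u"
      using node_weight_Suc[of Z n ?u] node_weight_swp[of j "Suc n" "Suc n" Z t] j
      unfolding g uj by simp
    have nz: "poly (g (t j)) (t j) \<noteq> 0"
      using disj Z j by (auto simp: g_def poly_prod)
    \<comment> \<open>Here a and b are the values of the polynomial g at s and at t j, c is its
      derivative at t j, and d = s - t j. Clearing b^2 turns the coefficient of the value into minus
      \<open>node_kernel'\<close>.\<close>
    have arith: "(p * (a / b - d * c * a / b\<^sup>2) + q * (d * a / b)) * (b\<^sup>2 * w)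
       = q * (d * a * b * w) - p * ((d * c - b) * a * w)" if "b \<noteq> 0" for a b c d p q w :: real
      using that by (simp add: power2_eq_square field_simps)
    show ?thesis
      unfolding node_kernel_def node_kernel'_def J g uj by (rule arith[OF nz])
  qed
  have "poly \<phi> s * ?J = (\<Sum>z\<in>Z. poly \<phi> z * (poly (\<omega> z) s / poly (\<omega> z) z * ?J))
    + (\<Sum>j=1..Suc n. (poly \<phi> (t j) * (poly (g (t j)) s / poly (g (t j)) (t j)
                 - (s - t j) * poly (pderiv (g (t j))) (t j) * poly (g (t j)) s / (poly (g (t j)) (t j))\<^sup>2)
             + poly (pderiv \<phi>) (t j) * ((s - t j) * poly (g (t j)) s / poly (g (t j)) (t j))) * ?J)"
    unfolding H sum.reindex[OF inj] comp_def ring_distribs(2)[of _ _ ?J] sum_distrib_right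
    by (simp only: mult.assoc times_divide_eq_left times_divide_eq_right)
  also have "\<dots> = (\<Sum>z\<in>Z. poly \<phi> z * node_end Z (Suc n) z s t)
    + (\<Sum>j=1..Suc n. poly (pderiv \<phi>) (t j) * node_kernel Z n s (t \<circ> swp j (Suc n))
        - poly \<phi> (t j) * node_kernel' Z n s (t \<circ> swp j (Suc n)))"
    by (intro arg_cong2[where f="(+)"] sum.cong refl) (simp_all only: ends inner)
  finally show ?thesis .
qed


section \<open>Integration of the weighted interpolation formula\<close>

lemma node_kernel_zero: "poly (node_poly Z) x = 0 \<Longrightarrow> node_kernel Z n s (t(Suc n := x)) = 0"
  by (simp add: node_kernel_def poly_conf_poly[of Z n t x])

text \<open>Common source of both formulas. \<open>0 \<in> Z\<close> removes the boundary values at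
  0; those at 1 are kept, because 1 is a simple node in the odd case only.\<close>

lemma quadrature:
  fixes \<phi> :: "real poly" and s :: real
  assumes Z: "finite Z" "0 \<in> Z" and deg: "degree \<phi> < card Z + 2 * Suc n"
  defines "J \<equiv> \<lambda>t. \<Sum>z\<in>Z. node_end Z (Suc n) z s t"
  shows "poly \<phi> s * cube_integral (Suc n) (node_weight Z (Suc n))
    = (\<Sum>z\<in>Z. poly \<phi> z * cube_integral (Suc n) (node_end Z (Suc n) z s))
    + 2 * cube_integral (Suc n) (\<lambda>t. Sigma_sum (Suc n) (poly \<phi>) t * (node_weight Z (Suc n) t - J t))
    + real (Suc n) * poly \<phi> 1 * cube_integral n (\<lambda>t. node_kernel Z n s (t(Suc n := 1)))
    + 2 * real (Suc n) * cube_integral n (\<lambda>t. Sigma_sum n (poly \<phi>) t * node_kernel Z n s (t(Suc n := 1)))"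
proof -
  let ?N = "Suc n" and ?I = "cube_integral (Suc n)"
  let ?K = "node_kernel Z n s" and ?D = "node_kernel' Z n s" and ?W = "node_weight Z (Suc n)"
  let ?S = "Sigma_sum ?N (poly \<phi>)" and ?S' = "Sigma_sum n (poly \<phi>)"
  let ?K1 = "\<lambda>t. node_kernel Z n s (t(Suc n := 1))"
  have cupd: "continuous_on UNIV (\<lambda>t :: nat \<Rightarrow> real. t(?N := c))" for c
  proof (rule continuous_on_coordinatewise_then_product)
    show "continuous_on UNIV (\<lambda>t :: nat \<Rightarrow> real. (t(?N := c)) i)" for i
      by (cases "i = ?N") auto
  qed
  have cS: "continuous_on UNIV (\<lambda>t. Sigma_sum k (poly \<phi>) t)" for k
    unfolding Sigma_sum_def by (intro continuous_intros)
  have cJ: "continuous_on UNIV (\<lambda>t. J t)"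
    unfolding J_def by (intro continuous_intros)
  have cK1: "continuous_on UNIV ?K1"
    by (rule continuous_on_compose2[OF continuous_node_kernel cupd]) auto
  have jN: "j \<in> {1..?N} \<Longrightarrow> ?N \<in> {1..?N}" for j by simp
  have perm: "?I (\<lambda>t. f (t \<circ> swp j ?N)) = ?I f" if "continuous_on UNIV f" "j \<in> {1..?N}" for f j
    by (rule cube_integral_permute[OF that jN[OF that(2)]]) (rule refl)
  have K0: "node_kernel Z n s (t(?N := 0)) = 0" for t
    by (rule node_kernel_zero) (use Z in \<open>auto simp: poly_node_poly\<close>)

  let ?f = "\<lambda>t. poly (pderiv \<phi>) (t ?N) * ?K t - poly \<phi> (t ?N) * ?D t"
  have cf: "continuous_on UNIV ?f" by (intro continuous_intros)
  have "poly \<phi> s * ?I ?W = ?I (\<lambda>t. poly \<phi> s * ?W t)" by simp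
  also have "\<dots> = ?I (\<lambda>t. (\<Sum>z\<in>Z. poly \<phi> z * node_end Z ?N z s t) + (\<Sum>j=1..?N. ?f (t \<circ> swp j ?N)))"
  proof (rule cube_integral_cong[OF _ _ Z(1)])
    show "continuous_on UNIV (\<lambda>t. (\<Sum>z\<in>Z. poly \<phi> z * node_end Z ?N z s t) + (\<Sum>j=1..?N. ?f (t \<circ> swp j ?N)))"
      by (intro continuous_on_add continuous_on_sum continuous_swp cf continuous_on_mult_left continuous_node_end)
    show "continuous_on UNIV (\<lambda>t. poly \<phi> s * ?W t)" by (intro continuous_intros)
    show "poly \<phi> s * ?W t = (\<Sum>z\<in>Z. poly \<phi> z * node_end Z ?N z s t) + (\<Sum>j=1..?N. ?f (t \<circ> swp j ?N))"
      if "\<And>i. i \<in> {1..?N} \<Longrightarrow> t i \<notin> Z" for t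
      using node_hermite[OF Z(1) that deg, where s=s] by simp
  qed
  also have "\<dots> = ?I (\<lambda>t. \<Sum>z\<in>Z. poly \<phi> z * node_end Z ?N z s t) + ?I (\<lambda>t. \<Sum>j=1..?N. ?f (t \<circ> swp j ?N))"
    by (intro cube_integral_add continuous_on_sum continuous_swp cf continuous_on_mult_left continuous_node_end)
  also have "?I (\<lambda>t. \<Sum>z\<in>Z. poly \<phi> z * node_end Z ?N z s t) = (\<Sum>z\<in>Z. poly \<phi> z * ?I (node_end Z ?N z s))"
    by (subst cube_integral_sum) (auto intro!: continuous_intros)
  also have "?I (\<lambda>t. \<Sum>j=1..?N. ?f (t \<circ> swp j ?N)) = (\<Sum>j=1..?N. ?I (\<lambda>t. ?f (t \<circ> swp j ?N)))"
    by (intro cube_integral_sum continuous_swp cf)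
  also have "\<dots> = (\<Sum>j=1..?N. ?I ?f)"
    by (intro sum.cong refl perm cf)
  also have "\<dots> = real ?N * ?I ?f" by simp
  finally have A: "poly \<phi> s * ?I ?W = (\<Sum>z\<in>Z. poly \<phi> z * ?I (node_end Z ?N z s)) + real ?N * ?I ?f" .

  \<comment> \<open>\<open>?f + 2 * ?g\<close> is the derivative of \<open>poly \<phi>\<close> times
    the kernel in the last coordinate, so \<open>?f\<close> can be exchanged for
    \<open>- 2 * ?g\<close> and a boundary value.\<close>
  let ?g = "\<lambda>t. poly \<phi> (t ?N) * ?D t"
  have cg: "continuous_on UNIV ?g" by (intro continuous_intros)
  have "?I (\<lambda>t. ?f t + 2 * ?g t) = cube_integral n (\<lambda>t. poly \<phi> ((t(?N := 1)) ?N) * ?K (t(?N := 1)))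
      - cube_integral n (\<lambda>t. poly \<phi> ((t(?N := 0)) ?N) * ?K (t(?N := 0)))"
  proof (rule cube_integral_deriv)
    show "continuous_on UNIV (\<lambda>t. ?f t + 2 * ?g t)" by (intro continuous_intros)
    show "continuous_on UNIV (\<lambda>t. poly \<phi> (t ?N) * ?K t)" by (intro continuous_intros)
    fix t :: "nat \<Rightarrow> real" and x :: real
    show "((\<lambda>x. poly \<phi> ((t(?N := x)) ?N) * ?K (t(?N := x))) has_real_derivative
      ?f (t(?N := x)) + 2 * ?g (t(?N := x))) (at x)"
      using DERIV_mult[OF poly_DERIV[of \<phi> x] node_kernel_has_derivative[of Z n s t x]]
      by (simp add: algebra_simps)
  qed
  also have "\<dots> = poly \<phi> 1 * cube_integral n ?K1"
    by (simp add: K0 cube_integral_def)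
  also have "?I (\<lambda>t. ?f t + 2 * ?g t) = ?I ?f + 2 * ?I ?g"
    using cube_integral_add[OF cf continuous_on_mult_left[OF cg, of 2], of ?N] by simp
  finally have B: "?I ?f = poly \<phi> 1 * cube_integral n ?K1 - 2 * ?I ?g"
    by (simp only: eq_diff_eq)

  have "?I (\<lambda>t. ?S t * (J t - ?W t)) = ?I (\<lambda>t. \<Sum>j=1..?N. ?S (t \<circ> swp j ?N) * ?D (t \<circ> swp j ?N))"
  proof (rule cube_integral_cong[OF _ _ Z(1)])
    show "continuous_on UNIV (\<lambda>t. ?S t * (J t - ?W t))" by (intro continuous_intros cS cJ)
    show "continuous_on UNIV (\<lambda>t. \<Sum>j=1..?N. ?S (t \<circ> swp j ?N) * ?D (t \<circ> swp j ?N))"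
      by (intro continuous_on_sum continuous_on_mult continuous_swp cS continuous_node_kernel')
    fix t :: "nat \<Rightarrow> real" assume t: "\<And>i. i \<in> {1..?N} \<Longrightarrow> t i \<notin> Z"
    \<comment> \<open>For the constant polynomial 1 the formula expresses the difference of the
      weights by derivatives of kernels alone.\<close>
    have "?W t = J t - (\<Sum>j=1..?N. ?D (t \<circ> swp j ?N))"
      using node_hermite[OF Z(1) t, where \<phi>=1 and s=s] by (simp add: J_def sum_negf)
    moreover have "(\<Sum>j=1..?N. ?S (t \<circ> swp j ?N) * ?D (t \<circ> swp j ?N)) = (\<Sum>j=1..?N. ?S t * ?D (t \<circ> swp j ?N))"
      by (intro sum.cong refl) (simp only: Sigma_sum_def sum_swp[of _ ?N ?N "poly \<phi>" t] jN)
    ultimately show "?S t * (J t - ?W t) = (\<Sum>j=1..?N. ?S (t \<circ> swp j ?N) * ?D (t \<circ> swp j ?N))"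
      by (simp only: sum_distrib_left[symmetric]) simp
  qed
  also have "\<dots> = (\<Sum>j=1..?N. ?I (\<lambda>t. ?S (t \<circ> swp j ?N) * ?D (t \<circ> swp j ?N)))"
    by (intro cube_integral_sum continuous_on_mult continuous_swp cS continuous_node_kernel')
  also have "\<dots> = (\<Sum>j=1..?N. ?I (\<lambda>t. ?S t * ?D t))"
    by (intro sum.cong refl perm[of "\<lambda>t. ?S t * ?D t"] continuous_on_mult cS continuous_node_kernel')
  also have "\<dots> = real ?N * ?I (\<lambda>t. ?S t * ?D t)" by simp
  \<comment> \<open>The summand of the last coordinate is separated: the others do not contain the
    variable of differentiation, so their product with \<open>?D\<close> is an exact
    derivative.\<close>
  also have "(\<lambda>t. ?S t * ?D t) = (\<lambda>t. ?g t + ?S' t * ?D t)"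
    by (simp add: Sigma_sum_def fun_eq_iff algebra_simps)
  also have "?I (\<lambda>t. ?g t + ?S' t * ?D t) = ?I ?g + ?I (\<lambda>t. ?S' t * ?D t)"
    by (intro cube_integral_add cg continuous_on_mult cS continuous_node_kernel')
  also have "?I (\<lambda>t. ?S' t * ?D t)
      = cube_integral n (\<lambda>t. ?S' (t(?N := 1)) * ?K (t(?N := 1))) - cube_integral n (\<lambda>t. ?S' (t(?N := 0)) * ?K (t(?N := 0)))"
  proof (rule cube_integral_deriv)
    show "continuous_on UNIV (\<lambda>t. ?S' t * ?D t)" "continuous_on UNIV (\<lambda>t. ?S' t * ?K t)"
      by (intro continuous_intros cS)+
    fix t :: "nat \<Rightarrow> real" and x :: real
    have "?S' (t(?N := x)) = ?S' t" for x
      unfolding Sigma_sum_def by (intro sum.cong) auto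
    then show "((\<lambda>x. ?S' (t(?N := x)) * ?K (t(?N := x))) has_real_derivative ?S' (t(?N := x)) * ?D (t(?N := x))) (at x)"
      using DERIV_cmult[OF node_kernel_has_derivative[of Z n s t x], of "?S' t"] by simp
  qed
  also have "(\<lambda>t. ?S' (t(?N := 1)) * ?K (t(?N := 1))) = (\<lambda>t. ?S' t * ?K1 t)"
    unfolding Sigma_sum_def by (intro ext arg_cong2[where f="(*)"] sum.cong) auto
  also have "cube_integral n (\<lambda>t. ?S' (t(?N := 0)) * ?K (t(?N := 0))) = 0"
    by (simp add: K0 cube_integral_def)
  finally have C: "?I (\<lambda>t. ?S t * (J t - ?W t)) = real ?N * (?I ?g + cube_integral n (\<lambda>t. ?S' t * ?K1 t))"
    by (simp only: diff_0_right)
  have "?I (\<lambda>t. ?S t * (?W t - J t)) = - ?I (\<lambda>t. ?S t * (J t - ?W t))"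
    unfolding cube_integral_minus[symmetric] by (simp add: algebra_simps)
  then show ?thesis
    unfolding A B C by (simp only:) (simp add: algebra_simps)
qed


text \<open>The simple node is 0, with \<open>m\<close> double nodes. At 1 the kernel becomes
  \<open>- Jc_eu m s t\<close>, the source of the integrals over one dimension less; the number
  \<open>m\<close> of coordinates turns \<open>fact m\<close> into \<open>fact (m - 1)\<close>
  there.\<close>

lemma even_case:
  fixes \<phi> :: "real poly"
  assumes m: "m \<ge> 1" and deg: "degree \<phi> \<le> 2 * m"
  shows "poly \<phi> s * moment_vol (2 * m) =
        - (2 / (fact (2 * m) * fact m))
          * cube_integral m (\<lambda>t. Sigma_sum m (poly \<phi>) t * (Jc_el m s t - Jc_el m 0 t))
        - 2 / (fact (2 * m) * fact (m - 1))
          * cube_integral (m - 1) (\<lambda>t. Sigma_sum (m - 1) (poly \<phi>) t * Jc_eu m s t)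
        + poly \<phi> 0 / (fact (2 * m) * fact m) * cube_integral m (\<lambda>t. Jc_el m s t)
        - poly \<phi> 1 / (fact (2 * m) * fact (m - 1)) * cube_integral (m - 1) (\<lambda>t. Jc_eu m s t)"
proof -
  obtain n where n: "m = Suc n" using m by (cases m) auto
  have W: "node_weight {0} m = Jc_el m 0"
    by (simp add: fun_eq_iff node_weight_def Jc_el_def poly_node_poly)
  have E: "node_end {0} m 0 s = Jc_el m s"
    by (simp add: fun_eq_iff node_end_def Jc_el_def poly_node_poly power2_commute[of s])
  have K: "node_kernel {0} n s (t(m := 1)) = - Jc_eu m s t" for t
    by (simp add: n node_kernel_def Jc_eu_def poly_conf_poly poly_node_poly node_weight_def
        power2_commute[of s] prod.distrib algebra_simps)
  have I: "cube_integral m (Jc_el m 0) = fact (2 * m) * fact m * moment_vol (2 * m)"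
  proof -
    have "Jc_el m 0 = selberg_weight 2 0 m"
      by (simp add: fun_eq_iff Jc_el_def selberg_weight_def)
    then show ?thesis using selberg_moment_vol(1)[of m] by (simp add: selberg_def)
  qed
  have "\<phi>s * (f * (r * g) * v) = p0 * a + 2 * - b - r * p1 * c - 2 * r * d \<Longrightarrow> f \<noteq> 0 \<Longrightarrow> r \<noteq> 0 \<Longrightarrow> g \<noteq> 0 \<Longrightarrow>
    \<phi>s * v = - (2 / (f * (r * g))) * b - 2 / (f * g) * d + p0 / (f * (r * g)) * a - p1 / (f * g) * c"
    for \<phi>s f r g v p0 a b p1 c d :: real
  proof -
    assume h: "\<phi>s * (f * (r * g) * v) = p0 * a + 2 * - b - r * p1 * c - 2 * r * d" and nz: "f \<noteq> 0" "r \<noteq> 0" "g \<noteq> 0"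
    have "\<phi>s * v = \<phi>s * (f * (r * g) * v) / (f * (r * g))" using nz by simp
    also have "\<dots> = - (2 / (f * (r * g))) * b - 2 / (f * g) * d + p0 / (f * (r * g)) * a - p1 / (f * g) * c"
      unfolding h using nz by (simp add: add_divide_distrib diff_divide_distrib)
    finally show ?thesis .
  qed
  note arith = this
  have fm: "fact m = (real m * fact n :: real)" by (simp add: n)
  have neg: "cube_integral m (\<lambda>t. Sigma_sum m (poly \<phi>) t * (Jc_el m 0 t - Jc_el m s t))
     = - cube_integral m (\<lambda>t. Sigma_sum m (poly \<phi>) t * (Jc_el m s t - Jc_el m 0 t))"
    unfolding cube_integral_minus[symmetric] by (simp add: algebra_simps)
  have "poly \<phi> s * (fact (2 * m) * (real m * fact n) * moment_vol (2 * m))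
    = poly \<phi> 0 * cube_integral m (Jc_el m s)
    + 2 * - cube_integral m (\<lambda>t. Sigma_sum m (poly \<phi>) t * (Jc_el m s t - Jc_el m 0 t))
    - real m * poly \<phi> 1 * cube_integral n (Jc_eu m s)
    - 2 * real m * cube_integral n (\<lambda>t. Sigma_sum n (poly \<phi>) t * Jc_eu m s t)"
    using quadrature[where Z="{0}" and \<phi>=\<phi> and n=n and s=s] deg
    unfolding neg[symmetric] n[symmetric] K
    by (simp add: W E I fm n[symmetric])
  from arith[OF this] show ?thesis
    using m by (simp add: n fm[unfolded n])
qed

text \<open>The simple nodes are 0 and 1, with \<open>m - 1\<close> double nodes, so the kernel
  vanishes at both ends and no boundary integrals appear.\<close>

lemma odd_case:
  fixes \<phi> :: "real poly"
  assumes m: "m \<ge> 1" and deg: "degree \<phi> \<le> 2 * m - 1"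
  shows "poly \<phi> s * moment_vol (2 * m - 1) =
        2 / (fact (2 * m - 1) * fact (m - 1))
          * cube_integral (m - 1) (\<lambda>t. Sigma_sum (m - 1) (poly \<phi>) t * Hc m s t)
        + poly \<phi> 0 / (fact (2 * m - 1) * fact (m - 1)) * cube_integral (m - 1) (\<lambda>t. Jc_ou m s t)
        + poly \<phi> 1 / (fact (2 * m - 1) * fact (m - 1)) * cube_integral (m - 1) (\<lambda>t. Jc_ol m s t)"
proof -
  obtain k where k: "m = Suc k" using m by (cases m) auto
  have I: "cube_integral k (Jc_ou m 0) = fact (2 * m - 1) * fact k * moment_vol (2 * m - 1)"
  proof -
    have "Jc_ou m 0 = selberg_weight 2 2 k"
      by (simp add: fun_eq_iff Jc_ou_def selberg_weight_def k prod.distrib)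
    moreover have "2 * m - 1 = 2 * k + 1" using k by simp
    ultimately show ?thesis using selberg_moment_vol(2)[of k] by (simp only: selberg_def)
  qed
  have "poly \<phi> s * cube_integral k (Jc_ou m 0)
    = 2 * cube_integral k (\<lambda>t. Sigma_sum k (poly \<phi>) t * Hc m s t)
      + poly \<phi> 0 * cube_integral k (Jc_ou m s) + poly \<phi> 1 * cube_integral k (Jc_ol m s)"
  proof (cases k)
    \<comment> \<open>For \<open>m = 1\<close> there is no double node to differentiate in, and the
      claim is linear interpolation between 0 and 1.\<close>
    case 0
    have "degree \<phi> \<le> 1" using deg k 0 by simp
    then have "\<phi> = [:coeff \<phi> 0, coeff \<phi> 1:]"
      by (intro poly_eqI) (auto simp: coeff_pCons coeff_eq_0 One_nat_def split: nat.split)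
    then obtain a b where "\<phi> = [:a, b:]" by blast
    moreover have "cube_integral 0 (\<lambda>t. c) = c" for c
      using prob_space.prob_space[OF prob_space_cube[of 0]]
      by (subst cube_integral_continuous) (auto intro: continuous_intros)
    ultimately show ?thesis
      using k 0 by (simp add: Jc_ou_def[abs_def] Jc_ol_def[abs_def] Sigma_sum_def algebra_simps)
  next
    case (Suc n)
    have sd: "{0, 1} - {0} = {1 :: real}" "{0, 1} - {1} = {0 :: real}" by auto
    have W: "node_weight {0, 1} k = Jc_ou m 0"
      by (simp add: fun_eq_iff node_weight_def Jc_ou_def poly_node_poly k power_mult_distrib prod.distrib power2_commute[of 1])
    have E: "node_end {0, 1} k 0 s = Jc_ou m s" "node_end {0, 1} k 1 s = Jc_ol m s"
      by (simp_all add: fun_eq_iff node_end_def Jc_ou_def Jc_ol_def poly_node_poly power2_commute[of s] power2_commute[of 1] k sd)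
    have K: "node_kernel {0, 1} n s (t(k := 1)) = 0" for t
      unfolding Suc by (rule node_kernel_zero) (simp add: poly_node_poly)
    have c: "card {0, 1 :: real} = 2" by simp
    have H: "Jc_ou m 0 t - (Jc_ou m s t + Jc_ol m s t) = Hc m s t" for t by (simp add: Hc_def)
    have z: "cube_integral n (\<lambda>t. 0) = 0" by (simp add: cube_integral_def)
    have "degree \<phi> < card {0, 1 :: real} + 2 * Suc n" using deg c k Suc by simp
    from quadrature[OF _ _ this, where s=s] show ?thesis
      unfolding Suc[symmetric] K by (simp add: W E H z)
  qed
  note E = this[unfolded I]
  define F :: real where "F = fact (2 * m - 1) * fact k"
  have F: "F \<noteq> 0" by (simp add: F_def)
  have "poly \<phi> s * moment_vol (2 * m - 1) = poly \<phi> s * (F * moment_vol (2 * m - 1)) / F"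
    using F by simp
  also have "\<dots> = 2 / F * cube_integral k (\<lambda>t. Sigma_sum k (poly \<phi>) t * Hc m s t)
        + poly \<phi> 0 / F * cube_integral k (Jc_ou m s) + poly \<phi> 1 / F * cube_integral k (Jc_ol m s)"
    unfolding E[folded F_def] by (simp only: add_divide_distrib times_divide_eq_left)
  finally have "poly \<phi> s * moment_vol (2 * m - 1) = 2 / F * cube_integral k (\<lambda>t. Sigma_sum k (poly \<phi>) t * Hc m s t)
        + poly \<phi> 0 / F * cube_integral k (Jc_ou m s) + poly \<phi> 1 / F * cube_integral k (Jc_ol m s)" .
  moreover have "m - 1 = k" using k by simp
  ultimately show ?thesis by (simp only: F_def)
qed

section \<open>Canonical moments and Gauss quadrature\<close>

declare One_nat_def [simp]

text \<open>The moment functional that sends the i-th power of x to \<open>c i\<close>. With the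
  shifted sequence, \<open>Lin (shift k c) p\<close> is its value at x^k p.\<close>

definition Lin :: "(nat \<Rightarrow> real) \<Rightarrow> real poly \<Rightarrow> real" where
  "Lin c p = (\<Sum>i\<le>degree p. coeff p i * c i)"

abbreviation shift :: "nat \<Rightarrow> (nat \<Rightarrow> real) \<Rightarrow> nat \<Rightarrow> real" where
  "shift k c \<equiv> (\<lambda>i. c (i + k))"

lemma Lin_eq: "degree p \<le> n \<Longrightarrow> Lin c p = (\<Sum>i\<le>n. coeff p i * c i)"
  unfolding Lin_def by (rule sum.mono_neutral_left) (auto simp: coeff_eq_0)

lemma Lin_add: "Lin c (p + q) = Lin c p + Lin c q"
  by (simp add: Lin_eq[of _ "max (degree p) (degree q)"] degree_add_le sum.distrib distrib_right)

lemma Lin_smult: "Lin c (smult a p) = a * Lin c p"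
  by (simp add: Lin_eq[of _ "degree p"] degree_smult_le sum_distrib_left mult.assoc)

lemma Lin_diff: "Lin c (p - q) = Lin c p - Lin c q"
  using Lin_add[of c p "smult (- 1) q"] Lin_smult[of c "- 1" q] by simp

lemma Lin_0 [simp]: "Lin c 0 = 0"
  by (simp add: Lin_def)

lemma Lin_1 [simp]: "Lin c 1 = c 0"
  by (simp add: Lin_def)

lemma Lin_sum: "Lin c (\<Sum>x\<in>A. f x) = (\<Sum>x\<in>A. Lin c (f x))"
  by (induction A rule: infinite_finite_induct) (simp_all add: Lin_add)

lemma Lin_pCons: "Lin c (pCons a p) = a * c 0 + Lin (shift 1 c) p"
proof -
  have "Lin c (pCons a p) = (\<Sum>i\<le>Suc (degree p). coeff (pCons a p) i * c i)"
    by (rule Lin_eq) (simp add: degree_pCons_le)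
  then show ?thesis by (subst (asm) sum.atMost_Suc_shift) (simp add: Lin_def One_nat_def)
qed

lemma Lin_mult: "Lin c (p * q) = Lin (\<lambda>i. Lin (shift i c) p) q"
proof (induction q arbitrary: c)
  case 0
  then show ?case by simp
next
  case (pCons a q)
  have "Lin c (p * pCons a q) = a * Lin c p + Lin (shift 1 c) (p * q)"
    by (simp add: Lin_add Lin_smult Lin_pCons)
  also have "\<dots> = Lin (\<lambda>i. Lin (shift i c) p) (pCons a q)"
    unfolding pCons.IH by (simp add: Lin_pCons add_ac)
  finally show ?case .
qed

lemma Lin_cong: "(\<And>i. i \<le> degree p \<Longrightarrow> c i = d i) \<Longrightarrow> Lin c p = Lin d p"
  by (auto simp: Lin_def intro: sum.cong)

text \<open>Orthogonality to all powers below \<open>d\<close> leaves only the top coefficient of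
  \<open>q\<close>.\<close>

lemma Lin_mult_orthogonal:
  assumes "\<And>i. i < d \<Longrightarrow> Lin (shift i c) p = 0" and "degree q \<le> d"
  shows "Lin c (p * q) = coeff q d * Lin (shift d c) p"
proof -
  have "Lin c (p * q) = (\<Sum>i\<le>d. coeff q i * Lin (shift i c) p)"
    unfolding Lin_mult by (rule Lin_eq[OF assms(2)])
  also have "\<dots> = (\<Sum>i\<le>d. if i = d then coeff q d * Lin (shift d c) p else 0)"
    by (intro sum.cong refl) (use assms(1) in auto)
  finally show ?thesis by simp
qed

text \<open>With a the leading coefficient of f, the remainder g = f - a R has smaller degree and is
  orthogonal to R. So the value at f^2 is a^2 times the norm of R plus the value at g^2.\<close>

lemma Lin_pos_def:
  assumes R: "\<And>d. d \<le> D \<Longrightarrow> degree (R d) = d \<and> lead_coeff (R d) = 1"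
    and orth: "\<And>d i. d \<le> D \<Longrightarrow> i < d \<Longrightarrow> Lin (shift i c) (R d) = 0"
    and pos: "\<And>d. d \<le> D \<Longrightarrow> Lin (shift d c) (R d) > 0"
  shows "f \<noteq> 0 \<Longrightarrow> degree f \<le> D \<Longrightarrow> Lin c (f * f) > 0"
proof (induction "degree f" arbitrary: f rule: less_induct)
  case less
  let ?d = "degree f" and ?a = "lead_coeff f"
  define g where "g = f - smult ?a (R ?d)"
  have dR: "degree (R ?d) = ?d" and lR: "coeff (R ?d) ?d = 1" using R[of ?d] less.prems by auto
  have a: "?a \<noteq> 0" using less.prems by simp
  have gd: "coeff g ?d = 0" by (simp add: g_def lR)
  have deg: "degree g \<le> ?d" unfolding g_def by (intro degree_diff_le) (auto simp: dR degree_smult_le)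
  have f: "f * f = smult (?a\<^sup>2) (R ?d * R ?d) + smult (2 * ?a) (R ?d * g) + g * g"
  proof -
    have E: "f = smult ?a (R ?d) + g"
      by (subst g_def, subst add.commute, rule diff_add_cancel[symmetric])
    have "f * f = (smult ?a (R ?d) + g) * (smult ?a (R ?d) + g)"
      by (rule arg_cong2[where f="(*)", OF E E])
    also have "\<dots> = smult ?a (smult ?a (R ?d * R ?d)) + (smult ?a (R ?d * g) + smult ?a (R ?d * g)) + g * g"
      by (simp add: algebra_simps)
    also have "smult ?a (R ?d * g) + smult ?a (R ?d * g) = smult (2 * ?a) (R ?d * g)"
      by (simp add: smult_add_left[symmetric])
    finally show ?thesis by (simp add: power2_eq_square add.assoc smult_add_left[symmetric])
  qed
  have RR: "Lin c (R ?d * R ?d) = Lin (shift ?d c) (R ?d)"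
    using Lin_mult_orthogonal[of ?d c "R ?d" "R ?d"] orth[of ?d] less.prems dR lR by simp
  have Rg: "Lin c (R ?d * g) = 0"
    using Lin_mult_orthogonal[of ?d c "R ?d" g] orth[of ?d] less.prems deg gd by simp
  have "Lin c (g * g) \<ge> 0"
  proof (cases "g = 0")
    case False
    then have "degree g \<noteq> ?d" using gd by (metis leading_coeff_0_iff)
    then show ?thesis using less.hyps[of g] False deg less.prems by fastforce
  qed simp
  moreover have "?a\<^sup>2 * Lin (shift ?d c) (R ?d) > 0"
    using a pos[of ?d] less.prems by simp
  ultimately show ?case
    by (subst f) (simp add: Lin_add Lin_smult RR Rg)
qed

text \<open>\<open>lowp p n\<close> and \<open>upp p n\<close> are the monic polynomials, orthogonal with respect to the moments
  with canonical moments \<open>p\<close>, that measure the distance of the \<open>n\<close>-th moment from the lower and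
  from the upper end of its range, the latter up to sign. They depend on \<open>p 1, \<dots>, p (n - 1)\<close> only.\<close>

fun canpair :: "(nat \<Rightarrow> real) \<Rightarrow> nat \<Rightarrow> real poly \<times> real poly" where
  "canpair p 0 = (1, 0)"
| "canpair p (Suc 0) = ([:0, 1:], [:1, - 1:])"
| "canpair p (Suc (Suc n)) =
    (let k = Suc n; F = fst (canpair p k); U = snd (canpair p k);
       F' = (if even k then pCons 0 (smult (1 - p k) F) else smult (1 - p k) F) - smult (p k) U
     in (F', smult (1 - p k) F - (if even k then F' else pCons 0 F')))"

definition lowp :: "(nat \<Rightarrow> real) \<Rightarrow> nat \<Rightarrow> real poly" where "lowp p n = fst (canpair p n)"
definition upp :: "(nat \<Rightarrow> real) \<Rightarrow> nat \<Rightarrow> real poly" where "upp p n = snd (canpair p n)"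

lemma lowp_1 [simp]: "lowp p (Suc 0) = [:0, 1:]" and upp_1 [simp]: "upp p (Suc 0) = [:1, - 1:]"
  and lowp_0 [simp]: "lowp p 0 = 1"
  by (simp_all add: lowp_def upp_def)

lemma lowp_even:
  assumes "even n" "n \<noteq> 0"
  shows "lowp p (Suc n) = pCons 0 (smult (1 - p n) (lowp p n)) - smult (p n) (upp p n)"
    "upp p (Suc n) = smult (1 - p n) (lowp p n) - lowp p (Suc n)"
  using assms by (cases n; simp add: lowp_def upp_def Let_def)+

lemma lowp_odd:
  assumes "odd n"
  shows "lowp p (Suc n) = smult (1 - p n) (lowp p n) - smult (p n) (upp p n)"
    "upp p (Suc n) = smult (1 - p n) (lowp p n) - pCons 0 (lowp p (Suc n))"
  using assms by (cases n; simp add: lowp_def upp_def Let_def)+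

lemma canpair_cong: "(\<And>i. 1 \<le> i \<Longrightarrow> i < n \<Longrightarrow> p i = q i) \<Longrightarrow> canpair p n = canpair q n"
  by (induction p n rule: canpair.induct) (simp_all add: Let_def One_nat_def)

lemma canpair_degree:
  assumes "n \<ge> 1"
  shows "degree (lowp p n) \<le> (n + 1) div 2 \<and> coeff (lowp p n) ((n + 1) div 2) = 1 \<and>
    degree (upp p n) \<le> (n + 2) div 2 \<and> coeff (upp p n) ((n + 2) div 2) = - 1"
  using assms
proof (induction n rule: dec_induct)
  case base
  then show ?case by (simp add: One_nat_def)
next
  case (step n)
  show ?case
  proof (cases "even n")
    case True
    then obtain k where n: "n = 2 * k" by blast
    have k: "k \<noteq> 0" using step n by auto
    have L: "lowp p (Suc n) = pCons 0 (smult (1 - p n) (lowp p n)) - smult (p n) (upp p n)"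
      and U: "upp p (Suc n) = smult (1 - p n) (lowp p n) - lowp p (Suc n)"
      using lowp_even[OF True] step by auto
    have d: "degree (lowp p n) \<le> k" "coeff (lowp p n) k = 1" "degree (upp p n) \<le> Suc k" "coeff (upp p n) (Suc k) = - 1"
      using step.IH by (auto simp: n)
    have 1: "degree (lowp p (Suc n)) \<le> Suc k" unfolding L
      using d by (intro degree_diff_le) (auto intro: order_trans[OF degree_pCons_le] order_trans[OF degree_smult_le])
    have 2: "coeff (lowp p (Suc n)) (Suc k) = 1" unfolding L using d by simp
    have 3: "degree (upp p (Suc n)) \<le> Suc k" unfolding U
      using d 1 by (intro degree_diff_le) (auto intro: order_trans[OF degree_smult_le])
    have 4: "coeff (upp p (Suc n)) (Suc k) = - 1" unfolding U using d 2 by (simp add: coeff_eq_0)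
    show ?thesis using 1 2 3 4 by (simp add: n)
  next
    case False
    then obtain k where n: "n = 2 * k + 1" by (elim oddE)
    have L: "lowp p (Suc n) = smult (1 - p n) (lowp p n) - smult (p n) (upp p n)"
      and U: "upp p (Suc n) = smult (1 - p n) (lowp p n) - pCons 0 (lowp p (Suc n))"
      using lowp_odd[OF False] by auto
    have d: "degree (lowp p n) \<le> Suc k" "coeff (lowp p n) (Suc k) = 1" "degree (upp p n) \<le> Suc k" "coeff (upp p n) (Suc k) = - 1"
      using step.IH by (auto simp: n)
    have 1: "degree (lowp p (Suc n)) \<le> Suc k" unfolding L
      using d by (intro degree_diff_le) (auto intro: order_trans[OF degree_smult_le])
    have 2: "coeff (lowp p (Suc n)) (Suc k) = 1" unfolding L using d by simp
    have 3: "degree (upp p (Suc n)) \<le> Suc (Suc k)" unfolding U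
      using d 1 by (intro degree_diff_le) (auto intro: order_trans[OF degree_smult_le] order_trans[OF degree_pCons_le])
    have 4: "coeff (upp p (Suc n)) (Suc (Suc k)) = - 1" unfolding U using d 2 by (simp add: coeff_eq_0)
    show ?thesis using 1 2 3 4 by (simp add: n)
  qed
qed

text \<open>These factors are nonnegative on the unit interval. The cofactors are orthogonal
  polynomials for the functional weighted by 1, x, 1 - x or x (1 - x), so a factor times its squared
  cofactor is a nonnegative test function.\<close>

definition low_factor :: "nat \<Rightarrow> real poly" where "low_factor n = (if even n then 1 else [:0, 1:])"
definition up_factor :: "nat \<Rightarrow> real poly" where "up_factor n = (if even n then [:0, 1, - 1:] else [:1, - 1:])"

lemma canpair_factor:
  assumes "n \<ge> 1"
  shows "low_factor n dvd lowp p n \<and> up_factor n dvd upp p n"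
  using assms
proof (induction n rule: dec_induct)
  case base
  then show ?case by (simp add: One_nat_def low_factor_def up_factor_def)
next
  case (step n)
  obtain R S where R: "lowp p n = low_factor n * R" and S: "upp p n = up_factor n * S"
    using step.IH by (auto elim!: dvdE)
  define X A B :: "real poly" where "X = [:0, 1:]" and "A = [:1 - p n:]" and "B = [:p n:]"
  have sm: "smult (1 - p n) q = A * q" "smult (p n) q = B * q" "pCons 0 q = X * q" for q
    by (simp_all add: A_def B_def X_def)
  show ?case
  proof (cases "even n")
    case True
    have e: "low_factor n = 1" "up_factor n = X * (1 - X)" "low_factor (Suc n) = X" "up_factor (Suc n) = 1 - X"
      using True by (simp_all add: low_factor_def up_factor_def X_def one_pCons)
    have L: "lowp p (Suc n) = X * (A * R - B * ((1 - X) * S))"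
      using lowp_even(1)[OF True, of p] step(1) unfolding R S sm e by (simp add: algebra_simps)
    have "upp p (Suc n) = (1 - X) * (A * R + B * (X * S))"
      using lowp_even(2)[OF True, of p] step(1) unfolding L R sm e by (simp add: algebra_simps)
    then show ?thesis unfolding L e by simp
  next
    case False
    have e: "low_factor n = X" "up_factor n = 1 - X" "low_factor (Suc n) = 1" "up_factor (Suc n) = X * (1 - X)"
      using False by (simp_all add: low_factor_def up_factor_def X_def one_pCons)
    have L: "lowp p (Suc n) = A * (X * R) - B * ((1 - X) * S)"
      using lowp_odd(1)[OF False, of p] unfolding R S sm e .
    have "upp p (Suc n) = X * (1 - X) * (A * R + B * S)"
      using lowp_odd(2)[OF False, of p] unfolding L R sm e by (simp add: algebra_simps)
    then show ?thesis unfolding e by simp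
  qed
qed

lemma canpair_factor_obtain:
  assumes "n \<ge> 1"
  obtains R S where "lowp p n = low_factor n * R" "degree R = n div 2" "lead_coeff R = 1"
    "upp p n = up_factor n * S" "degree S = (n - 1) div 2" "lead_coeff S = 1"
proof -
  obtain R S where R: "lowp p n = low_factor n * R" and S: "upp p n = up_factor n * S"
    using canpair_factor[OF assms, of p] by (auto elim!: dvdE)
  note d = canpair_degree[OF assms, of p]
  have dl: "degree (lowp p n) = (n + 1) div 2" "lead_coeff (lowp p n) = 1"
    using d le_degree[of "lowp p n" "(n + 1) div 2"] by (auto intro: antisym)
  have du: "degree (upp p n) = (n + 2) div 2" "lead_coeff (upp p n) = - 1"
    using d le_degree[of "upp p n" "(n + 2) div 2"] by (auto intro: antisym)
  have nz: "R \<noteq> 0" "S \<noteq> 0" "low_factor n \<noteq> 0" "up_factor n \<noteq> 0"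
    using dl du R S by (auto simp: low_factor_def up_factor_def)
  have f: "degree (low_factor n) = (if even n then 0 else 1)" "lead_coeff (low_factor n) = 1"
    "degree (up_factor n) = (if even n then 2 else 1)" "lead_coeff (up_factor n) = - 1"
    by (auto simp: low_factor_def up_factor_def)
  have "degree R + degree (low_factor n) = (n + 1) div 2"
    using dl nz degree_mult_eq[of "low_factor n" R] by (simp add: R)
  moreover have "degree S + degree (up_factor n) = (n + 2) div 2"
    using du nz degree_mult_eq[of "up_factor n" S] by (simp add: S)
  ultimately have "degree R = n div 2" "degree S = (n - 1) div 2"
    using f assms by (auto split: if_splits elim!: evenE oddE)
  moreover have "lead_coeff R = 1"
    using lead_coeff_mult[of "low_factor n" R] dl(2) f(2) by (simp only: R)
  moreover have "lead_coeff S = 1"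
    using lead_coeff_mult[of "up_factor n" S] du(2) f(4) by (simp only: S)
  ultimately show ?thesis using that R S by blast
qed

definition canw :: "(nat \<Rightarrow> real) \<Rightarrow> nat \<Rightarrow> real" where
  "canw p n = (\<Prod>i=1..<n. p i * (1 - p i))"

text \<open>The moments with prescribed canonical moments: \<open>canm p n\<close> lies \<open>canw p n * p n\<close> above the
  lower end of the range of the \<open>n\<close>-th moment, and \<open>canw p n\<close> is the length of this range.\<close>

function canm :: "(nat \<Rightarrow> real) \<Rightarrow> nat \<Rightarrow> real" where
  "canm p n = (if n = 0 then 1 else canw p n * p n
     - (\<Sum>i<(n + 1) div 2. coeff (lowp p n) i * canm p (i + n div 2)))"
  by pat_completeness auto
termination by (relation "Wellfounded.measure snd") auto

declare canm.simps [simp del]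

lemma canm_0 [simp]: "canm p 0 = 1" by (simp add: canm.simps)

lemma canw_Suc: "n \<ge> 1 \<Longrightarrow> canw p (Suc n) = canw p n * (p n * (1 - p n))"
  by (simp add: canw_def)

text \<open>\<open>lowp p n\<close> is monic, so \<open>canm p n\<close> enters with coefficient 1,
  and its definition is this equation solved for it.\<close>

lemma Lin_lowp_diag:
  assumes "n \<ge> 1"
  shows "Lin (shift (n div 2) (canm p)) (lowp p n) = canw p n * p n"
proof -
  let ?d = "(n + 1) div 2"
  note d = canpair_degree[OF assms, of p]
  have e: "?d + n div 2 = n" by presburger
  have "Lin (shift (n div 2) (canm p)) (lowp p n) = (\<Sum>i\<le>?d. coeff (lowp p n) i * canm p (i + n div 2))"
    using d by (intro Lin_eq) auto
  also have "\<dots> = (\<Sum>i<?d. coeff (lowp p n) i * canm p (i + n div 2)) + canm p n"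
    using d e by (simp add: lessThan_Suc_atMost[symmetric])
  also have "canm p n = canw p n * p n - (\<Sum>i<?d. coeff (lowp p n) i * canm p (i + n div 2))"
    using assms by (subst canm.simps) simp
  finally show ?thesis by simp
qed

lemma Lin_shift_pCons: "Lin (shift i c) (pCons 0 q) = Lin (shift (Suc i) c) q"
  by (simp add: Lin_pCons add_ac One_nat_def)

text \<open>This is what the recursion of \<open>canpair\<close> is designed for. Write w and p for
  \<open>canw p n\<close> and \<open>p n\<close>. The first nonzero values of \<open>lowp\<close>
  and \<open>upp\<close> are w p and w (1 - p); weighted with 1 - p and - p they cancel (after a
  shift by x for even \<open>n\<close>), so the next \<open>lowp\<close> is orthogonal to one more
  power. The next \<open>upp\<close> plus the next \<open>lowp\<close> (times x for odd
  \<open>n\<close>) is (1 - p) times the old \<open>lowp\<close>, with value w p (1 - p), the next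
  \<open>canw\<close>; so the next \<open>upp\<close> takes the share that \<open>lowp\<close>
  leaves.\<close>

lemma canpair_orthogonal:
  assumes "n \<ge> 1"
  shows "(\<forall>i<n div 2. Lin (shift i (canm p)) (lowp p n) = 0) \<and>
    (\<forall>i<(n - 1) div 2. Lin (shift i (canm p)) (upp p n) = 0) \<and>
    Lin (shift ((n - 1) div 2) (canm p)) (upp p n) = canw p n * (1 - p n)"
  using assms
proof (induction n rule: dec_induct)
  case base
  have "canm p (Suc 0) = p (Suc 0)"
    using Lin_lowp_diag[of "Suc 0" p] by (simp add: Lin_pCons canw_def One_nat_def)
  then show ?case by (simp add: Lin_pCons canw_def One_nat_def)
next
  case (step n)
  let ?c = "canm p"
  have diag: "Lin (shift (n div 2) ?c) (lowp p n) = canw p n * p n"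
    "Lin (shift (Suc n div 2) ?c) (lowp p (Suc n)) = canw p (Suc n) * p (Suc n)"
    using Lin_lowp_diag step by auto
  have w: "canw p (Suc n) = canw p n * (p n * (1 - p n))" using canw_Suc step by auto
  show ?case
  proof (cases "even n")
    case True
    then obtain k where n: "n = 2 * k" by blast
    have k: "k \<noteq> 0" using step n by auto
    have L: "Lin (shift i ?c) (lowp p (Suc n)) = (1 - p n) * Lin (shift (Suc i) ?c) (lowp p n) - p n * Lin (shift i ?c) (upp p n)" for i
      using lowp_even(1)[OF True, of p] step by (simp add: Lin_diff Lin_smult Lin_shift_pCons)
    have U: "Lin (shift i ?c) (upp p (Suc n)) = (1 - p n) * Lin (shift i ?c) (lowp p n) - Lin (shift i ?c) (lowp p (Suc n))" for i
      using lowp_even(2)[OF True, of p] step by (simp add: Lin_diff Lin_smult)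
    have IH: "\<And>i. i < k \<Longrightarrow> Lin (shift i ?c) (lowp p n) = 0" "\<And>i. i < k - 1 \<Longrightarrow> Lin (shift i ?c) (upp p n) = 0"
      "Lin (shift (k - 1) ?c) (upp p n) = canw p n * (1 - p n)"
    proof -
      have "(2 * k - 1) div 2 = k - 1" using k by presburger
      then show "\<And>i. i < k \<Longrightarrow> Lin (shift i ?c) (lowp p n) = 0" "\<And>i. i < k - 1 \<Longrightarrow> Lin (shift i ?c) (upp p n) = 0"
      "Lin (shift (k - 1) ?c) (upp p n) = canw p n * (1 - p n)" using step.IH by (auto simp: n)
    qed
    have dk: "Lin (shift k ?c) (lowp p n) = canw p n * p n" using diag(1) n by simp
    have dk': "Lin (shift k ?c) (lowp p (Suc n)) = canw p (Suc n) * p (Suc n)" using diag(2) n by simp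
    have low: "Lin (shift i ?c) (lowp p (Suc n)) = 0" if "i < k" for i
    proof (cases "i = k - 1")
      case True
      then have "Suc i = k" using k by simp
      then show ?thesis unfolding L using IH(3) dk True by simp
    next
      case False
      then have "Suc i < k" "i < k - 1" using that by auto
      then show ?thesis unfolding L using IH(1)[of "Suc i"] IH(2)[of i] by simp
    qed
    have "Lin (shift i ?c) (upp p (Suc n)) = 0" if "i < k" for i
      unfolding U using low[OF that] IH(1)[OF that] by simp
    moreover have "Lin (shift k ?c) (upp p (Suc n)) = canw p (Suc n) * (1 - p (Suc n))"
      unfolding U dk dk' w by (simp add: algebra_simps)
    ultimately show ?thesis using low by (simp add: n)
  next
    case False
    then obtain k where n: "n = 2 * k + 1" by (elim oddE)
    have L: "Lin (shift i ?c) (lowp p (Suc n)) = (1 - p n) * Lin (shift i ?c) (lowp p n) - p n * Lin (shift i ?c) (upp p n)" for i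
      using lowp_odd(1)[OF False, of p] by (simp add: Lin_diff Lin_smult)
    have U: "Lin (shift i ?c) (upp p (Suc n)) = (1 - p n) * Lin (shift i ?c) (lowp p n) - Lin (shift (Suc i) ?c) (lowp p (Suc n))" for i
      using lowp_odd(2)[OF False, of p] by (simp add: Lin_diff Lin_smult Lin_shift_pCons)
    have IH: "\<And>i. i < k \<Longrightarrow> Lin (shift i ?c) (lowp p n) = 0" "\<And>i. i < k \<Longrightarrow> Lin (shift i ?c) (upp p n) = 0"
      "Lin (shift k ?c) (upp p n) = canw p n * (1 - p n)"
      using step.IH by (auto simp: n)
    have dk: "Lin (shift k ?c) (lowp p n) = canw p n * p n" using diag(1) n by simp
    have dk': "Lin (shift (Suc k) ?c) (lowp p (Suc n)) = canw p (Suc n) * p (Suc n)" using diag(2) n by simp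
    have low: "Lin (shift i ?c) (lowp p (Suc n)) = 0" if "i < Suc k" for i
    proof (cases "i = k")
      case True
      then show ?thesis unfolding L using IH(3) dk True by simp
    next
      case False
      then show ?thesis unfolding L using IH that by simp
    qed
    have "Lin (shift i ?c) (upp p (Suc n)) = 0" if "i < k" for i
      unfolding U using low[of "Suc i"] IH(1)[OF that] that by simp
    moreover have "Lin (shift k ?c) (upp p (Suc n)) = canw p (Suc n) * (1 - p (Suc n))"
      unfolding U dk dk' w by (simp add: algebra_simps)
    ultimately show ?thesis using low by (simp add: n)
  qed
qed


section \<open>Positivity of the moment functional\<close>

lemma one_minus_X_mult: "[:1, - 1:] * q = q - pCons 0 (q :: real poly)"
  by (rule poly_eqI) (simp add: coeff_pCons split: nat.split)

lemma linear_mult: "[:- z, 1:] * q = pCons 0 q - smult z (q :: real poly)"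
  by (rule poly_eqI) (simp add: coeff_pCons split: nat.split)

lemma canpair_pos:
  assumes p: "\<And>i. 1 \<le> i \<Longrightarrow> 0 < p i \<and> p i < 1"
  shows "canw p n > 0"
  unfolding canw_def by (rule prod_pos) (use p in auto)

text \<open>Three monic orthogonal families feed \<open>Lin_pos_def\<close>:
  \<open>lowp p (2 * d)\<close> for the functional itself, and the cofactors of x in
  \<open>lowp p (2 * d + 1)\<close> and of 1 - x in \<open>upp p (2 * d + 1)\<close> for the
  functionals weighted by x and 1 - x. Apart from \<open>canm p 0 = 1\<close>, the norms are
  \<open>canw p n * p n\<close> or \<open>canw p n * (1 - p n)\<close>.\<close>

lemma canm_pos_def:
  assumes p: "\<And>i. 1 \<le> i \<Longrightarrow> 0 < p i \<and> p i < 1" and f: "f \<noteq> 0"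
  shows "Lin (canm p) (f * f) > 0" "Lin (canm p) ([:0, 1:] * (f * f)) > 0" "Lin (canm p) ([:1, - 1:] * (f * f)) > 0"
proof -
  let ?c = "canm p"
  have w: "canw p n * p n > 0" "canw p n * (1 - p n) > 0" if "n \<ge> 1" for n
    using canpair_pos[OF p, where n=n] p[OF that] by simp_all
  define R where "R d = lowp p (2 * d)" for d
  have R: "degree (R d) = d \<and> lead_coeff (R d) = 1" for d
  proof (cases "d = 0")
    case False
    then obtain Q where "lowp p (2 * d) = low_factor (2 * d) * Q" "degree Q = 2 * d div 2" "lead_coeff Q = 1"
      using canpair_factor_obtain[of "2 * d" p] by (metis One_nat_def Suc_leI nat_0_less_mult_iff neq0_conv zero_less_numeral)
    then show ?thesis by (simp add: R_def low_factor_def)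
  qed (simp add: R_def)
  show "Lin ?c (f * f) > 0"
  proof (rule Lin_pos_def[where R=R and D="degree f"])
    show "Lin (shift i ?c) (R d) = 0" if "i < d" for i d
      using canpair_orthogonal[of "2 * d" p] that by (simp add: R_def)
    show "Lin (shift d ?c) (R d) > 0" for d
    proof (cases "d = 0")
      case False
      then show ?thesis using Lin_lowp_diag[of "2 * d" p] w[of "2 * d"] by (simp add: R_def)
    qed (simp add: R_def)
  qed (rule R f order_refl)+
  have "\<exists>Q S. degree Q = d \<and> lead_coeff Q = 1 \<and> degree S = d \<and> lead_coeff S = 1 \<and>
      lowp p (2 * d + 1) = [:0, 1:] * Q \<and> upp p (2 * d + 1) = [:1, - 1:] * S" for d
  proof -
    obtain Q S where "lowp p (2 * d + 1) = low_factor (2 * d + 1) * Q" "degree Q = (2 * d + 1) div 2" "lead_coeff Q = 1"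
      "upp p (2 * d + 1) = up_factor (2 * d + 1) * S" "degree S = (2 * d + 1 - 1) div 2" "lead_coeff S = 1"
      by (rule canpair_factor_obtain[of "2 * d + 1" p]) auto
    moreover have "low_factor (2 * d + 1) = [:0, 1:]" "up_factor (2 * d + 1) = [:1, - 1:]"
      "(2 * d + 1) div 2 = d" "(2 * d + 1 - 1) div 2 = d"
      by (simp_all add: low_factor_def up_factor_def)
    ultimately show ?thesis by metis
  qed
  then obtain Q S where QS: "\<And>d. degree (Q d) = d \<and> lead_coeff (Q d) = 1" "\<And>d. degree (S d) = d \<and> lead_coeff (S d) = 1"
      "\<And>d. lowp p (2 * d + 1) = [:0, 1:] * Q d" "\<And>d. upp p (2 * d + 1) = [:1, - 1:] * S d"
    by metis
  have o: "Lin (shift d ?c) (lowp p (2 * d + 1)) > 0" "Lin (shift d ?c) (upp p (2 * d + 1)) > 0"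
     "\<And>i. i < d \<Longrightarrow> Lin (shift i ?c) (lowp p (2 * d + 1)) = 0"
     "\<And>i. i < d \<Longrightarrow> Lin (shift i ?c) (upp p (2 * d + 1)) = 0" for d
    using canpair_orthogonal[of "2 * d + 1" p] Lin_lowp_diag[of "2 * d + 1" p] w[of "2 * d + 1"] by auto
  define c1 where "c1 i = ?c (Suc i)" for i
  define c2 where "c2 i = ?c i - ?c (Suc i)" for i
  have c1: "Lin (shift i c1) q = Lin (shift i ?c) ([:0, 1:] * q)" for i q
    by (simp add: Lin_pCons c1_def One_nat_def)
  have c2: "Lin (shift i c2) q = Lin (shift i ?c) ([:1, - 1:] * q)" for i q
  proof -
    have "Lin (shift i c2) q = Lin (shift i ?c) q - Lin (shift (Suc i) ?c) q"
      by (simp add: Lin_def c2_def sum_subtractf[symmetric] algebra_simps)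
    also have "\<dots> = Lin (shift i ?c) (q - pCons 0 q)"
      by (simp add: Lin_diff Lin_pCons One_nat_def)
    finally show ?thesis by (simp only: one_minus_X_mult)
  qed
  have "Lin c1 (f * f) > 0"
  proof (rule Lin_pos_def[where R=Q and D="degree f"])
    show "degree (Q d) = d \<and> lead_coeff (Q d) = 1" for d by (rule QS(1))
    show "Lin (shift i c1) (Q d) = 0" if "i < d" for i d
      using o(3)[OF that] by (simp only: c1 QS(3))
    show "Lin (shift d c1) (Q d) > 0" for d
      using o(1)[of d] by (simp only: c1 QS(3))
  qed (rule f order_refl)+
  then show "Lin ?c ([:0, 1:] * (f * f)) > 0" using c1[of 0 "f * f"] by simp
  have "Lin c2 (f * f) > 0"
  proof (rule Lin_pos_def[where R=S and D="degree f"])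
    show "degree (S d) = d \<and> lead_coeff (S d) = 1" for d by (rule QS(2))
    show "Lin (shift i c2) (S d) = 0" if "i < d" for i d
      using o(4)[OF that] by (simp only: c2 QS(4))
    show "Lin (shift d c2) (S d) > 0" for d
      using o(2)[of d] by (simp only: c2 QS(4))
  qed (rule f order_refl)+
  then show "Lin ?c ([:1, - 1:] * (f * f)) > 0" using c2[of 0 "f * f"] by simp
qed

section \<open>Gauss quadrature\<close>

lemma map_poly_of_real_add: "map_poly complex_of_real (p + q) = map_poly complex_of_real p + map_poly complex_of_real q"
  by (rule poly_eqI) (simp add: coeff_map_poly)

lemma map_poly_of_real_mult: "map_poly complex_of_real (p * q) = map_poly complex_of_real p * map_poly complex_of_real q"
proof (induction p)
  case (pCons a p)
  have "map_poly complex_of_real (smult a q) = smult (complex_of_real a) (map_poly complex_of_real q)" for a q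
    by (rule map_poly_smult) auto
  then show ?case by (simp add: map_poly_of_real_add map_poly_pCons pCons.IH)
qed simp

lemma poly_map_of_real: "poly (map_poly complex_of_real p) (complex_of_real x) = complex_of_real (poly p x)"
  by (induction p) (simp_all add: map_poly_pCons)

lemma prod_linear_dvd:
  fixes P :: "real poly"
  assumes "finite A" "\<And>a. a \<in> A \<Longrightarrow> poly P a = 0"
  shows "(\<Prod>a\<in>A. [:- a, 1:]) dvd P"
  using assms
proof (induction A arbitrary: P rule: finite_induct)
  case (insert a A)
  have "[:- a, 1:] dvd P" using insert.prems by (simp add: poly_eq_0_iff_dvd)
  then obtain Q where Q: "P = [:- a, 1:] * Q" by (rule dvdE)
  have "poly Q x = 0" if "x \<in> A" for x
  proof -
    have "poly [:- a, 1:] x \<noteq> 0" using that insert.hyps by auto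
    moreover have "poly [:- a, 1:] x * poly Q x = 0"
      using insert.prems[of x] that unfolding Q by (simp only: poly_mult) simp
    ultimately show ?thesis by simp
  qed
  then have "(\<Prod>a\<in>A. [:- a, 1:]) dvd Q" by (rule insert.IH)
  then show ?case unfolding Q prod.insert[OF insert.hyps] by (rule mult_dvd_mono[OF dvd_refl])
qed simp

text \<open>A nonreal root of P is also a root of the remainder modulo its real quadratic; the
  remainder has real coefficients and degree below 2, so it is 0.\<close>

lemma real_poly_divisor:
  fixes P :: "real poly"
  assumes "degree P > 0"
  obtains u where "poly P u = 0" | u v where "v \<noteq> 0" "[:u\<^sup>2 + v\<^sup>2, - 2 * u, 1:] dvd P"
proof -
  let ?C = "map_poly complex_of_real"
  have "degree (?C P) > 0" using assms by (simp add: degree_map_poly)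
  then have "\<not> constant (poly (?C P))" by (simp add: constant_degree)
  then obtain z where z: "poly (?C P) z = 0" using fundamental_theorem_of_algebra by blast
  show ?thesis
  proof (cases "Im z = 0")
    case True
    then have "z = complex_of_real (Re z)" by (simp add: complex_eq_iff)
    then have "complex_of_real (poly P (Re z)) = 0" using z poly_map_of_real by metis
    then show ?thesis using that(1) by simp
  next
    case False
    define q where "q = [:(Re z)\<^sup>2 + (Im z)\<^sup>2, - 2 * Re z, 1:]"
    define r where "r = P mod q"
    have q: "poly (?C q) z = 0"
      by (simp add: q_def map_poly_pCons complex_eq_iff power2_eq_square algebra_simps)
    have "degree r < 2" using degree_mod_less[of q P] by (auto simp: r_def q_def)
    then have rr: "r = [:coeff r 0, coeff r 1:]"
      by (intro poly_eqI) (auto simp: coeff_pCons coeff_eq_0 One_nat_def split: nat.split)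
    have "P = q * (P div q) + r" by (simp add: r_def)
    then have "poly (?C P) z = poly (?C (q * (P div q) + r)) z" by simp
    then have "poly (?C r) z = 0"
      using z q by (simp only: map_poly_of_real_add map_poly_of_real_mult poly_add poly_mult) simp
    then have "complex_of_real (coeff r 0) + z * complex_of_real (coeff r 1) = 0"
      by (subst (asm) rr) (simp add: map_poly_pCons)
    then have "coeff r 1 = 0" "coeff r 0 = 0"
      using False by (auto simp: complex_eq_iff)
    then have "r = 0" using rr by simp
    then have "q dvd P" by (simp add: r_def mod_eq_0_iff_dvd)
    then show ?thesis using that(2)[OF False] unfolding q_def by blast
  qed
qed

text \<open>No measure with the moments \<open>canm p\<close> is known yet; this constructs a
  discrete one. The classical argument therefore runs on the positive functional alone, with the
  roots of the orthogonal polynomial of degree \<open>m\<close> as nodes.\<close>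

lemma gauss_quadrature:
  assumes p: "\<And>i. 1 \<le> i \<Longrightarrow> 0 < p i \<and> p i < 1" and m: "m \<ge> 1"
  shows "\<exists>Z w. finite Z \<and> Z \<subseteq> {0..1} \<and> (\<forall>z\<in>Z. w z \<ge> 0) \<and>
    (\<forall>f. degree f < 2 * m \<longrightarrow> Lin (canm p) f = (\<Sum>z\<in>Z. w z * poly f z))"
proof -
  let ?c = "canm p"
  have pd: "Lin ?c (f * f) > 0" "Lin ?c ([:0, 1:] * (f * f)) > 0" "Lin ?c ([:1, - 1:] * (f * f)) > 0"
    if "f \<noteq> 0" for f
    by (rule canm_pos_def; use p that in blast)+
  define P where "P = lowp p (2 * m)"
  have PR: "degree P = m" "lead_coeff P = 1"
  proof -
    obtain R where "lowp p (2 * m) = low_factor (2 * m) * R" "degree R = 2 * m div 2" "lead_coeff R = 1"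
      by (rule canpair_factor_obtain[of "2 * m" p]) (use m in auto)
    then show "degree P = m" "lead_coeff P = 1" by (simp_all add: P_def low_factor_def)
  qed
  then have P0: "P \<noteq> 0" using m by auto
  have orth: "Lin ?c (P * g) = 0" if "degree g < m" for g
    using Lin_mult_orthogonal[of m ?c P g] canpair_orthogonal[of "2 * m" p] m that
    by (simp add: P_def coeff_eq_0)
  \<comment> \<open>If \<open>P = ((x - u)\<^sup>2 + v\<^sup>2) g\<close>, then \<open>L (P g) = L (((x - u) g)\<^sup>2) + v\<^sup>2 L (g\<^sup>2) > 0\<close>, against orthogonality.
    Hence \<open>P\<close> has neither a complex pair of roots nor (case \<open>v = 0\<close>) a double root.\<close>
  have no_square: False if "[:u\<^sup>2 + v\<^sup>2, - 2 * u, 1:] dvd P" for u v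
  proof -
    from that obtain g where g: "P = [:u\<^sup>2 + v\<^sup>2, - 2 * u, 1:] * g" by (rule dvdE)
    then have g0: "g \<noteq> 0" using P0 by auto
    have deg: "degree g < m"
      using PR(1) g0 unfolding g by (subst (asm) degree_mult_eq) auto
    have "[:u\<^sup>2 + v\<^sup>2, - 2 * u, 1:] = [:- u, 1:] * [:- u, 1:] + [:v\<^sup>2:]"
      by (simp add: power2_eq_square)
    then have "P * g = ([:- u, 1:] * [:- u, 1:] + [:v\<^sup>2:]) * g * g"
      by (simp only: g)
    also have "\<dots> = ([:- u, 1:] * g) * ([:- u, 1:] * g) + [:v\<^sup>2:] * (g * g)"
    proof -
      have "(a * a + b) * g * g = (a * g) * (a * g) + b * (g * g)" for a b :: "real poly"
        by (simp add: algebra_simps)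
      then show ?thesis .
    qed
    also have "[:v\<^sup>2:] * (g * g) = smult (v\<^sup>2) (g * g)" by simp
    finally have "Lin ?c (P * g) = Lin ?c (([:- u, 1:] * g) * ([:- u, 1:] * g)) + v\<^sup>2 * Lin ?c (g * g)"
      by (simp only: Lin_add Lin_smult)
    moreover have "[:- u, 1:] * g \<noteq> 0" by (rule no_zero_divisors[OF _ g0]) simp
    then have "Lin ?c (([:- u, 1:] * g) * ([:- u, 1:] * g)) > 0"
      by (rule pd(1))
    moreover have "v\<^sup>2 * Lin ?c (g * g) \<ge> 0"
      using pd(1)[OF g0] by simp
    ultimately show False
      using orth[OF deg] by linarith
  qed
  define Z where "Z = {z. poly P z = 0}"
  have finZ: "finite Z" unfolding Z_def by (rule poly_roots_finite[OF P0])
  have Z01: "Z \<subseteq> {0..1}"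
  proof
    fix z assume "z \<in> Z"
    then have "[:- z, 1:] dvd P" by (simp add: Z_def poly_eq_0_iff_dvd)
    then obtain g where g: "P = [:- z, 1:] * g" by (rule dvdE)
    then have g0: "g \<noteq> 0" using P0 by auto
    have deg: "degree g < m"
      using PR(1) g0 unfolding g by (subst (asm) degree_mult_eq) auto
    have "Lin ?c (P * g) = Lin ?c ([:0, 1:] * (g * g)) - z * Lin ?c (g * g)"
    proof -
      have "P * g = pCons 0 (g * g) - smult z (g * g)"
        unfolding linear_mult[symmetric] by (simp only: g mult.assoc)
      then have "Lin ?c (P * g) = Lin ?c (pCons 0 (g * g)) - z * Lin ?c (g * g)"
        by (simp only: Lin_diff Lin_smult)
      then show ?thesis by simp
    qed
    \<comment> \<open>Since P g = (x - z) g^2 has value 0, z is the quotient of the values at x g^2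
      and g^2, and 1 - z likewise with 1 - x. Both are positive.\<close>
    then have A: "z * Lin ?c (g * g) = Lin ?c ([:0, 1:] * (g * g))" using orth[OF deg] by simp
    have "Lin ?c ([:1, - 1:] * (g * g)) = Lin ?c (g * g) - Lin ?c ([:0, 1:] * (g * g))"
    proof -
      have "[:0, 1:] * (g * g) = pCons 0 (g * g)" by simp
      then show ?thesis by (simp only: one_minus_X_mult Lin_diff)
    qed
    then have "(1 - z) * Lin ?c (g * g) = Lin ?c ([:1, - 1:] * (g * g))"
      using A by (simp add: algebra_simps)
    then have "z * Lin ?c (g * g) > 0" "(1 - z) * Lin ?c (g * g) > 0"
      using A pd(2,3)[OF g0] by simp_all
    then show "z \<in> {0..1}"
      using pd(1)[OF g0] by (simp add: zero_less_mult_iff)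
  qed
  define W where "W = (\<Prod>z\<in>Z. [:- z, 1:])"
  have "W dvd P"
    unfolding W_def by (rule prod_linear_dvd[OF finZ]) (simp add: Z_def)
  then obtain V where V: "P = W * V" by (rule dvdE)
  have "degree V = 0"
  proof (rule ccontr)
    assume "degree V \<noteq> 0"
    then have "degree V > 0" by simp
    then show False
    proof (cases rule: real_poly_divisor)
      \<comment> \<open>A real root of the cofactor is already a root of P, hence of W, and becomes
        a double root of P.\<close>
      case (1 u)
      then have "u \<in> Z" by (simp add: Z_def V)
      then have "[:- u, 1:] dvd W" unfolding W_def using finZ by (rule dvd_prodI[rotated, where f="\<lambda>z. [:- z, 1:]"])
      moreover have "[:- u, 1:] dvd V" using 1 by (simp add: poly_eq_0_iff_dvd)
      ultimately have "[:- u, 1:] * [:- u, 1:] dvd P"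
        unfolding V by (rule mult_dvd_mono)
      moreover have "[:- u, 1:] * [:- u, 1:] = [:u\<^sup>2 + 0\<^sup>2, - 2 * u, 1:]"
        by (simp add: power2_eq_square)
      ultimately show False using no_square by metis
    next
      case (2 u v)
      then show False using no_square[of u v] V by (simp add: dvd_mult)
    qed
  qed
  then have cZ: "card Z = m"
    using PR(1) P0 unfolding V by (subst (asm) degree_mult_eq) (auto simp: W_def degree_prod_linear[OF finZ])
  define \<l> where "\<l> z = smult (1 / (\<Prod>y\<in>Z-{z}. z - y)) (\<Prod>y\<in>Z-{z}. [:- y, 1:])" for z
  have l: "poly (\<l> z) y = (if y = z then 1 else 0)" if "z \<in> Z" "y \<in> Z" for y z
    using that finZ by (auto simp: \<l>_def poly_prod)
  have dl: "degree (\<l> z) < m" if "z \<in> Z" for z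
  proof -
    have "card (Z - {z}) < m" using that finZ cZ m by (simp add: card_Diff_singleton)
    then show ?thesis
      using degree_prod_linear[of "Z - {z}" "\<lambda>y. y"] finZ degree_smult_le[of "1 / (\<Prod>y\<in>Z-{z}. z - y)" "\<Prod>y\<in>Z-{z}. [:- y, 1:]"]
      unfolding \<l>_def by simp
  qed
  define w where "w z = Lin ?c (\<l> z)" for z
  have quad: "Lin ?c f = (\<Sum>z\<in>Z. w z * poly f z)" if "degree f < 2 * m" for f
  proof -
    define r where "r = f mod P"
    have dr: "degree r < m" using degree_mod_less[OF P0, of f] PR m by (auto simp: r_def)
    have f: "f = P * (f div P) + r" by (simp add: r_def)
    have "degree (f div P) < m"
    proof (cases "f div P = 0")
      case False
      have "m + degree (f div P) = degree (P * (f div P))" using P0 False PR by (simp add: degree_mult_eq)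
      also have "P * (f div P) = f - r" by (simp add: r_def minus_mod_eq_mult_div)
      also have "degree (f - r) < 2 * m" using that dr by (intro degree_diff_less) auto
      finally show ?thesis by simp
    qed (use m in auto)
    have rz: "poly r z = poly f z" if "z \<in> Z" for z
      using that arg_cong[OF f, of "\<lambda>f. poly f z"] by (simp add: Z_def)
    let ?D = "r - (\<Sum>z\<in>Z. smult (poly f z) (\<l> z))"
    \<comment> \<open>Lagrange interpolation at the nodes, as the case without double nodes.\<close>
    have "?D = 0"
    proof (rule hermite_unique[of Z "{}"])
      have "degree (\<Sum>z\<in>Z. smult (poly f z) (\<l> z)) \<le> m - 1"
        by (intro degree_sum_le finZ order_trans[OF degree_smult_le]) (use dl in force)
      then have "degree ?D \<le> m - 1" using dr by (intro degree_diff_le) auto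
      then show "degree ?D < card Z + 2 * card {}" using cZ m by simp
      fix z assume z: "z \<in> Z"
      have "(\<Sum>y\<in>Z. poly f y * poly (\<l> y) z) = (\<Sum>y\<in>Z. if y = z then poly f y else 0)"
        by (intro sum.cong refl) (use l z in auto)
      then show "poly ?D z = 0" using z finZ rz by (simp add: poly_sum)
    qed (use finZ in auto)
    then have "Lin ?c r = (\<Sum>z\<in>Z. w z * poly f z)"
      by (simp add: Lin_sum Lin_smult w_def mult.commute)
    moreover have "Lin ?c f = Lin ?c (P * (f div P)) + Lin ?c r"
      using f Lin_add by metis
    ultimately show ?thesis using orth[OF \<open>degree (f div P) < m\<close>] by simp
  qed
  have "w z \<ge> 0" if z: "z \<in> Z" for z
  proof -
    \<comment> \<open>The squared Lagrange polynomial is within the range of exactness, so the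
      weight at z is the value of the functional at a square.\<close>
    have "degree (\<l> z * \<l> z) < 2 * m"
      using degree_mult_le[of "\<l> z" "\<l> z"] dl[OF z] by simp
    then have "Lin ?c (\<l> z * \<l> z) = (\<Sum>y\<in>Z. w y * (poly (\<l> z) y * poly (\<l> z) y))"
      using quad by simp
    also have "\<dots> = (\<Sum>y\<in>Z. if y = z then w z else 0)"
      by (intro sum.cong refl) (use l z in auto)
    also have "\<dots> = w z" using finZ z by simp
    finally show ?thesis
      using pd(1)[of "\<l> z"] l[OF z z] by (cases "\<l> z = 0") auto
  qed
  then show ?thesis using quad finZ Z01 by blast
qed

section \<open>The volume of the moment space\<close>

abbreviation unit_sets :: "real measure" where "unit_sets \<equiv> restrict_space borel {0..1}"

lemma moment_spaceI:
  assumes "prob_space \<mu>" "sets \<mu> = sets unit_sets" "\<And>i. i \<in> {1..n} \<Longrightarrow> (\<integral>t. t ^ i \<partial>\<mu>) = x i" "x \<in> extensional {1..n}"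
  shows "x \<in> moment_space n"
proof -
  have "x = (\<lambda>i\<in>{1..n}. \<integral>t. t ^ i \<partial>\<mu>)"
    using assms(3,4) by (auto simp: fun_eq_iff extensional_def)
  then show ?thesis using assms(1,2) unfolding moment_space_def by blast
qed

lemma moment_space_extensional: "moment_space n \<subseteq> extensional {1..n}"
  by (auto simp: moment_space_def)

lemma moment_spaceD:
  assumes "x \<in> moment_space n"
  shows "\<exists>\<mu>. prob_space \<mu> \<and> sets \<mu> = sets unit_sets \<and> (\<forall>i\<in>{1..n}. (\<integral>t. t ^ i \<partial>\<mu>) = x i)"
  using assms unfolding moment_space_def by fastforce

lemma integrable_poly:
  assumes \<mu>: "prob_space \<mu>" "sets \<mu> = sets unit_sets"
  shows "integrable \<mu> (\<lambda>t. poly f t :: real)"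
proof -
  interpret prob_space \<mu> by fact
  have "bounded (poly f ` {0..1})"
    by (intro compact_imp_bounded compact_continuous_image) (auto intro: continuous_intros)
  then obtain B where B: "\<forall>t\<in>{0..1}. norm (poly f t) \<le> B"
    by (auto simp: bounded_iff)
  have sp: "space \<mu> = {0..1}" using sets_eq_imp_space_eq[OF \<mu>(2)] by (simp add: space_restrict_space)
  have "poly f \<in> borel_measurable unit_sets"
    by (intro measurable_restrict_space1 borel_measurable_continuous_onI) (auto intro: continuous_intros)
  then have "poly f \<in> borel_measurable \<mu>"
    using measurable_cong_sets[OF \<mu>(2) refl] by blast
  then show ?thesis
    by (intro integrable_const_bound[of _ B]) (use B sp in auto)
qed

lemma integral_poly:
  assumes \<mu>: "prob_space \<mu>" "sets \<mu> = sets unit_sets"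
  shows "(\<integral>t. poly f t \<partial>\<mu>) = Lin (\<lambda>i. \<integral>t. t ^ i \<partial>\<mu>) f"
proof -
  have int: "integrable \<mu> (\<lambda>t. t ^ i)" for i
    using integrable_poly[OF \<mu>, of "monom 1 i"] by (simp add: poly_monom)
  have "(\<integral>t. poly f t \<partial>\<mu>) = (\<integral>t. (\<Sum>i\<le>degree f. coeff f i * t ^ i) \<partial>\<mu>)"
    by (simp add: poly_altdef)
  also have "\<dots> = (\<Sum>i\<le>degree f. coeff f i * (\<integral>t. t ^ i \<partial>\<mu>))"
    by (subst Bochner_Integration.integral_sum) (use int in auto)
  finally show ?thesis by (simp add: Lin_def)
qed

text \<open>Pushing the point measure forward replaces its own sigma-algebra by the Borel sets of
  the unit interval, as \<open>moment_space\<close> requires.\<close>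

lemma discrete_measure:
  assumes Z: "finite Z" "Z \<subseteq> {0..1}" and w: "\<And>z. z \<in> Z \<Longrightarrow> w z \<ge> 0" "(\<Sum>z\<in>Z. w z) = 1"
  obtains \<mu> where "prob_space \<mu>" "sets \<mu> = sets unit_sets" "\<And>i. (\<integral>t. t ^ i \<partial>\<mu>) = (\<Sum>z\<in>Z. w z * z ^ i)"
proof
  let ?P = "point_measure Z w"
  let ?\<mu> = "distr ?P unit_sets (\<lambda>t. t)"
  have m: "(\<lambda>t. t) \<in> ?P \<rightarrow>\<^sub>M unit_sets"
    using Z by (auto simp: measurable_def space_point_measure sets_point_measure space_restrict_space)
  have "emeasure ?P Z = (\<Sum>z\<in>Z. ennreal (w z))"
    using Z by (simp add: emeasure_point_measure_finite)
  also have "\<dots> = 1" using w by (simp add: sum_ennreal)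
  finally have "prob_space ?P" by (intro prob_spaceI) (simp add: space_point_measure)
  then show "prob_space ?\<mu>" using m by (rule prob_space.prob_space_distr)
  show "sets ?\<mu> = sets unit_sets" by simp
  fix i
  have "(\<lambda>t::real. t ^ i) \<in> borel_measurable unit_sets"
    by (intro measurable_restrict_space1) auto
  then have "(\<integral>t. t ^ i \<partial>?\<mu>) = (\<integral>t. t ^ i \<partial>?P)"
    by (rule integral_distr[OF m])
  also have "\<dots> = (\<Sum>z\<in>Z. w z * z ^ i)"
    using Z w by (subst lebesgue_integral_point_measure_finite) auto
  finally show "(\<integral>t. t ^ i \<partial>?\<mu>) = (\<Sum>z\<in>Z. w z * z ^ i)" .
qed

section \<open>Canonical moments and membership in the moment space\<close>

definition Psi :: "nat \<Rightarrow> (nat \<Rightarrow> real) \<Rightarrow> nat \<Rightarrow> real" where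
  "Psi n p = (\<lambda>i\<in>{1..n}. canm p i)"

lemma Lin_monom: "Lin c (monom 1 i) = c i"
proof -
  have "Lin c (monom 1 i) = (\<Sum>j\<le>i. if j = i then c i else 0)"
    unfolding Lin_eq[OF degree_monom_le] by (intro sum.cong refl) (auto simp: coeff_monom)
  then show ?thesis by simp
qed

text \<open>Gauss quadrature with \<open>Suc n\<close> nodes is exact through degree 2 n + 1, which
  covers the first \<open>n\<close> moments; its nodes and weights form the measure.\<close>

lemma Psi_in_moment_space:
  assumes p: "\<And>i. 1 \<le> i \<Longrightarrow> 0 < p i \<and> p i < 1"
  shows "Psi n p \<in> moment_space n"
proof -
  obtain Z w where Z: "finite Z" "Z \<subseteq> {0..1}" and w: "\<And>z. z \<in> Z \<Longrightarrow> w z \<ge> 0"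
    and quad: "\<And>f. degree f < 2 * Suc n \<Longrightarrow> Lin (canm p) f = (\<Sum>z\<in>Z. w z * poly f z)"
  proof -
    have "\<exists>Z w. finite Z \<and> Z \<subseteq> {0..1} \<and> (\<forall>z\<in>Z. w z \<ge> 0) \<and>
      (\<forall>f. degree f < 2 * Suc n \<longrightarrow> Lin (canm p) f = (\<Sum>z\<in>Z. w z * poly f z))"
      by (rule gauss_quadrature) (use p in auto)
    then show ?thesis using that by blast
  qed
  have one: "(\<Sum>z\<in>Z. w z) = 1" using quad[of 1] by simp
  have mom: "(\<Sum>z\<in>Z. w z * z ^ i) = canm p i" if "i \<le> n" for i
    using quad[of "monom 1 i"] that degree_monom_le[of "1::real" i] by (simp add: Lin_monom poly_monom)
  obtain \<mu> where "prob_space \<mu>" "sets \<mu> = sets unit_sets" "\<And>i. (\<integral>t. t ^ i \<partial>\<mu>) = (\<Sum>z\<in>Z. w z * z ^ i)"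
    using discrete_measure[OF Z w one] by blast
  then show ?thesis
    by (intro moment_spaceI[of \<mu>]) (auto simp: Psi_def mom)
qed

text \<open>Induction gives \<open>canw p k > 0\<close>. A representing measure integrates
  \<open>low_factor k\<close> times R^2 and \<open>up_factor k\<close> times S^2 to
  \<open>canw p k * p k\<close> and \<open>canw p k * (1 - p k)\<close>, so both are nonnegative.
  Both test polynomials have degree at most \<open>k\<close>, so only prescribed moments
  enter.\<close>

lemma canm_in_range:
  assumes M: "Psi n p \<in> moment_space n" and ne: "\<And>i. i \<in> {1..n} \<Longrightarrow> p i \<noteq> 0 \<and> p i \<noteq> 1" and k: "k \<in> {1..n}"
  shows "0 < p k \<and> p k < 1"
  using k
proof (induction k rule: less_induct)
  case (less k)
  then have k: "1 \<le> k" "k \<le> n" by auto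
  obtain \<mu> where \<mu>: "prob_space \<mu>" "sets \<mu> = sets unit_sets"
    and mom: "\<And>i. i \<in> {1..n} \<Longrightarrow> (\<integral>t. t ^ i \<partial>\<mu>) = Psi n p i"
    using moment_spaceD[OF M] by blast
  interpret prob_space \<mu> by fact
  have sp: "space \<mu> = {0..1}" using sets_eq_imp_space_eq[OF \<mu>(2)] by (simp add: space_restrict_space)
  have Lin: "Lin (canm p) f = (\<integral>t. poly f t \<partial>\<mu>)" if "degree f \<le> n" for f
    unfolding integral_poly[OF \<mu>]
  proof (rule Lin_cong)
    fix i assume "i \<le> degree f"
    show "canm p i = (\<integral>t. t ^ i \<partial>\<mu>)"
    proof (cases "i = 0")
      case True
      then show ?thesis using prob_space by simp
    next
      case False
      then show ?thesis using mom[of i] \<open>i \<le> degree f\<close> that by (simp add: Psi_def)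
    qed
  qed
  have w: "canw p k > 0"
    unfolding canw_def by (rule prod_pos) (use less k in auto)
  obtain R S where RS: "lowp p k = low_factor k * R" "degree R = k div 2" "lead_coeff R = 1"
    "upp p k = up_factor k * S" "degree S = (k - 1) div 2" "lead_coeff S = 1"
    using canpair_factor_obtain[OF k(1), of p] by metis
  note orth = canpair_orthogonal[OF k(1), of p] and deg = canpair_degree[OF k(1), of p]
  have "canw p k * p k = Lin (canm p) (lowp p k * R)"
    using Lin_mult_orthogonal[of "k div 2" "canm p" "lowp p k" R] orth RS Lin_lowp_diag[OF k(1), of p] by simp
  also have "\<dots> = (\<integral>t. poly (lowp p k * R) t \<partial>\<mu>)"
  proof (rule Lin)
    have "degree (lowp p k * R) \<le> (k + 1) div 2 + k div 2"
      using degree_mult_le[of "lowp p k" R] deg RS(2) by linarith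
    also have "\<dots> \<le> n" using k by presburger
    finally show "degree (lowp p k * R) \<le> n" .
  qed
  also have "\<dots> \<ge> 0"
  proof (rule Bochner_Integration.integral_nonneg)
    fix t assume "t \<in> space \<mu>"
    then have "poly (low_factor k) t \<ge> 0" by (simp add: sp low_factor_def)
    then show "0 \<le> poly (lowp p k * R) t" unfolding RS by (simp add: mult.assoc)
  qed
  finally have "p k \<ge> 0" using w by (simp add: zero_le_mult_iff)
  have "canw p k * (1 - p k) = Lin (canm p) (upp p k * S)"
    using Lin_mult_orthogonal[of "(k - 1) div 2" "canm p" "upp p k" S] orth RS by simp
  also have "\<dots> = (\<integral>t. poly (upp p k * S) t \<partial>\<mu>)"
  proof (rule Lin)
    have "degree (upp p k * S) \<le> (k + 2) div 2 + (k - 1) div 2"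
      using degree_mult_le[of "upp p k" S] deg RS(5) by linarith
    also have "\<dots> \<le> n" using k by presburger
    finally show "degree (upp p k * S) \<le> n" .
  qed
  also have "\<dots> \<ge> 0"
  proof (rule Bochner_Integration.integral_nonneg)
    fix t assume "t \<in> space \<mu>"
    then have "poly (up_factor k) t \<ge> 0"
      using mult_left_le_one_le[of t t] by (simp add: sp up_factor_def algebra_simps)
    then show "0 \<le> poly (upp p k * S) t" unfolding RS by (simp add: mult.assoc)
  qed
  finally have "p k \<le> 1" using w by (simp add: zero_le_mult_iff)
  with \<open>p k \<ge> 0\<close> ne[of k] k show ?case by force
qed

text \<open>By Helly's theorem. The limit measure is pushed forward under clamping to the unit interval, so
  that its support need not be located.\<close>

lemma closed_moment_space: "closed (moment_space n)"
  unfolding closed_sequential_limits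
proof (intro allI impI, elim conjE)
  fix x :: "nat \<Rightarrow> nat \<Rightarrow> real" and l
  assume x: "\<forall>k. x k \<in> moment_space n" and lim: "x \<longlonglongrightarrow> l"
  have "\<exists>\<mu>. prob_space \<mu> \<and> sets \<mu> = sets unit_sets \<and> (\<forall>i\<in>{1..n}. (\<integral>t. t ^ i \<partial>\<mu>) = x k i)" for k
    using x moment_spaceD by blast
  then obtain \<mu> where \<mu>: "\<And>k. prob_space (\<mu> k)" "\<And>k. sets (\<mu> k) = sets unit_sets"
    "\<And>k i. i \<in> {1..n} \<Longrightarrow> (\<integral>t. t ^ i \<partial>(\<mu> k)) = x k i"
    by metis
  have coord: "(\<lambda>k. x k i) \<longlonglongrightarrow> l i" for i
  proof -
    have "continuous_on UNIV (\<lambda>x :: nat \<Rightarrow> real. x i)" by simp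
    then have "isCont (\<lambda>x :: nat \<Rightarrow> real. x i) l"
      using continuous_on_eq_continuous_at[OF open_UNIV] by blast
    from isCont_tendsto_compose[OF this lim] show ?thesis .
  qed
  have sp: "space (\<mu> k) = {0..1}" for k
    using sets_eq_imp_space_eq[OF \<mu>(2)] by (simp add: space_restrict_space)
  define \<nu> where "\<nu> k = distr (\<mu> k) borel (\<lambda>t. t)" for k
  have id: "(\<lambda>t. t) \<in> \<mu> k \<rightarrow>\<^sub>M borel" for k
  proof -
    have "(\<lambda>t :: real. t) \<in> unit_sets \<rightarrow>\<^sub>M borel" by (intro measurable_restrict_space1) simp
    then show ?thesis using measurable_cong_sets[OF \<mu>(2) refl] by blast
  qed
  have rd: "real_distribution (\<nu> k)" for k
    unfolding \<nu>_def by (rule prob_space.real_distribution_distr[OF \<mu>(1) id])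
  have "tight \<nu>"
    unfolding tight_def
  proof (intro conjI allI impI rd)
    fix \<epsilon> :: real assume "\<epsilon> > 0"
    \<comment> \<open>Tightness speaks of intervals open on the left, so the left end must be
      negative to include 0.\<close>
    have "measure (\<nu> k) {-1<..1} = 1" for k
    proof -
      have "measure (\<nu> k) {-1<..1} = measure (\<mu> k) ((\<lambda>t. t) -` {-1<..1} \<inter> space (\<mu> k))"
        unfolding \<nu>_def by (rule measure_distr[OF id]) simp
      also have "(\<lambda>t. t) -` {-1<..1} \<inter> space (\<mu> k) = space (\<mu> k)" by (auto simp: sp)
      finally show ?thesis using prob_space.prob_space[OF \<mu>(1)] by simp
    qed
    then show "\<exists>a b. a < b \<and> (\<forall>k. measure (\<nu> k) {a<..b} > 1 - \<epsilon>)"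
      using \<open>\<epsilon> > 0\<close> by (intro exI[of _ "-1"] exI[of _ 1]) auto
  qed
  from tight_imp_convergent_subsubsequence[OF this strict_mono_id]
  obtain r M where r: "strict_mono (r :: nat \<Rightarrow> nat)" and M: "real_distribution M" and wc: "weak_conv_m (\<nu> \<circ> id \<circ> r) M"
    by blast
  interpret M: real_distribution M by fact
  define clamp where "clamp t = max 0 (min 1 t)" for t :: real
  have cl: "continuous_on UNIV clamp" unfolding clamp_def[abs_def] by (intro continuous_intros)
  have clm [measurable]: "clamp \<in> borel_measurable borel"
    using cl by (rule borel_measurable_continuous_onI)
  have cl01: "clamp t \<in> {0..1}" for t by (auto simp: clamp_def)
  have clu: "clamp \<in> M \<rightarrow>\<^sub>M unit_sets"
    by (intro measurable_restrict_space2) (use cl01 in auto)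
  let ?\<mu> = "distr M unit_sets clamp"
  show "l \<in> moment_space n"
  proof (rule moment_spaceI)
    show "prob_space ?\<mu>" by (rule M.prob_space_distr[OF clu])
    show "sets ?\<mu> = sets unit_sets" by simp
    show "l \<in> extensional {1..n}"
      unfolding extensional_def
    proof (intro CollectI allI impI)
      fix i assume "i \<notin> {1..n}"
      moreover have "x k \<in> extensional {1..n}" for k
        using x moment_space_extensional by blast
      ultimately have "x k i = undefined" for k
        using extensional_arb by metis
      then have "(\<lambda>k. undefined) \<longlonglongrightarrow> l i" using coord[of i] by simp
      then show "l i = undefined" by (simp add: LIMSEQ_const_iff)
    qed
    fix i assume i: "i \<in> {1..n}"
    let ?f = "\<lambda>t. clamp t ^ i"
    have cf: "continuous_on UNIV ?f" by (intro continuous_intros cl)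
    have "(\<lambda>k. integral\<^sup>L ((\<nu> \<circ> id \<circ> r) k) ?f) \<longlonglongrightarrow> integral\<^sup>L M ?f"
    proof (rule weak_conv_imp_integral_bdd_continuous_conv[OF _ M wc])
      show "real_distribution ((\<nu> \<circ> id \<circ> r) k)" for k using rd by simp
      show "isCont ?f t" for t using cf by (simp add: continuous_on_eq_continuous_at)
      show "norm (?f t) \<le> 1" for t using cl01[of t] by (simp add: power_le_one)
    qed
    moreover have "integral\<^sup>L ((\<nu> \<circ> id \<circ> r) k) ?f = x (r k) i" for k
    proof -
      have "integral\<^sup>L (\<nu> (r k)) ?f = (\<integral>t. ?f t \<partial>\<mu> (r k))"
        unfolding \<nu>_def by (rule integral_distr[OF id]) measurable
      \<comment> \<open>The measures of the sequence live on the unit interval, where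
        \<open>clamp\<close> is the identity.\<close>
      also have "\<dots> = (\<integral>t. t ^ i \<partial>\<mu> (r k))"
        by (rule Bochner_Integration.integral_cong) (auto simp: sp clamp_def)
      finally show ?thesis using \<mu>(3)[OF i] by simp
    qed
    ultimately have "(\<lambda>k. x (r k) i) \<longlonglongrightarrow> integral\<^sup>L M ?f" by simp
    moreover have "(\<lambda>k. x (r k) i) \<longlonglongrightarrow> l i"
      using LIMSEQ_subseq_LIMSEQ[OF coord[of i] r] by (simp add: comp_def)
    ultimately have "integral\<^sup>L M ?f = l i" by (rule LIMSEQ_unique)
    moreover have "(\<integral>t. t ^ i \<partial>?\<mu>) = integral\<^sup>L M ?f"
      by (rule integral_distr[OF clu]) (intro measurable_restrict_space1, simp)
    ultimately show "(\<integral>t. t ^ i \<partial>?\<mu>) = l i" by simp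
  qed
qed

lemma measurable_id_fun: "(\<lambda>x. x) \<in> Pi\<^sub>M {1..n :: nat} (\<lambda>_. borel :: real measure) \<rightarrow>\<^sub>M borel"
proof (rule measurable_coordinatewise_then_product)
  fix i
  have "continuous_on UNIV (\<lambda>x :: nat \<Rightarrow> real. x i)" by simp
  then show "(\<lambda>x. x i) \<in> borel_measurable (Pi\<^sub>M {1..n} (\<lambda>_. borel :: real measure))"
    by (rule measurable_continuous_fun)
qed

text \<open>A closed set is Borel for the product topology, and the identity from the finite product
  sigma-algebra into these Borel sets is measurable.\<close>

lemma moment_space_sets: "moment_space n \<in> sets (Pi\<^sub>M {1..n} (\<lambda>_. borel))"
proof -
  have "(\<lambda>x. x) -` moment_space n \<inter> space (Pi\<^sub>M {1..n} (\<lambda>_. borel :: real measure)) \<in> sets (Pi\<^sub>M {1..n} (\<lambda>_. borel))"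
    by (rule measurable_sets[OF measurable_id_fun borel_closed[OF closed_moment_space]])
  moreover have "moment_space n \<subseteq> space (Pi\<^sub>M {1..n} (\<lambda>_. borel :: real measure))"
    by (auto simp: moment_space_def space_PiM)
  ultimately show ?thesis by (simp add: inf_absorb1)
qed


section \<open>Triangular form and continuity of the substitution\<close>

lemma lowp_cong:
  assumes "\<And>i. 1 \<le> i \<Longrightarrow> i < n \<Longrightarrow> p i = q i"
  shows "lowp p n = lowp q n"
  unfolding lowp_def by (rule arg_cong[where f=fst], rule canpair_cong, rule assms)

lemma canw_cong: "(\<And>i. 1 \<le> i \<Longrightarrow> i < n \<Longrightarrow> p i = q i) \<Longrightarrow> canw p n = canw q n"
  unfolding canw_def by (intro prod.cong) auto

lemma canm_cong: "(\<And>i. 1 \<le> i \<Longrightarrow> i \<le> n \<Longrightarrow> p i = q i) \<Longrightarrow> canm p n = canm q n"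
proof (induction n rule: less_induct)
  case (less n)
  show ?case
  proof (cases "n = 0")
    case False
    have "canm p (i + n div 2) = canm q (i + n div 2)" if "i < (n + 1) div 2" for i
    proof -
      have "i + n div 2 < n" using that by presburger
      then show ?thesis using less.prems by (intro less.IH) auto
    qed
    moreover have "canw p n = canw q n" "lowp p n = lowp q n"
      using less.prems by (intro canw_cong lowp_cong; simp)+
    moreover have "p n = q n" using less.prems False by simp
    ultimately show ?thesis by (simp add: canm.simps[of _ n])
  qed simp
qed

text \<open>\<open>lowp p n\<close>, \<open>canw p n\<close> and the lower moments depend on earlier
  entries of \<open>p\<close> only. The slope \<open>canw p n\<close> is the diagonal entry of the
  Jacobian matrix.\<close>

lemma canm_affine:
  assumes "n \<ge> 1"
  shows "canm (p(n := z)) n = canm (p(n := 0)) n + canw p n * z"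
proof -
  have w: "canw (p(n := y)) n = canw p n" for y by (rule canw_cong) simp
  have l: "lowp (p(n := y)) n = lowp p n" for y by (rule lowp_cong) simp
  have c: "canm (p(n := y)) (i + n div 2) = canm p (i + n div 2)" if "i < (n + 1) div 2" for i y
  proof (rule canm_cong)
    fix j assume "j \<le> i + n div 2"
    then have "j < n" using that by presburger
    then show "(p(n := y)) j = p j" by simp
  qed
  have "canm (p(n := y)) n = canw p n * y - (\<Sum>i<(n + 1) div 2. coeff (lowp p n) i * canm p (i + n div 2))" for y
  proof -
    have S: "(\<Sum>i<(n + 1) div 2. coeff (lowp p n) i * canm (p(n := y)) (i + n div 2))
        = (\<Sum>i<(n + 1) div 2. coeff (lowp p n) i * canm p (i + n div 2))"
      by (intro sum.cong refl) (simp only: c lessThan_iff)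
    show ?thesis
      using assms unfolding canm.simps[of "p(n := y)" n] w l S by simp
  qed
  from this[of z] this[of 0] show ?thesis by simp
qed

lemma continuous_canpair:
  "continuous_on UNIV (\<lambda>p. coeff (fst (canpair p n)) i) \<and> continuous_on UNIV (\<lambda>p. coeff (snd (canpair p n)) i)"
proof (induction n arbitrary: i rule: induct_nat_012)
  case (ge2 n)
  note [continuous_intros] = conjunct1[OF ge2(2)] conjunct2[OF ge2(2)]
  have sh: "continuous_on UNIV (\<lambda>p. coeff (pCons 0 (q p)) i)"
    if "\<And>i. continuous_on UNIV (\<lambda>p. coeff (q p) i)" for q :: "(nat \<Rightarrow> real) \<Rightarrow> real poly" and i
    using that by (cases i) (auto simp: coeff_pCons)
  let ?k = "Suc n"
  let ?q = "\<lambda>p. smult (1 - p ?k) (fst (canpair p ?k))"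
  let ?F = "\<lambda>p. (if even ?k then pCons 0 (?q p) else ?q p) - smult (p ?k) (snd (canpair p ?k))"
  have q: "continuous_on UNIV (\<lambda>p. coeff (?q p) i)" for i
    unfolding coeff_smult by (intro continuous_intros)
  have F: "continuous_on UNIV (\<lambda>p. coeff (?F p) i)" for i
  proof (cases "even ?k")
    case True
    then show ?thesis unfolding coeff_diff coeff_smult if_P[OF True]
      by (intro continuous_on_diff sh q) (intro continuous_intros)
  next
    case False
    then show ?thesis unfolding coeff_diff coeff_smult if_not_P[OF False]
      by (intro continuous_intros)
  qed
  have dif: "continuous_on UNIV (\<lambda>p. coeff (q p - r p) i)"
    if "\<And>i. continuous_on UNIV (\<lambda>p. coeff (q p) i)" "\<And>i. continuous_on UNIV (\<lambda>p. coeff (r p) i)"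
    for q r :: "(nat \<Rightarrow> real) \<Rightarrow> real poly" and i
    unfolding coeff_diff by (intro continuous_on_diff that)
  have "continuous_on UNIV (\<lambda>p. coeff (?q p - (if even ?k then ?F p else pCons 0 (?F p))) i)" for i
  proof (cases "even ?k")
    case True
    show ?thesis using dif[of ?q ?F i, OF q F] True by (simp only: if_True)
  next
    case False
    show ?thesis using dif[of ?q "\<lambda>p. pCons 0 (?F p)" i, OF q sh[OF F]] False by (simp only: if_False)
  qed
  then show ?case using F unfolding canpair.simps Let_def fst_conv snd_conv by blast
qed simp_all

lemma continuous_canw [continuous_intros]: "continuous_on UNIV (\<lambda>p. canw p n)"
  unfolding canw_def by (intro continuous_intros)

lemma continuous_canm: "continuous_on UNIV (\<lambda>p. canm p n)"
proof (induction n rule: less_induct)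
  case (less n)
  show ?case
  proof (cases "n = 0")
    case False
    have "continuous_on UNIV (\<lambda>p. canw p n * p n - (\<Sum>i<(n + 1) div 2. coeff (lowp p n) i * canm p (i + n div 2)))"
    proof (intro continuous_on_diff continuous_on_sum continuous_on_mult continuous_canw continuous_on_product_coordinates)
      show "continuous_on UNIV (\<lambda>p. coeff (lowp p n) i)" for i
        unfolding lowp_def using continuous_canpair by blast
      fix i assume "i \<in> {..<(n + 1) div 2}"
      then have "i + n div 2 < n" by (simp only: lessThan_iff)
      then show "continuous_on UNIV (\<lambda>p. canm p (i + n div 2))" by (rule less.IH)
    qed
    then show ?thesis using False by (subst canm.simps) simp
  qed simp
qed

lemma measurable_Psi: "Psi n \<in> Pi\<^sub>M {1..n} (\<lambda>_. borel) \<rightarrow>\<^sub>M Pi\<^sub>M {1..n} (\<lambda>_. borel)"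
  unfolding Psi_def[abs_def]
  by (intro measurable_restrict measurable_continuous_fun continuous_canm)

lemma Psi_Suc: "Psi (Suc n) (p(Suc n := z)) = (Psi n p)(Suc n := canm (p(Suc n := 0)) (Suc n) + canw p (Suc n) * z)"
proof
  fix i
  have "canm (p(Suc n := z)) i = canm p i" if "i \<le> n"
    by (rule canm_cong) (use that in auto)
  then show "Psi (Suc n) (p(Suc n := z)) i = ((Psi n p)(Suc n := canm (p(Suc n := 0)) (Suc n) + canw p (Suc n) * z)) i"
    using canm_affine[of "Suc n" p z] by (auto simp: Psi_def)
qed

section \<open>Change of variables to canonical moments\<close>

lemma AE_lborel_pow_neq:
  assumes "i \<in> {1..n}" shows "AE p in lborel_pow n. p i \<noteq> c"
proof (rule AE_I)
  let ?N = "Pi\<^sub>E {1..n} (\<lambda>j. if j = i then {c} else UNIV)"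
  show "{p \<in> space (lborel_pow n). \<not> p i \<noteq> c} \<subseteq> ?N"
    by (auto simp: lborel_pow_def space_PiM PiE_def extensional_def)
  have "emeasure (lborel_pow n) ?N = (\<Prod>j\<in>{1..n}. emeasure lborel (if j = i then {c} else UNIV))"
    unfolding lborel_pow_def by (rule lborel_prod.emeasure_PiM) auto
  also have "\<dots> = 0" using assms by (intro prod_zero) auto
  finally show "emeasure (lborel_pow n) ?N = 0" .
  show "?N \<in> sets (lborel_pow n)"
    unfolding lborel_pow_def by (intro sets_PiM_I_finite) auto
qed

lemma nn_integral_lborel_pow_Suc:
  assumes "f \<in> borel_measurable (Pi\<^sub>M {1..Suc n} (\<lambda>_. borel))"
  shows "(\<integral>\<^sup>+x. f x \<partial>lborel_pow (Suc n)) = (\<integral>\<^sup>+x. (\<integral>\<^sup>+y. f (x(Suc n := y)) \<partial>lborel) \<partial>lborel_pow n)"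
proof -
  have ins: "{1..Suc n} = insert (Suc n) {1..n}" by auto
  have "f \<in> borel_measurable (lborel_pow (Suc n))"
    using assms by (simp cong: measurable_cong_sets)
  then show ?thesis
    unfolding lborel_pow_def ins by (intro lborel_prod.product_nn_integral_insert) auto
qed

lemma measurable_upd_pair:
  "(\<lambda>(x, y). x(Suc n := y)) \<in> Pi\<^sub>M {1..n} (\<lambda>_. borel :: real measure) \<Otimes>\<^sub>M borel \<rightarrow>\<^sub>M Pi\<^sub>M {1..Suc n} (\<lambda>_. borel)"
proof -
  have ins: "{1..Suc n} = insert (Suc n) {1..n}" by auto
  show ?thesis unfolding ins by (rule measurable_add_dim)
qed

text \<open>The substitution is made on all of \<open>\<real>\<^sup>n\<close>, so that its image need not be described. Its
  \<open>k\<close>-th entry is affine in \<open>p k\<close>, with slope \<open>0\<close> only where an earlier coordinate is \<open>0\<close> or \<open>1\<close>.\<close>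

lemma nn_integral_canonical:
  assumes "G \<in> borel_measurable (Pi\<^sub>M {1..n} (\<lambda>_. borel))"
  shows "(\<integral>\<^sup>+x. G x \<partial>lborel_pow n) = (\<integral>\<^sup>+p. G (Psi n p) * ennreal (\<Prod>k=1..n. \<bar>canw p k\<bar>) \<partial>lborel_pow n)"
  using assms
proof (induction n arbitrary: G)
  case 0
  have "Psi 0 p = (\<lambda>_. undefined)" for p by (simp add: Psi_def restrict_def)
  then show ?case by (simp add: lborel_pow_def PiM_empty nn_integral_count_space_finite)
next
  case (Suc n)
  let ?N = "Suc n" and ?P = "\<lambda>n. Pi\<^sub>M {1..n} (\<lambda>_. borel :: real measure)"
  let ?J = "\<lambda>n p. ennreal (\<Prod>k=1..n. \<bar>canw p k\<bar>)"
  \<comment> \<open>Integrating out the last moment leaves a function of the first \<open>n\<close>,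
    to which the induction hypothesis applies; hence \<open>G\<close> is arbitrary.\<close>
  define g where "g x = (\<integral>\<^sup>+y. G (x(?N := y)) \<partial>lborel)" for x
  have GG: "(\<lambda>(x, y). G (x(?N := y))) \<in> borel_measurable (?P n \<Otimes>\<^sub>M borel)"
    using measurable_compose[OF measurable_upd_pair Suc.prems] by (simp only: case_prod_unfold)
  have g: "g \<in> borel_measurable (?P n)"
    unfolding g_def
    by (rule sigma_finite_measure.borel_measurable_nn_integral[OF lborel.sigma_finite_measure_axioms])
       (use GG in \<open>simp add: measurable_cong_sets[OF sets_pair_measure_cong[OF refl sets_lborel] refl]\<close>)
  have Gx: "(\<lambda>y. G (x(?N := y))) \<in> borel_measurable borel" if "x \<in> extensional {1..n}" for x
  proof -
    have "x \<in> space (?P n)" using that by (simp add: space_PiM PiE_def)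
    from measurable_compose[OF measurable_Pair1'[OF this] GG] show ?thesis by simp
  qed
  have Jm: "?J n \<in> borel_measurable (?P n)" for n
    by (intro measurable_compose[OF _ measurable_ennreal] measurable_continuous_fun continuous_intros)
  have "(\<integral>\<^sup>+x. G x \<partial>lborel_pow ?N) = (\<integral>\<^sup>+x. g x \<partial>lborel_pow n)"
    unfolding g_def by (rule nn_integral_lborel_pow_Suc[OF Suc.prems])
  also have "\<dots> = (\<integral>\<^sup>+p. g (Psi n p) * ?J n p \<partial>lborel_pow n)" by (rule Suc.IH[OF g])
  also have "\<dots> = (\<integral>\<^sup>+p. (\<integral>\<^sup>+z. G (Psi ?N (p(?N := z))) * ?J ?N (p(?N := z)) \<partial>lborel) \<partial>lborel_pow n)"
  proof (rule nn_integral_cong_AE)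
    have "AE p in lborel_pow n. \<forall>i\<in>{1..n}. p i \<noteq> 0 \<and> p i \<noteq> 1"
      by (intro AE_finite_allI AE_conjI AE_lborel_pow_neq) auto
    then show "AE p in lborel_pow n. g (Psi n p) * ?J n p = (\<integral>\<^sup>+z. G (Psi ?N (p(?N := z))) * ?J ?N (p(?N := z)) \<partial>lborel)"
    proof eventually_elim
      fix p :: "nat \<Rightarrow> real" assume p: "\<forall>i\<in>{1..n}. p i \<noteq> 0 \<and> p i \<noteq> 1"
      let ?a = "canm (p(?N := 0)) ?N" and ?c = "canw p ?N"
      have c: "?c \<noteq> 0" unfolding canw_def using p by (auto simp: prod_zero_iff)
      have ext: "Psi n p \<in> extensional {1..n}" by (simp add: Psi_def)
      have w: "canw (p(?N := z)) k = canw p k" if "k \<le> ?N" for k z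
        by (rule canw_cong) (use that in auto)
      have J: "?J ?N (p(?N := z)) = ?J n p * ennreal \<bar>?c\<bar>" for z
      proof -
        have "(\<Prod>k=1..n. \<bar>canw (p(?N := z)) k\<bar>) = (\<Prod>k=1..n. \<bar>canw p k\<bar>)"
          by (intro prod.cong refl) (simp add: w)
        then show ?thesis by (simp add: w ennreal_mult prod_nonneg)
      qed
      \<comment> \<open>The one-dimensional affine substitution y = a + c z in the last moment, for
        fixed earlier entries.\<close>
      have "g (Psi n p) = \<bar>?c\<bar> * (\<integral>\<^sup>+z. G ((Psi n p)(?N := ?a + ?c * z)) \<partial>lborel)"
        unfolding g_def by (rule nn_integral_real_affine[OF Gx[OF ext] c])
      also have "\<dots> = \<bar>?c\<bar> * (\<integral>\<^sup>+z. G (Psi ?N (p(?N := z))) \<partial>lborel)"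
        by (simp only: Psi_Suc)
      finally have g': "g (Psi n p) = \<bar>?c\<bar> * (\<integral>\<^sup>+z. G (Psi ?N (p(?N := z))) \<partial>lborel)" .
      have "(\<lambda>z. G (Psi ?N (p(?N := z)))) \<in> borel_measurable borel"
      proof -
        have "(\<lambda>z. ?a + ?c * z) \<in> borel_measurable borel" by measurable
        from measurable_compose[OF this Gx[OF ext]] show ?thesis by (simp only: Psi_Suc)
      qed
      then have "(\<integral>\<^sup>+z. G (Psi ?N (p(?N := z))) * ?J ?N (p(?N := z)) \<partial>lborel)
          = (\<integral>\<^sup>+z. G (Psi ?N (p(?N := z))) \<partial>lborel) * (?J n p * ennreal \<bar>?c\<bar>)"
        unfolding J by (intro nn_integral_multc) simp
      then show "g (Psi n p) * ?J n p = (\<integral>\<^sup>+z. G (Psi ?N (p(?N := z))) * ?J ?N (p(?N := z)) \<partial>lborel)"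
        unfolding g' by (simp add: mult_ac)
    qed
  qed
  also have "\<dots> = (\<integral>\<^sup>+p. G (Psi ?N p) * ?J ?N p \<partial>lborel_pow ?N)"
    by (rule nn_integral_lborel_pow_Suc[symmetric])
       (intro borel_measurable_times_ennreal measurable_compose[OF measurable_Psi Suc.prems] Jm)
  finally show ?case .
qed

section \<open>Beta integrals and the value of the volume\<close>

lemma beta_unif: "integral\<^sup>L unif (\<lambda>x. x ^ a * (1 - x) ^ b) = fact a * fact b / fact (a + b + 1)"
proof (induction b arbitrary: a)
  case 0
  have "integral\<^sup>L unif (\<lambda>x. real (Suc a) * x ^ a) = 1 ^ Suc a - 0 ^ Suc a"
  proof (rule integral_unif_deriv[where F="\<lambda>x. x ^ Suc a"])
    show "((\<lambda>x. x ^ Suc a) has_real_derivative real (Suc a) * x ^ a) (at x)" for x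
      using DERIV_power_Suc[OF DERIV_ident, of a x UNIV] by (simp add: add.commute)
  qed (intro continuous_intros)
  then have "real (Suc a) * integral\<^sup>L unif (\<lambda>x. x ^ a) = 1" by (simp del: of_nat_Suc)
  then have I: "integral\<^sup>L unif (\<lambda>x. x ^ a) = 1 / real (Suc a)"
    by (simp add: eq_divide_eq mult.commute del: of_nat_Suc)
  show ?case by (simp add: I del: of_nat_Suc)
next
  case (Suc b)
  let ?I = "\<lambda>a b. integral\<^sup>L unif (\<lambda>x. x ^ a * (1 - x) ^ b)"
  have "integral\<^sup>L unif (\<lambda>x. real (Suc a) * (x ^ a * (1 - x) ^ Suc b) - real (Suc b) * (x ^ Suc a * (1 - x) ^ b))
      = 1 ^ Suc a * (1 - 1) ^ Suc b - 0 ^ Suc a * (1 - 0) ^ Suc b"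
  proof (rule integral_unif_deriv[where F="\<lambda>x. x ^ Suc a * (1 - x) ^ Suc b"])
    fix x :: real
    have d: "((\<lambda>x. 1 - x) has_real_derivative - 1) (at x)" by (auto intro!: derivative_eq_intros)
    show "((\<lambda>x. x ^ Suc a * (1 - x) ^ Suc b) has_real_derivative
      real (Suc a) * (x ^ a * (1 - x) ^ Suc b) - real (Suc b) * (x ^ Suc a * (1 - x) ^ b)) (at x)"
      using DERIV_mult[OF DERIV_power_Suc[OF DERIV_ident, of a x UNIV] DERIV_power_Suc[OF d, of b]]
      by (simp add: algebra_simps)
  qed (intro continuous_intros)
  also have "\<dots> = 0" by simp
  also have "integral\<^sup>L unif (\<lambda>x. real (Suc a) * (x ^ a * (1 - x) ^ Suc b) - real (Suc b) * (x ^ Suc a * (1 - x) ^ b))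
      = real (Suc a) * ?I a (Suc b) - real (Suc b) * ?I (Suc a) b"
  proof -
    have int: "integrable unif (\<lambda>x. x ^ i * (1 - x) ^ j)" for i j
      by (intro integrable_unif_continuous continuous_intros)
    show ?thesis
      unfolding Bochner_Integration.integral_diff[OF integrable_mult_right[OF int] integrable_mult_right[OF int]]
      by (simp only: integral_mult_right_zero)
  qed
  \<comment> \<open>Integration by parts trades one power of 1 - x for one of x, which is why the
    induction on \<open>b\<close> keeps \<open>a\<close> arbitrary.\<close>
  finally have "real (Suc a) * ?I a (Suc b) = real (Suc b) * ?I (Suc a) b"
    by (simp only: right_minus_eq)
  note E = this
  have div: "c * x = y \<Longrightarrow> c \<noteq> 0 \<Longrightarrow> x = y / c" for c x y :: real
    by (simp add: eq_divide_eq mult.commute)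
  have nz: "real (Suc a) \<noteq> 0" by (rule of_nat_neq_0)
  have cancel: "B * (A * f * g / h) / A = f * (B * g) / h" if "A \<noteq> 0" for A B f g h :: real
    using that by simp
  have "?I a (Suc b) = real (Suc b) * (real (Suc a) * fact a * fact b / fact (a + Suc b + 1)) / real (Suc a)"
    using div[OF E nz] unfolding Suc.IH fact_Suc[of a] by (simp only: add_Suc add_Suc_right)
  also have "\<dots> = fact a * fact (Suc b) / fact (a + Suc b + 1)"
    unfolding cancel[OF nz] fact_Suc[of b] ..
  finally show ?case .
qed

lemma nn_integral_beta:
  "(\<integral>\<^sup>+x. ennreal (indicator {0..1} x * (x * (1 - x)) ^ k) \<partial>lborel) = ennreal ((fact k)\<^sup>2 / fact (2 * k + 1))"
proof -
  have "(\<integral>\<^sup>+x. ennreal (indicator {0..1} x * (x * (1 - x)) ^ k) \<partial>lborel)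
      = (\<integral>\<^sup>+x. indicator {0..1} x * ennreal ((x * (1 - x)) ^ k) \<partial>lborel)"
    by (intro nn_integral_cong) (auto split: split_indicator)
  also have "\<dots> = (\<integral>\<^sup>+x. ennreal ((x * (1 - x)) ^ k) \<partial>unif)"
    unfolding unif_def by (subst nn_integral_density) auto
  also have "\<dots> = ennreal (integral\<^sup>L unif (\<lambda>x. (x * (1 - x)) ^ k))"
  proof (rule nn_integral_eq_integral)
    show "integrable unif (\<lambda>x. (x * (1 - x)) ^ k)"
      by (intro integrable_unif_continuous continuous_intros)
    show "AE x in unif. 0 \<le> (x * (1 - x)) ^ k"
      using AE_unif_cube by eventually_elim auto
  qed
  also have "integral\<^sup>L unif (\<lambda>x. (x * (1 - x)) ^ k) = (fact k)\<^sup>2 / fact (2 * k + 1)"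
    using beta_unif[of k k] by (simp only: power_mult_distrib power2_eq_square mult_2)
  finally show ?thesis .
qed

text \<open>The factor of index i occurs in \<open>canw p k\<close> exactly for k > i, hence n - i
  times among the k up to n.\<close>

lemma prod_canw: "(\<Prod>k=1..n. canw p k) = (\<Prod>i=1..n. (p i * (1 - p i)) ^ (n - i))"
proof (induction n)
  case (Suc n)
  have "(\<Prod>i=1..Suc n. (p i * (1 - p i)) ^ (Suc n - i)) = (\<Prod>i=1..n. (p i * (1 - p i)) ^ (n - i) * (p i * (1 - p i)))"
    by (simp add: Suc_diff_le mult.commute)
  also have "\<dots> = (\<Prod>k=1..n. canw p k) * canw p (Suc n)"
    by (simp only: prod.distrib[of "\<lambda>i. (p i * (1 - p i)) ^ (n - i)" "\<lambda>i. p i * (1 - p i)"]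
        Suc.IH[symmetric] canw_def[of p "Suc n"] atLeastLessThanSuc_atLeastAtMost)
  finally show ?case by simp
qed simp

text \<open>Where no coordinate is 0 or 1, \<open>Psi n p\<close> lies in the moment space exactly
  if \<open>p\<close> lies in the cube, by \<open>Psi_in_moment_space\<close> and
  \<open>canm_in_range\<close>. The integrand then splits into functions of single
  coordinates.\<close>

lemma vol_moment_space: "vol n (moment_space n) = moment_vol n"
proof -
  let ?b = "\<lambda>k x. indicator {0..1} x * (x * (1 - x)) ^ k :: real"
  have M: "indicator (moment_space n) \<in> borel_measurable (Pi\<^sub>M {1..n} (\<lambda>_. borel :: real measure))"
    by (intro borel_measurable_indicator moment_space_sets)
  have "emeasure (lborel_pow n) (moment_space n) = (\<integral>\<^sup>+x. indicator (moment_space n) x \<partial>lborel_pow n)"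
    using moment_space_sets[of n] by (intro nn_integral_indicator[symmetric]) simp
  also have "\<dots> = (\<integral>\<^sup>+p. indicator (moment_space n) (Psi n p) * ennreal (\<Prod>k=1..n. \<bar>canw p k\<bar>) \<partial>lborel_pow n)"
    by (rule nn_integral_canonical[OF M])
  also have "\<dots> = (\<integral>\<^sup>+p. (\<Prod>i\<in>{1..n}. ennreal (?b (n - i) (p i))) \<partial>lborel_pow n)"
  proof (rule nn_integral_cong_AE)
    have "AE p in lborel_pow n. \<forall>i\<in>{1..n}. p i \<noteq> 0 \<and> p i \<noteq> 1"
      by (intro AE_finite_allI AE_conjI AE_lborel_pow_neq) auto
    then show "AE p in lborel_pow n. indicator (moment_space n) (Psi n p) * ennreal (\<Prod>k=1..n. \<bar>canw p k\<bar>)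
        = (\<Prod>i\<in>{1..n}. ennreal (?b (n - i) (p i)))"
    proof eventually_elim
      fix p :: "nat \<Rightarrow> real" assume p: "\<forall>i\<in>{1..n}. p i \<noteq> 0 \<and> p i \<noteq> 1"
      show "indicator (moment_space n) (Psi n p) * ennreal (\<Prod>k=1..n. \<bar>canw p k\<bar>)
        = (\<Prod>i\<in>{1..n}. ennreal (?b (n - i) (p i)))"
      proof (cases "\<forall>i\<in>{1..n}. p i \<in> {0..1}")
        case True
        have p01: "0 < p i \<and> p i < 1" if "i \<in> {1..n}" for i
          using p True that by force
        \<comment> \<open>\<open>Psi_in_moment_space\<close> asks for an infinite sequence inside
          the open interval; 1/2 is an arbitrary filling that does not affect the first
          \<open>n\<close> moments.\<close>
        define q where "q i = (if i \<in> {1..n} then p i else 1 / 2)" for i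
        have "Psi n p = Psi n q"
          unfolding Psi_def by (intro restrict_ext canm_cong) (auto simp: q_def)
        moreover have "Psi n q \<in> moment_space n"
          by (rule Psi_in_moment_space) (use p01 in \<open>simp add: q_def\<close>)
        ultimately have "Psi n p \<in> moment_space n" by simp
        moreover have "(\<Prod>k=1..n. \<bar>canw p k\<bar>) = (\<Prod>i=1..n. (p i * (1 - p i)) ^ (n - i))"
        proof -
          have "canw p k > 0" if "k \<in> {1..n}" for k
            unfolding canw_def by (rule prod_pos) (use p01 that in auto)
          then have "(\<Prod>k=1..n. \<bar>canw p k\<bar>) = (\<Prod>k=1..n. canw p k)"
            by (intro prod.cong) (auto simp: less_imp_le)
          then show ?thesis by (simp only: prod_canw)
        qed
        moreover have "(\<Prod>i\<in>{1..n}. ennreal (?b (n - i) (p i))) = ennreal (\<Prod>i=1..n. (p i * (1 - p i)) ^ (n - i))"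
          using True by (subst prod_ennreal[symmetric]) (auto intro!: prod.cong)
        ultimately show ?thesis by simp
      next
        case False
        then obtain i where i: "i \<in> {1..n}" "p i \<notin> {0..1}" by blast
        have "Psi n p \<notin> moment_space n"
        proof
          assume "Psi n p \<in> moment_space n"
          then have "0 < p i \<and> p i < 1"
            by (rule canm_in_range[OF _ _ i(1)]) (use p in auto)
          then show False using i(2) by simp
        qed
        moreover have "(\<Prod>i\<in>{1..n}. ennreal (?b (n - i) (p i))) = 0"
          by (rule prod_zero) (use i in \<open>auto intro!: bexI[of _ i]\<close>)
        ultimately show ?thesis by simp
      qed
    qed
  qed
  also have "\<dots> = (\<Prod>i\<in>{1..n}. \<integral>\<^sup>+x. ennreal (?b (n - i) x) \<partial>lborel)"
    unfolding lborel_pow_def by (rule lborel_prod.product_nn_integral_prod) auto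
  also have "\<dots> = (\<Prod>i\<in>{1..n}. ennreal ((fact (n - i))\<^sup>2 / fact (2 * (n - i) + 1)))"
    by (simp only: nn_integral_beta)
  also have "\<dots> = ennreal (\<Prod>i=1..n. (fact (n - i))\<^sup>2 / fact (2 * (n - i) + 1))"
    by (rule prod_ennreal) simp
  also have "(\<Prod>i=1..n. (fact (n - i))\<^sup>2 / fact (2 * (n - i) + 1)) = moment_vol n"
    unfolding moment_vol_def
    by (rule prod.reindex_bij_witness[of _ "\<lambda>k. n - k" "\<lambda>i. n - i"]) auto
  finally have "emeasure (lborel_pow n) (moment_space n) = ennreal (moment_vol n)" .
  moreover have "moment_vol n \<ge> 0" by (simp add: moment_vol_def prod_nonneg)
  ultimately show ?thesis by (simp add: vol_def Sigma_Algebra.measure_def)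
qed

theorem theorem7p1:
  fixes m :: nat and s :: real
  assumes "m \<ge> 1" and "s \<in> {0..1}"
  shows "(\<forall>\<phi> :: real poly. degree \<phi> \<le> 2 * m - 1 \<longrightarrow>
      poly \<phi> s * vol (2 * m - 1) (moment_space (2 * m - 1)) =
        2 / (fact (2 * m - 1) * fact (m - 1))
          * cube_integral (m - 1) (\<lambda>t. Sigma_sum (m - 1) (poly \<phi>) t * Hc m s t)
        + poly \<phi> 0 / (fact (2 * m - 1) * fact (m - 1)) * cube_integral (m - 1) (\<lambda>t. Jc_ou m s t)
        + poly \<phi> 1 / (fact (2 * m - 1) * fact (m - 1)) * cube_integral (m - 1) (\<lambda>t. Jc_ol m s t))
    \<and> (\<forall>\<phi> :: real poly. degree \<phi> \<le> 2 * m \<longrightarrow>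
      poly \<phi> s * vol (2 * m) (moment_space (2 * m)) =
        - (2 / (fact (2 * m) * fact m))
          * cube_integral m (\<lambda>t. Sigma_sum m (poly \<phi>) t * (Jc_el m s t - Jc_el m 0 t))
        - 2 / (fact (2 * m) * fact (m - 1))
          * cube_integral (m - 1) (\<lambda>t. Sigma_sum (m - 1) (poly \<phi>) t * Jc_eu m s t)
        + poly \<phi> 0 / (fact (2 * m) * fact m) * cube_integral m (\<lambda>t. Jc_el m s t)
        - poly \<phi> 1 / (fact (2 * m) * fact (m - 1)) * cube_integral (m - 1) (\<lambda>t. Jc_eu m s t))"
proof (intro conjI allI impI)
  fix \<phi> :: "real poly"
  show "poly \<phi> s * vol (2 * m - 1) (moment_space (2 * m - 1)) =
        2 / (fact (2 * m - 1) * fact (m - 1))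
          * cube_integral (m - 1) (\<lambda>t. Sigma_sum (m - 1) (poly \<phi>) t * Hc m s t)
        + poly \<phi> 0 / (fact (2 * m - 1) * fact (m - 1)) * cube_integral (m - 1) (\<lambda>t. Jc_ou m s t)
        + poly \<phi> 1 / (fact (2 * m - 1) * fact (m - 1)) * cube_integral (m - 1) (\<lambda>t. Jc_ol m s t)"
    if "degree \<phi> \<le> 2 * m - 1"
    unfolding vol_moment_space by (rule odd_case[OF assms(1) that])
  show "poly \<phi> s * vol (2 * m) (moment_space (2 * m)) =
        - (2 / (fact (2 * m) * fact m))
          * cube_integral m (\<lambda>t. Sigma_sum m (poly \<phi>) t * (Jc_el m s t - Jc_el m 0 t))
        - 2 / (fact (2 * m) * fact (m - 1))
          * cube_integral (m - 1) (\<lambda>t. Sigma_sum (m - 1) (poly \<phi>) t * Jc_eu m s t)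
        + poly \<phi> 0 / (fact (2 * m) * fact m) * cube_integral m (\<lambda>t. Jc_el m s t)
        - poly \<phi> 1 / (fact (2 * m) * fact (m - 1)) * cube_integral (m - 1) (\<lambda>t. Jc_eu m s t)"
    if "degree \<phi> \<le> 2 * m"
    unfolding vol_moment_space by (rule even_case[OF assms(1) that])
qed

end
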